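(* Let $\mathsf{p}: P \to M$ be a surjective submersion of smooth manifolds and let $\star$ be a star product on $M$. Then $\mathsf{p}$ admits a deformation quantization with respect to $\star$, and any two deformation quantizations of $\mathsf{p}$ with respect to $\star$ are equivalent. Moreover, there exists a deformation quantization of $\mathsf{p}$ with respect to $\star$ which preserves the fibration.
   Context: All functions are smooth and complex valued; $\lambda$ is a formal parameter; maps are extended $\mathbb{C}[[\lambda]]$-(multi)linearly to formal power series. Star product: a star product $\star$ on $M$ is an associative $\mathbb{C}[[\lambda]]$-bilinear product on $C^\infty(M)[[\lambda]]$ of the form $a \star b = \sum_{r=0}^\infty \lambda^r C_r(a,b)$ with $C_0(a,b)=ab$, all $C_r$ bidifferential operators, and $1\star a = a = a\star 1$. Deformation quantization of the surjective submersion $\mathsf{p}$ (with respect to $\star$): a right module structure $\bullet$ of the algebra $(C^\infty(M)[[\lambda]],\star)$ on $C^\infty(P)[[\lambda]]$ of the form $f\bullet a = f\cdot \mathsf{p}^*a + \sum_{r=1}^\infty \lambda^r \rho_r(f,a)$ for $f\in C^\infty(P)[[\lambda]]$, $a\in C^\infty(M)[[\lambda]]$, with bidifferential operators $\rho_r$. Equivalence: two such $\bullet$ and $\tilde\bullet$ (for the same $\star$) are equivalent if there is a formal series $T=\mathrm{id}+\sum_{r=1}^\infty\lambda^r T_r$ of differential operators $T_r$ on $C^\infty(P)$ with $T(f\bullet a)=T(f)\mathbin{\tilde\bullet} a$ for all $f,a$. Preserving the fibration: $(\mathsf{p}^*a)\bullet b=\mathsf{p}^*(a\star b)$ for all $a,b\in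 C^\infty(M)[[\lambda]]$. *)

theory Defs
  imports
    "HOL-Analysis.Analysis"
    "HOL-Computational_Algebra.Formal_Power_Series"
    "HOL-Library.Function_Algebras"
begin

text \<open>
  A manifold has an entire type as its underlying topological space (Hausdorff and second
  countable by the type classes). It is modelled on a linear subspace \<open>V\<close> of a Euclidean space,
  and its dimension is \<open>dim V\<close>. A subspace is used instead of the whole Euclidean space because
  the class \<open>euclidean_space\<close> excludes dimension 0.
\<close>

record ('a, 'e) manifold =
  model :: "'e set"
  charts :: "('a set \<times> ('a \<Rightarrow> 'e)) set"

text \<open>
  \<open>Ck_on k V W f\<close> is meant for \<open>W\<close> relatively open in the subspace \<open>V\<close>. The derivative
  \<open>f' x\<close> of \<open>f\<close> within \<open>W\<close> is then uniquely determined on \<open>V\<close>, and only its values on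
  \<open>V\<close> are constrained further.
\<close>

primrec Ck_on ::
  "nat \<Rightarrow> 'e::euclidean_space set \<Rightarrow> 'e set \<Rightarrow> ('e \<Rightarrow> 'b::real_normed_vector) \<Rightarrow> bool" where
  "Ck_on 0 V W f \<longleftrightarrow> continuous_on W f"
| "Ck_on (Suc k) V W f \<longleftrightarrow>
     (\<exists>f'. (\<forall>x\<in>W. (f has_derivative f' x) (at x within W)) \<and>
           (\<forall>v\<in>V. Ck_on k V W (\<lambda>x. f' x v)))"

definition smooth_on ::
  "'e::euclidean_space set \<Rightarrow> 'e set \<Rightarrow> ('e \<Rightarrow> 'b::real_normed_vector) \<Rightarrow> bool" where
  "smooth_on V W f \<longleftrightarrow> (\<forall>k. Ck_on k V W f)"

definition smooth_manifold ::
  "('a::{t2_space, second_countable_topology}, 'e::euclidean_space) manifold \<Rightarrow> bool" where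
  "smooth_manifold M \<longleftrightarrow>
     subspace (model M) \<and>
     (\<Union>(U, \<phi>)\<in>charts M. U) = UNIV \<and>
     (\<forall>(U, \<phi>)\<in>charts M.
        open U \<and> openin (top_of_set (model M)) (\<phi> ` U) \<and>
        homeomorphism U (\<phi> ` U) \<phi> (inv_into U \<phi>)) \<and>
     (\<forall>(U, \<phi>)\<in>charts M. \<forall>(W, \<psi>)\<in>charts M.
        smooth_on (model M) (\<phi> ` (U \<inter> W)) (\<psi> \<circ> inv_into U \<phi>))"

definition smooth_functions ::
  "('a, 'e::euclidean_space) manifold \<Rightarrow> ('a \<Rightarrow> complex) set" where
  "smooth_functions M =
     {f. \<forall>(U, \<phi>)\<in>charts M. smooth_on (model M) (\<phi> ` U) (f \<circ> inv_into U \<phi>)}"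

definition smooth_map ::
  "('p::topological_space, 'e::euclidean_space) manifold \<Rightarrow>
   ('m::topological_space, 'f::euclidean_space) manifold \<Rightarrow> ('p \<Rightarrow> 'm) \<Rightarrow> bool" where
  "smooth_map P M p \<longleftrightarrow>
     continuous_on UNIV p \<and>
     (\<forall>(U, \<phi>)\<in>charts P. \<forall>(W, \<psi>)\<in>charts M.
        smooth_on (model P) (\<phi> ` (U \<inter> p -` W)) (\<psi> \<circ> p \<circ> inv_into U \<phi>))"

definition surjective_submersion ::
  "('p::topological_space, 'e::euclidean_space) manifold \<Rightarrow>
   ('m::topological_space, 'f::euclidean_space) manifold \<Rightarrow> ('p \<Rightarrow> 'm) \<Rightarrow> bool" where
  "surjective_submersion P M p \<longleftrightarrow>
     smooth_map P M p \<and> surj p \<and>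
     (\<forall>(U, \<phi>)\<in>charts P. \<forall>(W, \<psi>)\<in>charts M. \<forall>x\<in>U \<inter> p -` W.
        \<exists>D. ((\<psi> \<circ> p \<circ> inv_into U \<phi>) has_derivative D)
              (at (\<phi> x) within \<phi> ` (U \<inter> p -` W)) \<and>
            D ` model P = model M)"


text \<open>
  Products and sums of functions are pointwise. Operators are total HOL functions, but only their
  values on smooth functions matter. (Bi)differential operators are defined algebraically
  (Grothendieck): \<open>diff_op_below S k\<close> and \<open>bidiff_op_below S S' p k l\<close> say that the orders are
  strictly below the given bounds, so that an operator of order below 0 vanishes, and an operator
  has order below \<open>k + 1\<close> iff its commutators with multiplication operators have order
  below \<open>k\<close>.
\<close>

primrec diff_op_below ::
  "('a \<Rightarrow> complex) set \<Rightarrow> nat \<Rightarrow> (('a \<Rightarrow> complex) \<Rightarrow> ('a \<Rightarrow> complex)) \<Rightarrow> bool" where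
  "diff_op_below S 0 D \<longleftrightarrow> (\<forall>f\<in>S. D f = 0)"
| "diff_op_below S (Suc k) D \<longleftrightarrow> (\<forall>g\<in>S. diff_op_below S k (\<lambda>f. D (g * f) - g * D f))"

definition linear_op ::
  "('a \<Rightarrow> complex) set \<Rightarrow> ('b \<Rightarrow> complex) set \<Rightarrow>
   (('a \<Rightarrow> complex) \<Rightarrow> ('b \<Rightarrow> complex)) \<Rightarrow> bool" where
  "linear_op S S' D \<longleftrightarrow>
     (\<forall>f\<in>S. D f \<in> S') \<and>
     (\<forall>f\<in>S. \<forall>g\<in>S. D (f + g) = D f + D g) \<and>
     (\<forall>c. \<forall>f\<in>S. D (\<lambda>x. c * f x) = (\<lambda>x. c * D f x))"

definition differential_operator ::
  "('a, 'e::euclidean_space) manifold \<Rightarrow> (('a \<Rightarrow> complex) \<Rightarrow> ('a \<Rightarrow> complex)) \<Rightarrow> bool" where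
  "differential_operator M D \<longleftrightarrow>
     linear_op (smooth_functions M) (smooth_functions M) D \<and>
     (\<exists>k. diff_op_below (smooth_functions M) k D)"

text \<open>
  A bidifferential operator along \<open>p : P \<rightarrow> M\<close> is a map
  \<open>C\<^sup>\<infinity>(P) \<times> C\<^sup>\<infinity>(M) \<rightarrow> C\<^sup>\<infinity>(P)\<close>, where \<open>C\<^sup>\<infinity>(M)\<close> acts on the target by
  multiplication with pullbacks along \<open>p\<close>. Ordinary bidifferential operators on \<open>M\<close> are the
  case \<open>P = M\<close>, \<open>p = id\<close>.
\<close>

fun bidiff_op_below ::
  "('p \<Rightarrow> complex) set \<Rightarrow> ('m \<Rightarrow> complex) set \<Rightarrow> ('p \<Rightarrow> 'm) \<Rightarrow> nat \<Rightarrow> nat \<Rightarrow>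
   (('p \<Rightarrow> complex) \<Rightarrow> ('m \<Rightarrow> complex) \<Rightarrow> ('p \<Rightarrow> complex)) \<Rightarrow> bool" where
  "bidiff_op_below S S' p 0 l B \<longleftrightarrow> (\<forall>f\<in>S. \<forall>a\<in>S'. B f a = 0)"
| "bidiff_op_below S S' p (Suc k) 0 B \<longleftrightarrow> (\<forall>f\<in>S. \<forall>a\<in>S'. B f a = 0)"
| "bidiff_op_below S S' p (Suc k) (Suc l) B \<longleftrightarrow>
     (\<forall>g\<in>S. bidiff_op_below S S' p k (Suc l) (\<lambda>f a. B (g * f) a - g * B f a)) \<and>
     (\<forall>b\<in>S'. bidiff_op_below S S' p (Suc k) l (\<lambda>f a. B f (b * a) - (b \<circ> p) * B f a))"

definition bidifferential_operator ::
  "('p, 'e::euclidean_space) manifold \<Rightarrow> ('m, 'f::euclidean_space) manifold \<Rightarrow> ('p \<Rightarrow> 'm) \<Rightarrow>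
   (('p \<Rightarrow> complex) \<Rightarrow> ('m \<Rightarrow> complex) \<Rightarrow> ('p \<Rightarrow> complex)) \<Rightarrow> bool" where
  "bidifferential_operator P M p B \<longleftrightarrow>
     (\<forall>a\<in>smooth_functions M.
        linear_op (smooth_functions P) (smooth_functions P) (\<lambda>f. B f a)) \<and>
     (\<forall>f\<in>smooth_functions P.
        linear_op (smooth_functions M) (smooth_functions P) (\<lambda>a. B f a)) \<and>
     (\<exists>k l. bidiff_op_below (smooth_functions P) (smooth_functions M) p k l B)"


definition formal_functions ::
  "('a, 'e::euclidean_space) manifold \<Rightarrow> ('a \<Rightarrow> complex) fps set" where
  "formal_functions M = {a. \<forall>n. fps_nth a n \<in> smooth_functions M}"

definition formal_pullback ::
  "('p \<Rightarrow> 'm) \<Rightarrow> ('m \<Rightarrow> complex) fps \<Rightarrow> ('p \<Rightarrow> complex) fps" where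
  "formal_pullback p a = Abs_fps (\<lambda>n. fps_nth a n \<circ> p)"

definition formal_scalar :: "complex fps \<Rightarrow> ('a \<Rightarrow> complex) fps" where
  "formal_scalar c = Abs_fps (\<lambda>n x. fps_nth c n)"

text \<open>
  The extensions to formal power series, linear resp. bilinear over the formal power series
  in the parameter, of the series with \<open>r\<close>-th coefficient \<open>T r\<close> resp. \<open>B r\<close>.
\<close>

definition formal_op ::
  "(nat \<Rightarrow> ('a \<Rightarrow> complex) \<Rightarrow> ('b \<Rightarrow> complex)) \<Rightarrow>
   ('a \<Rightarrow> complex) fps \<Rightarrow> ('b \<Rightarrow> complex) fps" where
  "formal_op T f = Abs_fps (\<lambda>n. \<Sum>r\<le>n. T r (fps_nth f (n - r)))"

definition formal_biop ::
  "(nat \<Rightarrow> ('a \<Rightarrow> complex) \<Rightarrow> ('b \<Rightarrow> complex) \<Rightarrow> ('c \<Rightarrow> complex)) \<Rightarrow>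
   ('a \<Rightarrow> complex) fps \<Rightarrow> ('b \<Rightarrow> complex) fps \<Rightarrow> ('c \<Rightarrow> complex) fps" where
  "formal_biop B f a =
     Abs_fps (\<lambda>n. \<Sum>r\<le>n. \<Sum>i\<le>n - r. B r (fps_nth f i) (fps_nth a (n - r - i)))"

definition formal_bilinear ::
  "('a, 'e::euclidean_space) manifold \<Rightarrow> ('b, 'f::euclidean_space) manifold \<Rightarrow>
   (('a \<Rightarrow> complex) fps \<Rightarrow> ('b \<Rightarrow> complex) fps \<Rightarrow> ('c \<Rightarrow> complex) fps) \<Rightarrow> bool" where
  "formal_bilinear P M m \<longleftrightarrow>
     (\<forall>f\<in>formal_functions P. \<forall>g\<in>formal_functions P. \<forall>a\<in>formal_functions M.
        m (f + g) a = m f a + m g a) \<and>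
     (\<forall>f\<in>formal_functions P. \<forall>a\<in>formal_functions M. \<forall>b\<in>formal_functions M.
        m f (a + b) = m f a + m f b) \<and>
     (\<forall>c. \<forall>f\<in>formal_functions P. \<forall>a\<in>formal_functions M.
        m (formal_scalar c * f) a = formal_scalar c * m f a \<and>
        m f (formal_scalar c * a) = formal_scalar c * m f a)"


definition star_product ::
  "('m, 'f::euclidean_space) manifold \<Rightarrow>
   (('m \<Rightarrow> complex) fps \<Rightarrow> ('m \<Rightarrow> complex) fps \<Rightarrow> ('m \<Rightarrow> complex) fps) \<Rightarrow> bool" where
  "star_product M star \<longleftrightarrow>
     (\<exists>C. (\<forall>r. bidifferential_operator M M id (C r)) \<and>
          (\<forall>a\<in>smooth_functions M. \<forall>b\<in>smooth_functions M. C 0 a b = a * b) \<and>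
          (\<forall>a\<in>formal_functions M. \<forall>b\<in>formal_functions M. star a b = formal_biop C a b)) \<and>
     formal_bilinear M M star \<and>
     (\<forall>a\<in>formal_functions M. \<forall>b\<in>formal_functions M. \<forall>c\<in>formal_functions M.
        star (star a b) c = star a (star b c)) \<and>
     (\<forall>a\<in>formal_functions M. star 1 a = a \<and> star a 1 = a)"

definition deformation_quantization ::
  "('p, 'e::euclidean_space) manifold \<Rightarrow> ('m, 'f::euclidean_space) manifold \<Rightarrow> ('p \<Rightarrow> 'm) \<Rightarrow>
   (('m \<Rightarrow> complex) fps \<Rightarrow> ('m \<Rightarrow> complex) fps \<Rightarrow> ('m \<Rightarrow> complex) fps) \<Rightarrow>
   (('p \<Rightarrow> complex) fps \<Rightarrow> ('m \<Rightarrow> complex) fps \<Rightarrow> ('p \<Rightarrow> complex) fps) \<Rightarrow> bool" where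
  "deformation_quantization P M p star act \<longleftrightarrow>
     (\<exists>\<rho>. (\<forall>r. bidifferential_operator P M p (\<rho> r)) \<and>
          (\<forall>f\<in>smooth_functions P. \<forall>a\<in>smooth_functions M. \<rho> 0 f a = f * (a \<circ> p)) \<and>
          (\<forall>f\<in>formal_functions P. \<forall>a\<in>formal_functions M. act f a = formal_biop \<rho> f a)) \<and>
     formal_bilinear P M act \<and>
     (\<forall>f\<in>formal_functions P. \<forall>a\<in>formal_functions M. \<forall>b\<in>formal_functions M.
        act (act f a) b = act f (star a b)) \<and>
     (\<forall>f\<in>formal_functions P. act f 1 = f)"

definition equivalent_quantizations ::
  "('p, 'e::euclidean_space) manifold \<Rightarrow> ('m, 'f::euclidean_space) manifold \<Rightarrow>
   (('p \<Rightarrow> complex) fps \<Rightarrow> ('m \<Rightarrow> complex) fps \<Rightarrow> ('p \<Rightarrow> complex) fps) \<Rightarrow>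
   (('p \<Rightarrow> complex) fps \<Rightarrow> ('m \<Rightarrow> complex) fps \<Rightarrow> ('p \<Rightarrow> complex) fps) \<Rightarrow> bool" where
  "equivalent_quantizations P M act act' \<longleftrightarrow>
     (\<exists>T. (\<forall>r. differential_operator P (T r)) \<and>
          (\<forall>f\<in>smooth_functions P. T 0 f = f) \<and>
          (\<forall>f\<in>formal_functions P. \<forall>a\<in>formal_functions M.
             formal_op T (act f a) = act' (formal_op T f) a))"

definition preserves_fibration ::
  "('m, 'f::euclidean_space) manifold \<Rightarrow> ('p \<Rightarrow> 'm) \<Rightarrow>
   (('m \<Rightarrow> complex) fps \<Rightarrow> ('m \<Rightarrow> complex) fps \<Rightarrow> ('m \<Rightarrow> complex) fps) \<Rightarrow>
   (('p \<Rightarrow> complex) fps \<Rightarrow> ('m \<Rightarrow> complex) fps \<Rightarrow> ('p \<Rightarrow> complex) fps) \<Rightarrow> bool" where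
  "preserves_fibration M p star act \<longleftrightarrow>
     (\<forall>a\<in>formal_functions M. \<forall>b\<in>formal_functions M.
        act (formal_pullback p a) b = formal_pullback p (star a b))"

end

theory Submission
  imports Defs
begin

text \<open>
  Order by order in \<open>\<lambda>\<close>, the obstruction to extending a module structure, respectively an
  equivalence, is a Hochschild 2-cocycle, respectively 1-cocycle, of \<open>A = C\<^sup>\<infinity>(M)\<close> with values in the
  differential operators on \<open>S = C\<^sup>\<infinity>(P)\<close>. The Hochschild differential is left \<open>S\<close>-linear, so local
  primitives can be glued by a partition of unity on \<open>P\<close>.

  A cochain is a functional on \<open>S \<otimes> A \<otimes> \<dots>\<close>, and primitives are obtained by evaluating a cocycle on
  \<open>s(f) \<otimes> \<dots>\<close>, where \<open>s : S \<rightarrow> S \<otimes> A\<close> is a splitting of the multiplication that is \<open>A\<close>-linear modulo a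
  high power of the ideal \<open>I\<close> generated by the elements \<open>p\<^sup>*u \<otimes> 1 - 1 \<otimes> u\<close>. Locally there are
  coordinates \<open>x\<^sub>i\<close> on \<open>M\<close> and vector fields \<open>X\<^sub>i\<close> on \<open>P\<close> with \<open>X\<^sub>i(p\<^sup>*x\<^sub>j) = \<delta>\<^sub>i\<^sub>j\<close>. The derivation
  \<open>\<theta> = \<Sum>\<^sub>i (1 \<otimes> x\<^sub>i - p\<^sup>*x\<^sub>i \<otimes> 1)(X\<^sub>i \<otimes> 1)\<close> acts as \<open>-k\<close> on \<open>I\<^sup>k/I\<^sup>k\<^sup>+\<^sup>1\<close>, so
  \<open>s(f) = \<Prod>\<^sub>k (1 + \<theta>/k)(f \<otimes> 1)\<close> is such a splitting; no commutation of the \<open>X\<^sub>i\<close> is needed. Since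
  \<open>s(p\<^sup>*a) = 1 \<otimes> a\<close> modulo this power of \<open>I\<close>, the module structure built in this way preserves the fibration.
\<close>

section \<open>Differential operators along a map\<close>

text \<open>Write \<open>t(u)\<close> for \<open>p\<^sup>*u \<otimes> 1 - 1 \<otimes> u\<close>. The
  eigenvalues of \<theta> come from \<open>\<theta>(t(u)) = - t(u)\<close> modulo
  \<open>I\<^sup>2\<close>, since \<theta> is a derivation and linear over
  \<open>1 \<otimes> A\<close>. The factor \<open>1 + \<theta>/k\<close> therefore maps
  \<open>I\<^sup>k\<close> into \<open>I\<^sup>k\<^sup>+\<^sup>1\<close>, and the product over k
  from 1 to N maps \<open>I\<close> into \<open>I\<^sup>N\<^sup>+\<^sup>1\<close>. The defect of
  \<open>A\<close>-linearity of \<open>s\<close> is this product applied to an element of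
  \<open>I\<close>.

  The congruence turns into an equality because an operator of bounded order annihilates a power of
  \<open>I\<close>. The number of factors is fixed by the orders of the cocycle, before the homotopy
  raises them.

  The obstacle is that operators are given by commutators only, without symbols or local coordinate
  expressions. Locality has to be derived from cutoff functions, and Taylor expansion from
  Hadamard's lemma. Tensor products and ideals are never formed: an element of
  \<open>S \<otimes> A\<close> appears as an argument pair, and multiplication by
  \<open>t(u)\<close> as an operation on operators.\<close>

definition function_algebra :: "('a \<Rightarrow> complex) set \<Rightarrow> bool" where
  "function_algebra S \<longleftrightarrow>
     (\<forall>c. (\<lambda>_. c) \<in> S) \<and> (\<forall>f\<in>S. \<forall>g\<in>S. f + g \<in> S) \<and> (\<forall>f\<in>S. \<forall>g\<in>S. f * g \<in> S)"

lemma function_algebraD: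
  assumes "function_algebra S"
  shows "(\<lambda>_. c) \<in> S" "f \<in> S \<Longrightarrow> g \<in> S \<Longrightarrow> f + g \<in> S" "f \<in> S \<Longrightarrow> g \<in> S \<Longrightarrow> f * g \<in> S"
    "0 \<in> S" "1 \<in> S" "f \<in> S \<Longrightarrow> - f \<in> S" "f \<in> S \<Longrightarrow> g \<in> S \<Longrightarrow> f - g \<in> S"
    "(\<And>i. i \<in> I \<Longrightarrow> F i \<in> S) \<Longrightarrow> sum F I \<in> S"
proof -
  show c: "(\<lambda>_. c) \<in> S" for c using assms by (simp add: function_algebra_def)
  show a: "f \<in> S \<Longrightarrow> g \<in> S \<Longrightarrow> f + g \<in> S" for f g using assms by (simp add: function_algebra_def)
  show m: "f \<in> S \<Longrightarrow> g \<in> S \<Longrightarrow> f * g \<in> S" for f g using assms by (simp add: function_algebra_def)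
  show z: "0 \<in> S" using c[of 0] by (simp add: zero_fun_def)
  show "1 \<in> S" using c[of 1] by (simp add: one_fun_def)
  show n: "f \<in> S \<Longrightarrow> - f \<in> S" for f using m[OF c[of "-1"], of f] by (simp add: times_fun_def fun_Compl_def)
  show "f \<in> S \<Longrightarrow> g \<in> S \<Longrightarrow> f - g \<in> S" using a[OF _ n, of f g] by simp
  show "(\<And>i. i \<in> I \<Longrightarrow> F i \<in> S) \<Longrightarrow> sum F I \<in> S"
    by (induction I rule: infinite_finite_induct) (auto intro: z a)
qed

lemma sum_fun_apply: "(\<Sum>i\<in>I. F i) z = (\<Sum>i\<in>I. F i z)"
  for F :: "'i \<Rightarrow> 'a \<Rightarrow> 'b::comm_monoid_add"
  by (induction I rule: infinite_finite_induct) auto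

lemma pullback_simps [simp]:
  "(f * g) \<circ> q = (f \<circ> q) * (g \<circ> q)" "(f + g) \<circ> q = (f \<circ> q) + (g \<circ> q)"
  "(\<lambda>_. c) \<circ> q = (\<lambda>_. c)" "1 \<circ> q = 1" "0 \<circ> q = 0" "(- f') \<circ> q = - (f' \<circ> q)"
  "(f' - g') \<circ> q = (f' \<circ> q) - (g' \<circ> q)"
  for f g :: "'a \<Rightarrow> 'b::semiring_1" and f' g' :: "'a \<Rightarrow> 'c::ring_1"
  by (auto simp: fun_eq_iff)

lemmas pointwise = plus_fun_apply times_fun_apply zero_fun_apply one_fun_apply minus_apply
  uminus_apply comp_apply

text \<open>As simp rules, these would also rewrite eta-expanded products of functions under operators.\<close>

declare pointwise [simp del]

lemma linear_opD:
  assumes "linear_op S S' D"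
  shows "f \<in> S \<Longrightarrow> D f \<in> S'" "f \<in> S \<Longrightarrow> g \<in> S \<Longrightarrow> D (f + g) = D f + D g"
    "f \<in> S \<Longrightarrow> D ((\<lambda>_. c) * f) = (\<lambda>_. c) * D f"
  using assms by (simp_all add: linear_op_def times_fun_def)

lemma linear_opD':
  assumes "linear_op S S' D" "function_algebra S"
  shows "D 0 = 0" "f \<in> S \<Longrightarrow> D (- f) = - D f" "f \<in> S \<Longrightarrow> g \<in> S \<Longrightarrow> D (f - g) = D f - D g"
    "(\<And>i. i \<in> I \<Longrightarrow> F i \<in> S) \<Longrightarrow> D (\<Sum>i\<in>I. F i) = (\<Sum>i\<in>I. D (F i))"
proof -
  note S = function_algebraD[OF assms(2)] and D = linear_opD[OF assms(1)]
  have *: "(\<lambda>_. c) * g = (\<lambda>x. c * g x)" for c and g :: "'z \<Rightarrow> complex" by (simp add: times_fun_def)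
  show z: "D 0 = 0" using D(3)[of 0 0] S(4) by (simp add: * zero_fun_def)
  show n: "f \<in> S \<Longrightarrow> D (- f) = - D f" for f using D(3)[of f "-1"] by (simp add: * fun_Compl_def)
  show "f \<in> S \<Longrightarrow> g \<in> S \<Longrightarrow> D (f - g) = D f - D g"
    using D(2)[of f "- g"] n[of g] S(6)[of g] by simp
  show "(\<And>i. i \<in> I \<Longrightarrow> F i \<in> S) \<Longrightarrow> D (\<Sum>i\<in>I. F i) = (\<Sum>i\<in>I. D (F i))"
    by (induction I rule: infinite_finite_induct) (auto simp: z D S)
qed

lemma linear_opI:
  assumes "\<And>f. f \<in> S \<Longrightarrow> D f \<in> S'" "\<And>f g. f \<in> S \<Longrightarrow> g \<in> S \<Longrightarrow> D (f + g) = D f + D g"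
    "\<And>c f. f \<in> S \<Longrightarrow> D ((\<lambda>_. c) * f) = (\<lambda>_. c) * D f"
  shows "linear_op S S' D"
  using assms unfolding linear_op_def times_fun_def by auto

lemma linear_op_add:
  assumes "linear_op S S' D" "linear_op S S' E" "function_algebra S'"
  shows "linear_op S S' (\<lambda>f. D f + E f)"
  by (rule linear_opI)
    (simp_all add: linear_opD[OF assms(1)] linear_opD[OF assms(2)] function_algebraD[OF assms(3)]
      distrib_left add.commute add.left_commute)

lemma linear_op_diff:
  assumes "linear_op S S' D" "linear_op S S' E" "function_algebra S'"
  shows "linear_op S S' (\<lambda>f. D f - E f)"
  by (rule linear_opI)
    (simp_all add: linear_opD[OF assms(1)] linear_opD[OF assms(2)] function_algebraD[OF assms(3)]
      right_diff_distrib)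

lemma linear_op_mult_left:
  assumes "linear_op S S' D" "h \<in> S'" "function_algebra S'"
  shows "linear_op S S' (\<lambda>f. h * D f)"
  by (rule linear_opI)
    (simp_all add: linear_opD[OF assms(1)] assms(2) function_algebraD[OF assms(3)]
      distrib_left mult.left_commute)

lemma linear_op_zero: "function_algebra S' \<Longrightarrow> linear_op S S' (\<lambda>f. 0)"
  by (rule linear_opI) (auto simp: function_algebraD)

lemma linear_op_sum:
  "(\<And>i. i \<in> I \<Longrightarrow> linear_op S S' (D i)) \<Longrightarrow> function_algebra S' \<Longrightarrow>
     linear_op S S' (\<lambda>f. \<Sum>i\<in>I. D i f)"
  by (induction I rule: infinite_finite_induct) (auto simp: linear_op_zero linear_op_add)

lemma linear_op_compose:
  assumes "linear_op S S' C" "linear_op S' S'' D"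
  shows "linear_op S S'' (\<lambda>f. D (C f))"
  by (rule linear_opI) (simp_all add: linear_opD[OF assms(1)] linear_opD[OF assms(2)])

lemma linear_op_mult:
  assumes "function_algebra S" "g \<in> S"
  shows "linear_op S S (\<lambda>f. g * f)"
  by (rule linear_opI) (simp_all add: function_algebraD[OF assms(1)] assms(2) distrib_left mult.left_commute)

text \<open>Both slots of a bidifferential operator are instances: the first one along
  \<open>id\<close> on \<open>S\<close>, the second one along \<open>p\<close>, with
  \<open>A\<close> acting on the target through pullbacks. One calculus of orders thus serves
  both.\<close>

primrec diff_op_along ::
  "('a \<Rightarrow> complex) set \<Rightarrow> ('b \<Rightarrow> 'a) \<Rightarrow> nat \<Rightarrow> (('a \<Rightarrow> complex) \<Rightarrow> ('b \<Rightarrow> complex)) \<Rightarrow> bool" where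
  "diff_op_along A q 0 D \<longleftrightarrow> (\<forall>a\<in>A. D a = 0)"
| "diff_op_along A q (Suc k) D \<longleftrightarrow>
     (\<forall>g\<in>A. diff_op_along A q k (\<lambda>a. D (g * a) - (g \<circ> q) * D a))"

lemma diff_op_below_iff_along: "diff_op_below S k D \<longleftrightarrow> diff_op_along S id k D"
  by (induction k arbitrary: D) auto

context
  fixes A :: "('a \<Rightarrow> complex) set" and q :: "'b \<Rightarrow> 'a"
  assumes A: "function_algebra A"
begin

text \<open>Operators are total functions of which only the values on \<open>A\<close> matter.
  Multiplication by \<open>g\<close> stays inside \<open>A\<close>, so the commutators agree on
  \<open>A\<close> as well.\<close>

lemma diff_op_along_cong:
  "diff_op_along A q k D \<Longrightarrow> (\<And>a. a \<in> A \<Longrightarrow> D a = E a) \<Longrightarrow> diff_op_along A q k E"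
proof (induction k arbitrary: D E)
  case (Suc k)
  have "diff_op_along A q k (\<lambda>a. E (g * a) - (g \<circ> q) * E a)" if g: "g \<in> A" for g
  proof (rule Suc.IH)
    show "diff_op_along A q k (\<lambda>a. D (g * a) - (g \<circ> q) * D a)" using Suc.prems(1) g by simp
    show "D (g * a) - (g \<circ> q) * D a = E (g * a) - (g \<circ> q) * E a" if "a \<in> A" for a
      using Suc.prems(2)[of a] Suc.prems(2)[of "g * a"] function_algebraD(3)[OF A g that] that
      by (simp only:)
  qed
  then show ?case by simp
qed auto

lemma diff_op_along_zero: "diff_op_along A q k (\<lambda>a. 0)"
proof (induction k)
  case (Suc k)
  then have "diff_op_along A q k (\<lambda>a. 0 - (g \<circ> q) * 0)" for g
    by (simp only: mult_zero_right diff_self)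
  then show ?case by (simp only: diff_op_along.simps) blast
qed (simp only: diff_op_along.simps, blast)

lemma diff_op_along_zero': "(\<And>a. a \<in> A \<Longrightarrow> D a = 0) \<Longrightarrow> diff_op_along A q k D"
  by (rule diff_op_along_cong[OF diff_op_along_zero]) simp

lemma diff_op_along_add:
  "diff_op_along A q k D \<Longrightarrow> diff_op_along A q k E \<Longrightarrow> diff_op_along A q k (\<lambda>a. D a + E a)"
proof (induction k arbitrary: D E)
  case (Suc k)
  have "diff_op_along A q k (\<lambda>a. D (g * a) + E (g * a) - (g \<circ> q) * (D a + E a))" if g: "g \<in> A" for g
  proof (rule diff_op_along_cong[OF Suc.IH])
    show "diff_op_along A q k (\<lambda>a. D (g * a) - (g \<circ> q) * D a)" using Suc.prems(1) g by simp
    show "diff_op_along A q k (\<lambda>a. E (g * a) - (g \<circ> q) * E a)" using Suc.prems(2) g by simp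
    show "D (g * a) - (g \<circ> q) * D a + (E (g * a) - (g \<circ> q) * E a) =
        D (g * a) + E (g * a) - (g \<circ> q) * (D a + E a)" for a
      by (simp add: distrib_left)
  qed
  then show ?case by simp
qed simp

lemma diff_op_along_mult_left:
  "diff_op_along A q k D \<Longrightarrow> diff_op_along A q k (\<lambda>a. h * D a)"
proof (induction k arbitrary: D)
  case (Suc k)
  have "diff_op_along A q k (\<lambda>a. h * D (g * a) - (g \<circ> q) * (h * D a))" if g: "g \<in> A" for g
  proof (rule diff_op_along_cong[OF Suc.IH])
    show "diff_op_along A q k (\<lambda>a. D (g * a) - (g \<circ> q) * D a)" using Suc.prems(1) g by simp
    show "h * (D (g * a) - (g \<circ> q) * D a) = h * D (g * a) - (g \<circ> q) * (h * D a)" for a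
      by (simp add: right_diff_distrib mult.left_commute)
  qed
  then show ?case by simp
qed simp

lemma diff_op_along_mult_right:
  "diff_op_along A q k D \<Longrightarrow> b \<in> A \<Longrightarrow> diff_op_along A q k (\<lambda>a. D (b * a))"
proof (induction k arbitrary: D)
  case (Suc k)
  have "diff_op_along A q k (\<lambda>a. D (b * (g * a)) - (g \<circ> q) * D (b * a))" if g: "g \<in> A" for g
  proof (rule diff_op_along_cong[OF Suc.IH])
    show "diff_op_along A q k (\<lambda>a. D (g * a) - (g \<circ> q) * D a)" using Suc.prems(1) g by simp
    show "D (g * (b * a)) - (g \<circ> q) * D (b * a) = D (b * (g * a)) - (g \<circ> q) * D (b * a)" for a
      by (simp add: mult.left_commute)
  qed (fact Suc.prems(2))
  then show ?case by simp
qed (simp add: function_algebraD[OF A])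

lemma diff_op_along_diff:
  "diff_op_along A q k D \<Longrightarrow> diff_op_along A q k E \<Longrightarrow> diff_op_along A q k (\<lambda>a. D a - E a)"
  using diff_op_along_add[of k D "\<lambda>a. (-1) * E a"] diff_op_along_mult_left[of k E "-1"] by simp

lemma diff_op_along_sum:
  "(\<And>i. i \<in> I \<Longrightarrow> diff_op_along A q k (D i)) \<Longrightarrow> diff_op_along A q k (\<lambda>a. \<Sum>i\<in>I. D i a)"
  by (induction I rule: infinite_finite_induct) (simp_all add: diff_op_along_zero diff_op_along_add)

lemma diff_op_along_Suc: "diff_op_along A q k D \<Longrightarrow> diff_op_along A q (Suc k) D"
  by (induction k arbitrary: D) (auto simp: function_algebraD[OF A])

lemma diff_op_along_mono: "diff_op_along A q k D \<Longrightarrow> k \<le> l \<Longrightarrow> diff_op_along A q l D"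
  by (induction l) (auto simp: le_Suc_eq diff_op_along_Suc simp del: diff_op_along.simps)

end

text \<open>The commutator of \<open>D \<circ> C\<close> with \<open>g\<close> telescopes into
  \<open>D\<close> after the commutator of \<open>C\<close> with \<open>g\<close>, plus the
  commutator of \<open>D\<close> with \<open>g \<circ> r\<close> after \<open>C\<close>. Each
  summand lowers one of the two bounds by one, hence the induction on \<open>k + l\<close>.\<close>

lemma diff_op_along_compose:
  assumes A: "function_algebra A" and B: "function_algebra B"
    and pull: "\<And>a. a \<in> A \<Longrightarrow> a \<circ> r \<in> B"
  shows "diff_op_along A r l C \<Longrightarrow> diff_op_along B q k D \<Longrightarrow> (\<And>a. a \<in> A \<Longrightarrow> C a \<in> B) \<Longrightarrow>
    (\<And>a b. a \<in> B \<Longrightarrow> b \<in> B \<Longrightarrow> D (a + b) = D a + D b) \<Longrightarrow>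
    diff_op_along A (r \<circ> q) (k + l) (\<lambda>a. D (C a))"
proof (induction "k + l" arbitrary: k l C D)
  case 0
  have "D (C a) = 0" if "a \<in> A" for a
    using 0 that by simp
  then show ?case by (rule diff_op_along_zero'[OF A])
next
  case (Suc n)
  note SA = function_algebraD[OF A] and SB = function_algebraD[OF B]
  note lin = Suc.prems(4) and CB = Suc.prems(3)
  have D0: "D 0 = 0" using lin[of 0 0] SB(4) by simp
  have Dd: "D (a - b) = D a - D b" if "a \<in> B" "b \<in> B" for a b
    using lin[of "a - b" b] SB(7)[of a b] that by simp
  show ?case
  proof (cases "k = 0 \<or> l = 0")
    case True
    then have "D (C a) = 0" if "a \<in> A" for a
    proof
      assume "k = 0"
      then show ?thesis using Suc.prems(2) CB[OF that] by simp
    next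
      assume "l = 0"
      then show ?thesis using Suc.prems(1) that D0 by simp
    qed
    then show ?thesis
      by (rule diff_op_along_zero'[OF A])
  next
    case False
    then obtain k' l' where kl: "k = Suc k'" "l = Suc l'" by (meson not0_implies_Suc)
    have n: "n = k + l'" "n = k' + l" using Suc.hyps(2) kl by auto
    have "diff_op_along A (r \<circ> q) n (\<lambda>a. D (C (g * a)) - (g \<circ> (r \<circ> q)) * D (C a))" if g: "g \<in> A" for g
    proof -
      have gB: "g \<circ> r \<in> B" using g by (rule pull)
      have 1: "diff_op_along A (r \<circ> q) n (\<lambda>a. D (C (g * a) - (g \<circ> r) * C a))"
        unfolding n(1)
      proof (rule Suc.hyps(1)[OF n(1)])
        show "diff_op_along A r l' (\<lambda>a. C (g * a) - (g \<circ> r) * C a)"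
          using Suc.prems(1) g kl by simp
        show "C (g * a) - (g \<circ> r) * C a \<in> B" if "a \<in> A" for a
          by (intro SB CB gB SA g that)
      qed (fact Suc.prems(2) lin)+
      have 2: "diff_op_along A (r \<circ> q) n (\<lambda>a. D ((g \<circ> r) * C a) - ((g \<circ> r) \<circ> q) * D (C a))"
        unfolding n(2)
      proof (rule Suc.hyps(1)[OF n(2), where D = "\<lambda>c. D ((g \<circ> r) * c) - ((g \<circ> r) \<circ> q) * D c"])
        show "diff_op_along B q k' (\<lambda>c. D ((g \<circ> r) * c) - ((g \<circ> r) \<circ> q) * D c)"
          using Suc.prems(2) gB kl by simp
        show "D ((g \<circ> r) * (a + b)) - ((g \<circ> r) \<circ> q) * D (a + b) =
            D ((g \<circ> r) * a) - ((g \<circ> r) \<circ> q) * D a + (D ((g \<circ> r) * b) - ((g \<circ> r) \<circ> q) * D b)"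
          if "a \<in> B" "b \<in> B" for a b
          using that by (simp add: distrib_left lin SB(3)[OF gB])
      qed (fact Suc.prems(1) CB)+
      show ?thesis
      proof (rule diff_op_along_cong[OF A diff_op_along_add[OF A 1 2]])
        fix a assume a: "a \<in> A"
        have "D (C (g * a) - (g \<circ> r) * C a) = D (C (g * a)) - D ((g \<circ> r) * C a)"
          by (intro Dd CB SB gB SA g a)
        then show "D (C (g * a) - (g \<circ> r) * C a) + (D ((g \<circ> r) * C a) - ((g \<circ> r) \<circ> q) * D (C a))
            = D (C (g * a)) - (g \<circ> (r \<circ> q)) * D (C a)"
          by (simp add: comp_assoc)
      qed
    qed
    then have "diff_op_along A (r \<circ> q) (Suc n) (\<lambda>a. D (C a))" by simp
    then show ?thesis using Suc.hyps(2) by simp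
  qed
qed

text \<open>The recursion interleaves commutators in the two slots. A commutator in one slot does
  not raise the order in the other (facts \<open>L\<close> and \<open>R\<close>), so the nested
  condition decouples.\<close>

lemma bidiff_op_below_iff:
  assumes S: "function_algebra S" and A: "function_algebra A"
  shows "bidiff_op_below S A p k l B \<longleftrightarrow>
    (\<forall>a\<in>A. diff_op_along S id k (\<lambda>f. B f a)) \<and> (\<forall>f\<in>S. diff_op_along A p l (B f))"
  using assms
proof (induction S A p k l B rule: bidiff_op_below.induct)
  case (1 S A p l B)
  have "\<forall>f\<in>S. diff_op_along A p l (B f)" if "\<forall>f\<in>S. \<forall>a\<in>A. B f a = 0"
    using that by (intro ballI diff_op_along_zero'[OF 1(2)]) simp
  then show ?case by (simp only: bidiff_op_below.simps diff_op_along.simps) blast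
next
  case (2 S A p k B)
  have "\<forall>a\<in>A. diff_op_along S id (Suc k) (\<lambda>f. B f a)" if "\<forall>f\<in>S. \<forall>a\<in>A. B f a = 0"
    using that by (intro ballI diff_op_along_zero'[OF 2(1)]) simp
  then show ?case by (simp only: bidiff_op_below.simps diff_op_along.simps(1)) blast
next
  case (3 S A p k l B)
  note S = function_algebraD[OF 3(3)] and A = function_algebraD[OF 3(4)]
  let ?L = "\<lambda>g f a. B (g * f) a - g * B f a" and ?R = "\<lambda>b f a. B f (b * a) - (b \<circ> p) * B f a"
  have L: "diff_op_along A p (Suc l) (?L g f)"
    if "\<forall>f\<in>S. diff_op_along A p (Suc l) (B f)" "g \<in> S" "f \<in> S" for g f
    using that S(3) by (simp only: diff_op_along_diff[OF 3(4)] diff_op_along_mult_left[OF 3(4)])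
  have R: "diff_op_along S id (Suc k) (\<lambda>f. ?R b f a)"
    if "\<forall>a\<in>A. diff_op_along S id (Suc k) (\<lambda>f. B f a)" "b \<in> A" "a \<in> A" for b a
    using that A(3) by (simp only: diff_op_along_diff[OF 3(3)] diff_op_along_mult_left[OF 3(3)])
  have "bidiff_op_below S A p (Suc k) (Suc l) B \<longleftrightarrow>
      (\<forall>g\<in>S. (\<forall>a\<in>A. diff_op_along S id k (\<lambda>f. ?L g f a)) \<and> (\<forall>f\<in>S. diff_op_along A p (Suc l) (?L g f))) \<and>
      (\<forall>b\<in>A. (\<forall>a\<in>A. diff_op_along S id (Suc k) (\<lambda>f. ?R b f a)) \<and> (\<forall>f\<in>S. diff_op_along A p l (?R b f)))"
    by (simp only: bidiff_op_below.simps(3) 3(1)[OF _ 3(3,4)] 3(2)[OF _ 3(3,4)] cong: ball_cong)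
  also have "\<dots> \<longleftrightarrow> (\<forall>a\<in>A. diff_op_along S id (Suc k) (\<lambda>f. B f a)) \<and>
      (\<forall>f\<in>S. diff_op_along A p (Suc l) (B f))" (is "?l \<longleftrightarrow> ?r")
  proof
    assume ?l
    then have "\<forall>g\<in>S. \<forall>a\<in>A. diff_op_along S id k (\<lambda>f. ?L g f a)"
      "\<forall>b\<in>A. \<forall>f\<in>S. diff_op_along A p l (?R b f)" by blast+
    then show ?r unfolding diff_op_along.simps(2) comp_id by blast
  next
    assume r: ?r
    have "\<forall>g\<in>S. \<forall>a\<in>A. diff_op_along S id k (\<lambda>f. ?L g f a)"
      "\<forall>b\<in>A. \<forall>f\<in>S. diff_op_along A p l (?R b f)"
      using r[unfolded diff_op_along.simps(2) comp_id] by blast+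
    with r show ?l using L R by blast
  qed
  finally show ?case .
qed


section \<open>A contracting homotopy for bidifferential operators\<close>

text \<open>An algebraic form of vanishing to order \<open>n\<close> at \<open>x\<close>. Single
  products replace the sums that make up the \<open>n\<close>-th power of the maximal ideal; sums
  are treated by linearity of the operators where they occur.\<close>

inductive vanishing_order :: "('a \<Rightarrow> complex) set \<Rightarrow> 'a \<Rightarrow> nat \<Rightarrow> ('a \<Rightarrow> complex) \<Rightarrow> bool"
  for A x where
  base: "u \<in> A \<Longrightarrow> vanishing_order A x 0 u"
| step: "u \<in> A \<Longrightarrow> u x = 0 \<Longrightarrow> vanishing_order A x n w \<Longrightarrow> vanishing_order A x (Suc n) (u * w)"

context
  fixes A :: "('a \<Rightarrow> complex) set"
  assumes A: "function_algebra A"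
begin

lemma vanishing_order_in: "vanishing_order A x n u \<Longrightarrow> u \<in> A"
  by (induction rule: vanishing_order.induct) (auto simp: function_algebraD[OF A])

lemma vanishing_order_mult:
  "vanishing_order A x n u \<Longrightarrow> vanishing_order A x m v \<Longrightarrow> vanishing_order A x (n + m) (u * v)"
proof (induction rule: vanishing_order.induct)
  case (base u)
  from base(2,1) show ?case
  proof (induction rule: vanishing_order.induct)
    case (base v)
    then show ?case by (auto intro: vanishing_order.base function_algebraD[OF A])
  next
    case (step v n w)
    then have "vanishing_order A x (Suc (0 + n)) (v * (u * w))"
      by (intro vanishing_order.step) auto
    then show ?case by (simp add: mult.left_commute)
  qed
next
  case (step u n w)
  then have "vanishing_order A x (Suc (n + m)) (u * (w * v))"
    by (intro vanishing_order.step) auto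
  then show ?case by (simp add: mult.assoc)
qed

lemma vanishing_order_mult_right:
  "vanishing_order A x n u \<Longrightarrow> v \<in> A \<Longrightarrow> vanishing_order A x n (u * v)"
  using vanishing_order_mult[of x n u 0 v] by (simp add: vanishing_order.base)

lemma vanishing_order_mult_left:
  "vanishing_order A x n u \<Longrightarrow> v \<in> A \<Longrightarrow> vanishing_order A x n (v * u)"
  using vanishing_order_mult_right[of x n u v] by (simp add: mult.commute)

lemma vanishing_order_split:
  "vanishing_order A x (n + m) w \<Longrightarrow> \<exists>u v. w = u * v \<and> vanishing_order A x n u \<and> vanishing_order A x m v"
proof (induction n arbitrary: w)
  case 0
  then show ?case
    by (intro exI[of _ 1] exI[of _ w]) (auto intro: vanishing_order.base function_algebraD[OF A])
next
  case (Suc n)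
  from Suc.prems obtain u w' where w: "w = u * w'" "u \<in> A" "u x = 0" "vanishing_order A x (n + m) w'"
    by (cases rule: vanishing_order.cases) auto
  obtain u' v where "w' = u' * v" "vanishing_order A x n u'" "vanishing_order A x m v"
    using Suc.IH[OF w(4)] by blast
  with w show ?case
    by (intro exI[of _ "u * u'"] exI[of _ v]) (auto intro: vanishing_order.step simp: mult.assoc)
qed

text \<open>Iterating \<open>h = e * h\<close> writes \<open>h\<close> as
  \<open>e\<^sup>n * h\<close>. With \<open>e\<close> a cutoff, a function that is zero near
  \<open>x\<close> vanishes there to every order, which is the source of the locality of
  differential operators.\<close>

lemma vanishing_order_power:
  assumes "e \<in> A" "e x = 0" "h \<in> A" "e * h = h"
  shows "vanishing_order A x n h"
proof (induction n)
  case 0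
  then show ?case using assms by (auto intro: vanishing_order.base)
next
  case (Suc n)
  show ?case using vanishing_order.step[OF assms(1,2) Suc] assms(4) by simp
qed

text \<open>If \<open>w = u * w'\<close> with \<open>u\<close> zero at \<open>q z\<close>, then
  \<open>D w\<close> has at \<open>z\<close> the same value as the commutator of \<open>D\<close>
  with \<open>u\<close> on \<open>w'\<close>, and the order of that commutator is one lower.\<close>

lemma diff_op_along_vanishing_order:
  "diff_op_along A q n D \<Longrightarrow> vanishing_order A (q z) n w \<Longrightarrow> D w z = 0"
proof (induction n arbitrary: D w)
  case 0
  then show ?case using vanishing_order_in by (auto simp: pointwise)
next
  case (Suc n)
  from Suc.prems(2) obtain u w' where w: "w = u * w'" "u \<in> A" "u (q z) = 0" "vanishing_order A (q z) n w'"
    by (cases rule: vanishing_order.cases) auto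
  have "(D (u * w') - (u \<circ> q) * D w') z = 0"
    by (rule Suc.IH[OF _ w(4)]) (use Suc.prems(1) w(2) in simp)
  then have "D (u * w') z = 0" using w(3) by (simp add: minus_apply times_fun_apply comp_apply)
  then show ?case by (simp only: w(1))
qed

end

lemma vanishing_order_pullback:
  assumes "\<And>a. a \<in> A \<Longrightarrow> a \<circ> p \<in> S"
  shows "vanishing_order A (p z) n u \<Longrightarrow> vanishing_order S z n (u \<circ> p)"
proof (induction n arbitrary: u)
  case 0
  then show ?case using assms by (auto elim: vanishing_order.cases intro: vanishing_order.base)
next
  case (Suc n)
  from Suc.prems obtain v w where w: "u = v * w" "v \<in> A" "v (p z) = 0" "vanishing_order A (p z) n w"
    by (cases rule: vanishing_order.cases) auto
  have "vanishing_order S z (Suc n) ((v \<circ> p) * (w \<circ> p))"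
    using assms[OF w(2)] w(3) Suc.IH[OF w(4)] by (intro vanishing_order.step) (assumption | simp add: comp_apply)+
  then show ?case by (simp add: w(1))
qed

section \<open>Bidifferential operators over algebras with cutoff functions\<close>

type_synonym ('p, 'm) bioperator =
  "('p \<Rightarrow> complex) \<Rightarrow> ('m \<Rightarrow> complex) \<Rightarrow> ('p \<Rightarrow> complex)"

text \<open>The decoupled form of the order condition. The bounds stay explicit because the number
  of factors in the splitting is chosen from \<open>k + l\<close>.\<close>

definition bidiff :: "('p \<Rightarrow> complex) set \<Rightarrow> ('m \<Rightarrow> complex) set \<Rightarrow> ('p \<Rightarrow> 'm) \<Rightarrow> nat \<Rightarrow> nat \<Rightarrow>
   ('p, 'm) bioperator \<Rightarrow> bool" where
  "bidiff S A p k l B \<longleftrightarrow>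
     (\<forall>a\<in>A. linear_op S S (\<lambda>f. B f a) \<and> diff_op_along S id k (\<lambda>f. B f a)) \<and>
     (\<forall>f\<in>S. linear_op A S (B f) \<and> diff_op_along A p l (B f))"

text \<open>Analysis enters here only through the last two assumptions: a cutoff \<open>e\<close>
  that is 0 at a point of \<open>U\<close> and 1 off \<open>U\<close> satisfies
  \<open>e * h = h\<close> for every \<open>h\<close> vanishing on \<open>U\<close>.\<close>

locale pulled_back_algebra =
  fixes S :: "('p::topological_space \<Rightarrow> complex) set" and A :: "('m::topological_space \<Rightarrow> complex) set"
    and p :: "'p \<Rightarrow> 'm"
  assumes S: "function_algebra S" and A: "function_algebra A"
    and pull: "a \<in> A \<Longrightarrow> a \<circ> p \<in> S"
    and separate_S: "open U \<Longrightarrow> z \<in> U \<Longrightarrow> \<exists>e\<in>S. e z = 0 \<and> (\<forall>y. y \<notin> U \<longrightarrow> e y = 1)"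
    and separate_A: "open U' \<Longrightarrow> y \<in> U' \<Longrightarrow> \<exists>e\<in>A. e y = 0 \<and> (\<forall>y. y \<notin> U' \<longrightarrow> e y = 1)"
begin

lemmas Sc = function_algebraD[OF S] and Ac = function_algebraD[OF A]

lemma bidiffD:
  assumes "bidiff S A p k l B"
  shows "a \<in> A \<Longrightarrow> linear_op S S (\<lambda>f. B f a)" "f \<in> S \<Longrightarrow> linear_op A S (B f)"
    "a \<in> A \<Longrightarrow> diff_op_along S id k (\<lambda>f. B f a)" "f \<in> S \<Longrightarrow> diff_op_along A p l (B f)"
  using assms by (auto simp: bidiff_def)

lemma bidiff_simps:
  assumes "bidiff S A p k l B"
  shows "f \<in> S \<Longrightarrow> a \<in> A \<Longrightarrow> B f a \<in> S"
    "f \<in> S \<Longrightarrow> g \<in> S \<Longrightarrow> a \<in> A \<Longrightarrow> B (f + g) a = B f a + B g a"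
    "f \<in> S \<Longrightarrow> a \<in> A \<Longrightarrow> b \<in> A \<Longrightarrow> B f (a + b) = B f a + B f b"
    "f \<in> S \<Longrightarrow> g \<in> S \<Longrightarrow> a \<in> A \<Longrightarrow> B (f - g) a = B f a - B g a"
    "f \<in> S \<Longrightarrow> a \<in> A \<Longrightarrow> b \<in> A \<Longrightarrow> B f (a - b) = B f a - B f b"
    "a \<in> A \<Longrightarrow> B 0 a = 0" "f \<in> S \<Longrightarrow> B f 0 = 0"
    "f \<in> S \<Longrightarrow> a \<in> A \<Longrightarrow> B ((\<lambda>_. c) * f) a = (\<lambda>_. c) * B f a"
    "f \<in> S \<Longrightarrow> a \<in> A \<Longrightarrow> B f ((\<lambda>_. c) * a) = (\<lambda>_. c) * B f a"
    "(\<And>i. i \<in> I \<Longrightarrow> F i \<in> S) \<Longrightarrow> a \<in> A \<Longrightarrow> B (\<Sum>i\<in>I. F i) a = (\<Sum>i\<in>I. B (F i) a)"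
  by (rule linear_opD(1)[OF bidiffD(1)[OF assms]], assumption+)
    (rule linear_opD(2)[OF bidiffD(1)[OF assms]] linear_opD(2)[OF bidiffD(2)[OF assms]]
      linear_opD'(3)[OF bidiffD(1)[OF assms] S] linear_opD'(3)[OF bidiffD(2)[OF assms] A]
      linear_opD'(1)[OF bidiffD(1)[OF assms] S] linear_opD'(1)[OF bidiffD(2)[OF assms] A]
      linear_opD(3)[OF bidiffD(1)[OF assms]] linear_opD(3)[OF bidiffD(2)[OF assms]]
      linear_opD'(4)[OF bidiffD(1)[OF assms] S], assumption+)+

lemma bidiffI:
  assumes "\<And>a. a \<in> A \<Longrightarrow> linear_op S S (\<lambda>f. B f a)" "\<And>f. f \<in> S \<Longrightarrow> linear_op A S (B f)"
    "\<And>a. a \<in> A \<Longrightarrow> diff_op_along S id k (\<lambda>f. B f a)" "\<And>f. f \<in> S \<Longrightarrow> diff_op_along A p l (B f)"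
  shows "bidiff S A p k l B"
  using assms by (auto simp: bidiff_def)

lemma bidiff_mono:
  assumes "bidiff S A p k l B" "k \<le> k'" "l \<le> l'"
  shows "bidiff S A p k' l' B"
  by (rule bidiffI)
    (use bidiffD[OF assms(1)] assms(2,3) diff_op_along_mono[OF S] diff_op_along_mono[OF A] in blast)+

lemma bidiff_add:
  assumes "bidiff S A p k l B" "bidiff S A p k l C"
  shows "bidiff S A p k l (\<lambda>f a. B f a + C f a)"
  by (rule bidiffI)
    (simp_all add: bidiffD[OF assms(1)] bidiffD[OF assms(2)] linear_op_add[OF _ _ S]
      diff_op_along_add[OF S] diff_op_along_add[OF A])

lemma bidiff_diff:
  assumes "bidiff S A p k l B" "bidiff S A p k l C"
  shows "bidiff S A p k l (\<lambda>f a. B f a - C f a)"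
  by (rule bidiffI)
    (simp_all add: bidiffD[OF assms(1)] bidiffD[OF assms(2)] linear_op_diff[OF _ _ S]
      diff_op_along_diff[OF S] diff_op_along_diff[OF A])

lemma bidiff_mult_left:
  assumes "bidiff S A p k l B" "h \<in> S"
  shows "bidiff S A p k l (\<lambda>f a. h * B f a)"
  by (rule bidiffI)
    (simp_all add: bidiffD[OF assms(1)] assms(2) linear_op_mult_left[OF _ _ S]
      diff_op_along_mult_left[OF S] diff_op_along_mult_left[OF A])

lemma bidiff_zero: "bidiff S A p k l (\<lambda>f a. 0)"
  by (rule bidiffI)
    (simp_all add: linear_op_zero[OF S] diff_op_along_zero[OF S] diff_op_along_zero[OF A])

lemma bidiff_sum:
  "(\<And>i. i \<in> I \<Longrightarrow> bidiff S A p k l (B i)) \<Longrightarrow> bidiff S A p k l (\<lambda>f a. \<Sum>i\<in>I. B i f a)"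
  by (induction I rule: infinite_finite_induct) (simp_all add: bidiff_zero bidiff_add)

lemma bidiff_precompose:
  assumes "bidiff S A p k l B" "linear_op S S C" "diff_op_along S id j C"
  shows "bidiff S A p (k + j) l (\<lambda>f a. B (C f) a)"
proof (rule bidiffI)
  fix a assume a: "a \<in> A"
  show "linear_op S S (\<lambda>f. B (C f) a)"
    by (rule linear_op_compose[OF assms(2) bidiffD(1)[OF assms(1) a]])
  show "diff_op_along S id (k + j) (\<lambda>f. B (C f) a)"
    using diff_op_along_compose[OF S S _ assms(3) bidiffD(3)[OF assms(1) a]]
      linear_opD(1)[OF assms(2)] bidiff_simps(2)[OF assms(1) _ _ a] by simp
next
  fix f assume "f \<in> S"
  then have "C f \<in> S" by (rule linear_opD(1)[OF assms(2)])
  then show "linear_op A S (B (C f))" "diff_op_along A p l (B (C f))"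
    by (simp_all add: bidiffD[OF assms(1)])
qed

lemma bidiff_mult_fst:
  assumes "bidiff S A p k l B" "g \<in> S"
  shows "bidiff S A p k l (\<lambda>f a. B (g * f) a)"
proof (rule bidiffI)
  fix a assume a: "a \<in> A"
  show "linear_op S S (\<lambda>f. B (g * f) a)"
    by (rule linear_op_compose[OF linear_op_mult[OF S assms(2)] bidiffD(1)[OF assms(1) a]])
  show "diff_op_along S id k (\<lambda>f. B (g * f) a)"
    using diff_op_along_mult_right[OF S bidiffD(3)[OF assms(1) a] assms(2)] .
qed (simp_all add: bidiffD[OF assms(1)] Sc assms(2))

lemma bidiff_mult_snd:
  assumes "bidiff S A p k l B" "b \<in> A"
  shows "bidiff S A p k l (\<lambda>f a. B f (b * a))"
proof (rule bidiffI)
  fix f assume f: "f \<in> S"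
  show "linear_op A S (\<lambda>a. B f (b * a))"
    by (rule linear_op_compose[OF linear_op_mult[OF A assms(2)] bidiffD(2)[OF assms(1) f]])
  show "diff_op_along A p l (\<lambda>a. B f (b * a))"
    using diff_op_along_mult_right[OF A bidiffD(4)[OF assms(1) f] assms(2)] .
qed (simp_all add: bidiffD[OF assms(1)] Ac assms(2))

text \<open>A bilinear operator \<open>B\<close> is viewed as a linear map on \<open>S \<otimes> A\<close>. Then \<open>vdiff u B\<close> is \<open>B\<close> composed with
  the multiplication by \<open>p\<^sup>*u \<otimes> 1 - 1 \<otimes> u\<close>, the composition of \<open>B\<close> with \<open>\<theta>\<close> is \<open>theta B\<close> below, and
  \<open>vanishes_to_order W n B\<close> says that \<open>B\<close> vanishes on \<open>I\<^sup>n\<close> over \<open>W\<close>.\<close>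

definition vdiff :: "('m \<Rightarrow> complex) \<Rightarrow> ('p, 'm) bioperator \<Rightarrow>
    ('p, 'm) bioperator" where
  "vdiff u B f a = B ((u \<circ> p) * f) a - B f (u * a)"

lemma vdiff_apply: "vdiff u B f a z = B ((u \<circ> p) * f) a z - B f (u * a) z"
  by (simp add: vdiff_def minus_apply)

lemma bidiff_vdiff: "bidiff S A p k l B \<Longrightarrow> u \<in> A \<Longrightarrow> bidiff S A p k l (vdiff u B)"
  unfolding vdiff_def[abs_def] by (intro bidiff_diff bidiff_mult_fst bidiff_mult_snd pull)

primrec vanishes_to_order :: "'p set \<Rightarrow> nat \<Rightarrow>
    ('p, 'm) bioperator \<Rightarrow> bool" where
  "vanishes_to_order W 0 B \<longleftrightarrow> (\<forall>f\<in>S. \<forall>a\<in>A. \<forall>z\<in>W. B f a z = 0)"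
| "vanishes_to_order W (Suc n) B \<longleftrightarrow> (\<forall>u\<in>A. vanishes_to_order W n (vdiff u B))"

lemma vanishes_cong:
  "vanishes_to_order W n B \<Longrightarrow> (\<And>f a z. f \<in> S \<Longrightarrow> a \<in> A \<Longrightarrow> z \<in> W \<Longrightarrow> C f a z = B f a z) \<Longrightarrow>
    vanishes_to_order W n C"
proof (induction n arbitrary: B C)
  case (Suc n)
  have "vanishes_to_order W n (vdiff u C)" if u: "u \<in> A" for u
  proof (rule Suc.IH)
    show "vanishes_to_order W n (vdiff u B)" using Suc.prems(1) u by simp
    show "vdiff u C f a z = vdiff u B f a z" if "f \<in> S" "a \<in> A" "z \<in> W" for f a z
      using that by (simp add: vdiff_apply Suc.prems(2) Sc Ac pull u)
  qed
  then show ?case by simp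
qed simp

lemma vanishes_add:
  "vanishes_to_order W n B \<Longrightarrow> vanishes_to_order W n C \<Longrightarrow> vanishes_to_order W n (\<lambda>f a. B f a + C f a)"
proof (induction n arbitrary: B C)
  case (Suc n)
  have "vanishes_to_order W n (vdiff u (\<lambda>f a. B f a + C f a))" if u: "u \<in> A" for u
  proof (rule vanishes_cong[OF Suc.IH])
    show "vanishes_to_order W n (vdiff u B)" "vanishes_to_order W n (vdiff u C)"
      using Suc.prems u by simp_all
    show "vdiff u (\<lambda>f a. B f a + C f a) f a z = (vdiff u B f a + vdiff u C f a) z" for f a z
      by (simp add: vdiff_apply plus_fun_apply)
  qed
  then show ?case by simp
qed (simp add: pointwise)

lemma vanishes_mult_left:
  "vanishes_to_order W n B \<Longrightarrow> vanishes_to_order W n (\<lambda>f a. h * B f a)"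
proof (induction n arbitrary: B)
  case (Suc n)
  have "vanishes_to_order W n (vdiff u (\<lambda>f a. h * B f a))" if u: "u \<in> A" for u
  proof (rule vanishes_cong[OF Suc.IH])
    show "vanishes_to_order W n (vdiff u B)"
      using Suc.prems u by simp
    show "vdiff u (\<lambda>f a. h * B f a) f a z = (h * vdiff u B f a) z" for f a z
      by (simp add: vdiff_apply times_fun_apply right_diff_distrib)
  qed
  then show ?case by simp
qed (simp add: pointwise)

text \<open>Adding and subtracting \<open>(u \<circ> p) * B f a\<close> writes
  \<open>vdiff u B\<close> as a difference of two commutators. One of them lowers \<open>k\<close>,
  the other lowers \<open>l\<close>, so \<open>k + l\<close> multipliers exhaust both
  orders.\<close>

lemma bidiff_vanishes: "bidiff S A p k l B \<Longrightarrow> k + l \<le> n \<Longrightarrow> vanishes_to_order W n B"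
proof (induction n arbitrary: k l B)
  case 0
  then show ?case using bidiffD(3)[OF 0(1)] by (simp add: pointwise)
next
  case (Suc n)
  have "vanishes_to_order W n (vdiff u B)" if u: "u \<in> A" for u
  proof (cases "k = 0 \<or> l = 0")
    case True
    then have zero: "B f a = 0" if "f \<in> S" "a \<in> A" for f a
      using bidiffD(3,4)[OF Suc.prems(1)] that by auto
    show ?thesis
      by (rule vanishes_cong[OF Suc.IH[OF bidiff_zero[of 0 0]]])
        (simp_all add: vdiff_def zero u Sc Ac pull)
  next
    case False
    then obtain k' l' where kl: "k = Suc k'" "l = Suc l'" by (meson not0_implies_Suc)
    let ?B1 = "\<lambda>f a. B ((u \<circ> p) * f) a - (u \<circ> p) * B f a"
    let ?B2 = "\<lambda>f a. B f (u * a) - (u \<circ> p) * B f a"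
    have b1: "bidiff S A p k l ?B1"
      by (intro bidiff_diff bidiff_mult_fst bidiff_mult_left Suc.prems pull u)
    have b2: "bidiff S A p k l ?B2"
      by (intro bidiff_diff bidiff_mult_snd bidiff_mult_left Suc.prems pull u)
    have "bidiff S A p k' l ?B1"
    proof (rule bidiffI)
      show "diff_op_along S id k' (\<lambda>f. ?B1 f a)" if "a \<in> A" for a
        using bidiffD(3)[OF Suc.prems(1) that] pull[OF u] by (simp add: kl)
    qed (use bidiffD[OF b1] in blast)+
    moreover have "bidiff S A p k l' ?B2"
    proof (rule bidiffI)
      show "diff_op_along A p l' (?B2 f)" if "f \<in> S" for f
        using bidiffD(4)[OF Suc.prems(1) that] u by (simp add: kl)
    qed (use bidiffD[OF b2] in blast)+
    ultimately have "vanishes_to_order W n ?B1" "vanishes_to_order W n ?B2"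
      using Suc.IH[of k' l ?B1] Suc.IH[of k l' ?B2] Suc.prems(2) kl by auto
    from vanishes_add[OF this(1) vanishes_mult_left[OF this(2), of "-1"]]
    show ?thesis by (rule vanishes_cong) (simp add: vdiff_def pointwise)
  qed
  then show ?case by simp
qed

end

text \<open>A coordinate patch described by global objects: the \<open>x i\<close> stand for cut-off
  coordinates and the \<open>X i\<close> for cut-off vector fields. This is why duality is demanded
  on \<open>W\<close> only and the Hadamard formula only near \<open>p z\<close>.\<close>

locale local_frame = pulled_back_algebra S A p
  for S :: "('p::topological_space \<Rightarrow> complex) set" and A :: "('m::topological_space \<Rightarrow> complex) set"
    and p :: "'p \<Rightarrow> 'm" +
  fixes W :: "'p set" and d :: nat and x :: "nat \<Rightarrow> 'm \<Rightarrow> complex"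
    and X :: "nat \<Rightarrow> ('p \<Rightarrow> complex) \<Rightarrow> ('p \<Rightarrow> complex)"
  assumes open_W: "open W"
    and x_in: "i < d \<Longrightarrow> x i \<in> A"
    and X_linear: "i < d \<Longrightarrow> linear_op S S (X i)"
    and X_mult: "i < d \<Longrightarrow> f \<in> S \<Longrightarrow> g \<in> S \<Longrightarrow> X i (f * g) = X i f * g + f * X i g"
    and X_dual: "i < d \<Longrightarrow> j < d \<Longrightarrow> z \<in> W \<Longrightarrow> X i (x j \<circ> p) z = (if i = j then 1 else 0)"
    and hadamard: "z \<in> W \<Longrightarrow> b \<in> A \<Longrightarrow> \<exists>g U. (\<forall>i<d. g i \<in> A) \<and> open U \<and> p z \<in> U \<and>
      (\<forall>y\<in>U. b y = b (p z) + (\<Sum>i<d. (x i y - x i (p z)) * g i y))"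
begin

lemma X_in: "i < d \<Longrightarrow> f \<in> S \<Longrightarrow> X i f \<in> S"
  using linear_opD(1)[OF X_linear] .

lemma X_one: "i < d \<Longrightarrow> X i 1 = 0"
  using X_mult[of i 1 1] Sc(5) by simp

lemma X_const: "i < d \<Longrightarrow> X i (\<lambda>_. c) = 0"
  using linear_opD(3)[OF X_linear, of i 1 c] Sc(5) X_one by simp

text \<open>A derivation has order one, hence strictly below 2: its commutator with \<open>g\<close>
  is multiplication by \<open>X i g\<close>.\<close>

lemma X_order: "i < d \<Longrightarrow> diff_op_along S id 2 (X i)"
proof -
  assume i: "i < d"
  have "X i (h * (g * f)) - (h \<circ> id) * X i (g * f) - (g \<circ> id) * (X i (h * f) - (h \<circ> id) * X i f) =
     X i h * (g * f) - (g \<circ> id) * (X i h * f)" if "f \<in> S" "g \<in> S" "h \<in> S" for f g h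
    using that by (simp add: X_mult[OF i] Sc algebra_simps)
  then show ?thesis
    using Sc by (simp add: numeral_2_eq_2 X_mult[OF i] algebra_simps)
qed

section \<open>The derivation \<theta> and the filtration by powers of the diagonal ideal\<close>

definition theta :: "('p, 'm) bioperator \<Rightarrow>
    ('p, 'm) bioperator" where
  "theta B f a = (\<Sum>i<d. B (X i f) (x i * a) - B ((x i \<circ> p) * X i f) a)"

text \<open>This is \<open>B\<close> composed with multiplication by \<open>\<Sum>\<^sub>i
  X\<^sub>i(p\<^sup>*u) (p\<^sup>*x\<^sub>i \<otimes> 1 - 1 \<otimes> x\<^sub>i)\<close>, the first
  order Taylor approximation of \<open>p\<^sup>*u \<otimes> 1 - 1 \<otimes> u\<close>. The same
  element is the value of \<open>-\<theta>\<close> on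
  \<open>p\<^sup>*u \<otimes> 1 - 1 \<otimes> u\<close>.\<close>

definition substituted :: "('m \<Rightarrow> complex) \<Rightarrow> ('p, 'm) bioperator \<Rightarrow>
    ('p, 'm) bioperator" where
  "substituted u B f a = (\<Sum>i<d. vdiff (x i) B (X i (u \<circ> p) * f) a)"

lemma theta_eq_vdiff: "theta B f a = - (\<Sum>i<d. vdiff (x i) B (X i f) a)"
  by (simp add: theta_def vdiff_def sum_negf[symmetric])

lemma bidiff_theta:
  assumes "bidiff S A p k l B"
  shows "bidiff S A p (k + 2) l (theta B)"
proof -
  have "bidiff S A p (k + 2) l (\<lambda>f a. B (X i f) (x i * a) - B ((x i \<circ> p) * X i f) a)" if "i < d" for i
    by (intro bidiff_diff
        bidiff_precompose[where C = "X i" and B = "\<lambda>f a. B f (x i * a)"]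
        bidiff_precompose[where C = "X i" and B = "\<lambda>f a. B ((x i \<circ> p) * f) a"]
        bidiff_mult_snd bidiff_mult_fst assms X_linear X_order that pull x_in)
  then have "bidiff S A p (k + 2) l (\<lambda>f a. \<Sum>i<d. B (X i f) (x i * a) - B ((x i \<circ> p) * X i f) a)"
    by (intro bidiff_sum) auto
  then show ?thesis unfolding theta_def[abs_def] .
qed

text \<open>Leibniz rule for \<theta>: moving the multiplier
  \<open>p\<^sup>*u \<otimes> 1 - 1 \<otimes> u\<close> past \<theta> leaves the value of \<theta>
  on this multiplier, which is minus the sum encoded in \<open>substituted\<close>.\<close>

lemma vdiff_theta:
  assumes B: "bidiff S A p k l B" and u: "u \<in> A" and f: "f \<in> S" and a: "a \<in> A"
  shows "vdiff u (theta B) f a = theta (vdiff u B) f a - substituted u B f a"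
proof -
  have eq: "vdiff (x i) B (X i ((u \<circ> p) * f)) a - vdiff (x i) B (X i f) (u * a) =
     vdiff (x i) B (X i (u \<circ> p) * f) a + vdiff (x i) (vdiff u B) (X i f) a" if i: "i < d" for i
  proof -
    note in_S = Sc(2,3) X_in[OF i] pull[OF u] pull[OF x_in[OF i]] f
    note B' = bidiff_simps[OF bidiff_vdiff[OF B x_in[OF i]]]
    have "vdiff (x i) B (X i ((u \<circ> p) * f)) a =
      vdiff (x i) B (X i (u \<circ> p) * f) a + vdiff (x i) B ((u \<circ> p) * X i f) a"
      using X_mult[OF i pull[OF u] f] B'(2)[of "X i (u \<circ> p) * f" "(u \<circ> p) * X i f" a] in_S a by simp
    then show ?thesis by (simp add: vdiff_def mult.left_commute)
  qed
  have "vdiff u (theta B) f a =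
      - (\<Sum>i<d. vdiff (x i) B (X i ((u \<circ> p) * f)) a - vdiff (x i) B (X i f) (u * a))"
    by (simp add: vdiff_def[of u "theta B"] theta_eq_vdiff sum_subtractf)
  also have "(\<Sum>i<d. vdiff (x i) B (X i ((u \<circ> p) * f)) a - vdiff (x i) B (X i f) (u * a)) =
      (\<Sum>i<d. vdiff (x i) B (X i (u \<circ> p) * f) a + vdiff (x i) (vdiff u B) (X i f) a)"
    by (intro sum.cong refl eq) simp
  finally show ?thesis
    unfolding theta_eq_vdiff[of "vdiff u B"] substituted_def by (simp add: sum.distrib)
qed

lemma vdiff_commute: "vdiff u (vdiff v B) f a = vdiff v (vdiff u B) f a"
  by (simp add: vdiff_def mult.left_commute)

lemma vdiff_substituted: "vdiff v (substituted u B) f a = substituted u (vdiff v B) f a"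
  by (simp add: vdiff_def[of v "substituted u B"] substituted_def sum_subtractf[symmetric])
    (simp add: vdiff_def algebra_simps)

text \<open>The identity says that \<open>\<theta>(1 \<otimes> u - p\<^sup>*u \<otimes> 1)\<close> is congruent to \<open>-(1 \<otimes> u - p\<^sup>*u \<otimes> 1)\<close> modulo
  the square of the diagonal ideal. Both sides are derivations in \<open>u\<close>, so it is enough to check
  it on coordinates and, by Hadamard's lemma, on functions vanishing to high order.\<close>

lemma vdiff_eq_substituted:
  assumes B: "bidiff S A p k l B" and van: "vanishes_to_order W 2 B"
    and u: "u \<in> A" and f: "f \<in> S" and a: "a \<in> A" and z: "z \<in> W"
  shows "vdiff u B f a z = substituted u B f a z"
proof -
  \<comment> \<open>A common bound for the two slots: functions vanishing to order \<open>n\<close>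
    are then annihilated in either slot.\<close>
  define n where "n = max k l"
  have Bn: "bidiff S A p n n B" by (rule bidiff_mono[OF B]) (auto simp: n_def)
  \<comment> \<open>The point \<open>z\<close> is fixed but \<open>f\<close> and \<open>a\<close>
    range over everything, because closure under products applies the identity to modified
    \<open>f\<close> and \<open>a\<close>.\<close>
  define G where "G = {u \<in> A. \<forall>f\<in>S. \<forall>a\<in>A. vdiff u B f a z = substituted u B f a z}"
  have G_I: "u \<in> G" if "u \<in> A" "\<And>f a. f \<in> S \<Longrightarrow> a \<in> A \<Longrightarrow> vdiff u B f a z = substituted u B f a z" for u
    using that by (simp add: G_def)
  have G_A: "u \<in> A" if "u \<in> G" for u using that by (simp add: G_def)
  have G_D: "vdiff u B f a z = substituted u B f a z" if "u \<in> G" "f \<in> S" "a \<in> A" for u f a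
    using that by (simp add: G_def)
  note B' = bidiff_simps[OF bidiff_vdiff[OF B x_in]]
  \<comment> \<open>\<open>B\<close> annihilates \<open>I\<^sup>2\<close> over \<open>W\<close>. On
    multiples of \<open>p\<^sup>*x\<^sub>i \<otimes> 1 - 1 \<otimes> x\<^sub>i\<close> the factors
    \<open>p\<^sup>*v \<otimes> 1\<close> and \<open>1 \<otimes> v\<close> therefore have the same
    effect.\<close>
  have bal: "vdiff (x i) B ((v \<circ> p) * g) a z = vdiff (x i) B g (v * a) z"
    if "v \<in> A" "g \<in> S" "a \<in> A" "i < d" for v g a i
  proof -
    have "vdiff v (vdiff (x i) B) g a z = 0"
      using van that z x_in by (simp add: numeral_2_eq_2)
    then show ?thesis by (simp add: vdiff_apply[of v])
  qed
  have kill: "vdiff (x i) B g a z = 0" if "vanishing_order S z n g" "a \<in> A" "i < d" for g a i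
  proof -
    have "g \<in> S" using vanishing_order_in[OF S that(1)] .
    have "B g' b z = 0" if "vanishing_order S z n g'" "b \<in> A" for g' b
      using diff_op_along_vanishing_order[OF S bidiffD(3)[OF Bn that(2)], of z g'] that(1) by simp
    then show ?thesis
      using vanishing_order_mult_left[OF S that(1) pull[OF x_in[OF that(3)]]] that Ac(3) x_in
      by (simp add: vdiff_apply)
  qed
  have G_mult: "u * v \<in> G" if uv: "u \<in> G" "v \<in> G" for u v
  proof (rule G_I)
    show "u * v \<in> A" by (intro Ac G_A uv)
    fix f a assume f: "f \<in> S" and a: "a \<in> A"
    note uA = G_A[OF uv(1)] G_A[OF uv(2)]
    \<comment> \<open>The Leibniz rule for \<open>X i\<close> leaves \<open>u \<circ> p\<close> in
      the first slot, whereas the product rule for \<open>vdiff\<close> has \<open>u\<close> in the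
      second slot; \<open>bal\<close> moves it across.\<close>
    have 1: "vdiff (x i) B (X i ((u * v) \<circ> p) * f) a z =
        vdiff (x i) B (X i (u \<circ> p) * ((v \<circ> p) * f)) a z + vdiff (x i) B (X i (v \<circ> p) * f) (u * a) z"
      if i: "i < d" for i
    proof -
      note Xu = X_in[OF i pull[OF uA(1)]] X_in[OF i pull[OF uA(2)]]
      have "X i ((u * v) \<circ> p) * f = X i (u \<circ> p) * ((v \<circ> p) * f) + (u \<circ> p) * (X i (v \<circ> p) * f)"
        unfolding pullback_simps X_mult[OF i pull[OF uA(1)] pull[OF uA(2)]]
        by (simp add: distrib_right mult.assoc)
      moreover have "X i (u \<circ> p) * ((v \<circ> p) * f) \<in> S" "(u \<circ> p) * (X i (v \<circ> p) * f) \<in> S"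
        "X i (v \<circ> p) * f \<in> S"
        by (intro Sc Xu pull uA f)+
      ultimately show ?thesis
        using bal[OF uA(1) _ a i, of "X i (v \<circ> p) * f"] B'(2)[OF i _ _ a] by (simp add: plus_fun_apply)
    qed
    have "vdiff (u * v) B f a z = vdiff u B ((v \<circ> p) * f) a z + vdiff v B f (u * a) z"
      by (simp add: vdiff_apply ac_simps)
    also have "\<dots> = substituted u B ((v \<circ> p) * f) a z + substituted v B f (u * a) z"
      using G_D[OF uv(1) Sc(3)[OF pull[OF uA(2)] f] a] G_D[OF uv(2) f Ac(3)[OF uA(1) a]] by simp
    also have "\<dots> = substituted (u * v) B f a z"
      using 1 by (simp add: substituted_def sum_fun_apply sum.distrib)
    finally show "vdiff (u * v) B f a z = substituted (u * v) B f a z" .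
  qed
  have G_add: "u + v \<in> G" if uv: "u \<in> G" "v \<in> G" for u v
  proof (rule G_I)
    show "u + v \<in> A" by (intro Ac G_A uv)
    fix f a assume f: "f \<in> S" and a: "a \<in> A"
    note uA = G_A[OF uv(1)] G_A[OF uv(2)]
    have 1: "vdiff (x i) B (X i ((u + v) \<circ> p) * f) a =
        vdiff (x i) B (X i (u \<circ> p) * f) a + vdiff (x i) B (X i (v \<circ> p) * f) a"
      if i: "i < d" for i
      unfolding pullback_simps linear_opD(2)[OF X_linear[OF i] pull[OF uA(1)] pull[OF uA(2)]] distrib_right
      by (intro B'(2) i a Sc(3) f X_in pull uA)
    have "vdiff (u + v) B f a = vdiff u B f a + vdiff v B f a"
      using bidiff_simps(2)[OF B Sc(3)[OF pull[OF uA(1)] f] Sc(3)[OF pull[OF uA(2)] f] a]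
        bidiff_simps(3)[OF B f Ac(3)[OF uA(1) a] Ac(3)[OF uA(2) a]]
      by (simp add: vdiff_def distrib_right)
    moreover have "substituted (u + v) B f a = substituted u B f a + substituted v B f a"
      by (simp add: substituted_def 1 sum.distrib del: pullback_simps)
    ultimately show "vdiff (u + v) B f a z = substituted (u + v) B f a z"
      using G_D[OF uv(1) f a] G_D[OF uv(2) f a] by (simp add: plus_fun_apply)
  qed
  have G_const: "(\<lambda>_. c) \<in> G" for c
  proof (rule G_I)
    show "(\<lambda>_. c) \<in> A" by (rule Ac)
    fix f a assume f: "f \<in> S" and a: "a \<in> A"
    have "vdiff (\<lambda>_. c) B f a = 0" using f a by (simp add: vdiff_def bidiff_simps[OF B])
    moreover have "substituted (\<lambda>_. c) B f a = 0"
      unfolding substituted_def by (intro sum.neutral) (simp add: X_const B'(6) a)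
    ultimately show "vdiff (\<lambda>_. c) B f a z = substituted (\<lambda>_. c) B f a z" by simp
  qed
  have G_sum: "(\<Sum>i\<in>I. F i) \<in> G" if "\<And>i. i \<in> I \<Longrightarrow> F i \<in> G" for I :: "nat set" and F
    using that
    by (induction I rule: infinite_finite_induct) (auto intro: G_add G_const[of 0, folded zero_fun_def])
  have G_x: "x j \<in> G" if j: "j < d" for j
  proof (rule G_I)
    show "x j \<in> A" using x_in j by blast
    fix f a assume f: "f \<in> S" and a: "a \<in> A"
    obtain e where e: "e \<in> S" "e z = 0" "\<And>y. y \<notin> W \<Longrightarrow> e y = 1"
      using separate_S[OF open_W z] by blast
    have *: "vdiff (x i) B (X i (x j \<circ> p) * f) a z = (if i = j then vdiff (x j) B f a z else 0)"
      if i: "i < d" for i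
    proof -
      define c :: "'p \<Rightarrow> complex" where "c = (\<lambda>_. if i = j then 1 else 0)"
      \<comment> \<open>Duality is available on \<open>W\<close> only. The error \<open>h\<close> is
        zero there and disappears by locality at \<open>z\<close>.\<close>
      define h where "h = (X i (x j \<circ> p) - c) * f"
      have c: "c \<in> S" unfolding c_def by (rule Sc)
      have h: "h \<in> S" unfolding h_def using X_in[OF i pull[OF x_in[OF j]]] c f by (intro Sc)
      have "e * h = h"
      proof
        fix y show "(e * h) y = h y"
          by (cases "y \<in> W") (simp_all add: h_def pointwise X_dual[OF i j] c_def e(3))
      qed
      then have "vanishing_order S z n h" by (intro vanishing_order_power[OF S e(1,2) h])
      then have "vdiff (x i) B h a z = 0" using a i by (rule kill)
      moreover have "X i (x j \<circ> p) * f = h + c * f" by (simp add: h_def algebra_simps)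
      moreover have "vdiff (x i) B (c * f) a = c * vdiff (x i) B f a"
        unfolding c_def using B'(8)[OF i f a] .
      ultimately have "vdiff (x i) B (X i (x j \<circ> p) * f) a z = c z * vdiff (x i) B f a z"
        using B'(2)[OF i h Sc(3)[OF c f] a] by (simp add: pointwise)
      then show ?thesis by (auto simp: c_def)
    qed
    have "substituted (x j) B f a z = (\<Sum>i<d. if i = j then vdiff (x j) B f a z else 0)"
      unfolding substituted_def sum_fun_apply by (intro sum.cong refl *) simp
    then show "vdiff (x j) B f a z = substituted (x j) B f a z"
      using j by simp
  qed
  have G_high: "w \<in> G" if w: "vanishing_order A (p z) (n + n) w" for w
  proof (rule G_I)
    show "w \<in> A" using vanishing_order_in[OF A w] .
    fix f a assume f: "f \<in> S" and a: "a \<in> A"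
    \<comment> \<open>Twice the order is required for the terms containing \<open>X i\<close>: the
      derivation hits only one of the factors \<open>u\<close> and \<open>v\<close>, and the other
      one still vanishes to order \<open>n\<close>.\<close>
    obtain u v where uv: "w = u * v" "vanishing_order A (p z) n u" "vanishing_order A (p z) n v"
      using vanishing_order_split[OF A w] by blast
    have uA: "u \<in> A" "v \<in> A" using uv vanishing_order_in[OF A] by blast+
    have up: "vanishing_order S z n (u \<circ> p)" "vanishing_order S z n (v \<circ> p)"
      using uv vanishing_order_pullback[of A p S z n] pull by blast+
    have "B ((w \<circ> p) * f) a z = 0"
    proof -
      have "vanishing_order S z n ((w \<circ> p) * f)"
        using vanishing_order_mult_right[OF S up(1) Sc(3)[OF pull[OF uA(2)] f]]
        by (simp add: uv(1) mult.assoc)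
      then show ?thesis
        using diff_op_along_vanishing_order[OF S bidiffD(3)[OF Bn a], of z "(w \<circ> p) * f"] by simp
    qed
    moreover have "B f (w * a) z = 0"
    proof -
      have "vanishing_order A (p z) n (w * a)"
        using vanishing_order_mult_right[OF A uv(2) Ac(3)[OF uA(2) a]]
        by (simp add: uv(1) mult.assoc)
      then show ?thesis
        using diff_op_along_vanishing_order[OF A bidiffD(4)[OF Bn f], of z "w * a"] by simp
    qed
    moreover have "vdiff (x i) B (X i (w \<circ> p) * f) a z = 0" if i: "i < d" for i
    proof -
      note Xu = X_in[OF i pull[OF uA(1)]] X_in[OF i pull[OF uA(2)]]
      have "X i (w \<circ> p) * f = (v \<circ> p) * (X i (u \<circ> p) * f) + (u \<circ> p) * (X i (v \<circ> p) * f)"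
        using X_mult[OF i pull[OF uA(1)] pull[OF uA(2)]] by (simp add: uv(1) algebra_simps)
      moreover have "vdiff (x i) B ((v \<circ> p) * (X i (u \<circ> p) * f)) a z = 0"
        "vdiff (x i) B ((u \<circ> p) * (X i (v \<circ> p) * f)) a z = 0"
        by (intro kill vanishing_order_mult_right[OF S] up Sc Xu f a i)+
      ultimately show ?thesis
        using B'(2)[OF i Sc(3)[OF pull[OF uA(2)] Sc(3)[OF Xu(1) f]] Sc(3)[OF pull[OF uA(1)] Sc(3)[OF Xu(2) f]] a]
        by (simp add: plus_fun_apply)
    qed
    ultimately show "vdiff w B f a z = substituted w B f a z"
      by (simp add: vdiff_apply substituted_def sum_fun_apply)
  qed
  \<comment> \<open>Iterated Hadamard expansion. Each round multiplies the prefactor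
    \<open>w\<close> by one more \<open>t i\<close>, and \<open>m\<close> counts the orders still
    missing until \<open>G_high\<close> applies.\<close>
  have taylor: "w * b \<in> G"
    if "w \<in> G" "vanishing_order A (p z) j w" "j + m = n + n" "b \<in> A" for w b j m
    using that
  proof (induction m arbitrary: w b j)
    case 0
    then show ?case by (auto intro: G_high vanishing_order_mult_right[OF A])
  next
    case (Suc m)
    obtain g U where g: "\<And>i. i < d \<Longrightarrow> g i \<in> A" and U: "open U" "p z \<in> U"
      and had: "\<And>y. y \<in> U \<Longrightarrow> b y = b (p z) + (\<Sum>i<d. (x i y - x i (p z)) * g i y)"
      using hadamard[OF z Suc.prems(4)] by blast
    define t where "t i = x i - (\<lambda>_. x i (p z))" for i
    have t: "t i \<in> A" "t i \<in> G" "t i (p z) = 0" if "i < d" for i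
    proof -
      show "t i \<in> A" unfolding t_def by (intro Ac x_in that)
      have "t i = x i + (\<lambda>_. - x i (p z))" by (simp add: t_def fun_eq_iff pointwise)
      then show "t i \<in> G" using G_add[OF G_x[OF that] G_const] by simp
      show "t i (p z) = 0" by (simp add: t_def pointwise)
    qed
    \<comment> \<open>The expansion is an equality near \<open>p z\<close> only. The globally
      defined remainder \<open>r\<close> vanishes there on a neighbourhood, hence to every
      order.\<close>
    define r where "r = b - (\<lambda>_. b (p z)) - (\<Sum>i<d. t i * g i)"
    have r: "r \<in> A" unfolding r_def by (intro Ac Suc.prems t g) auto
    obtain e where e: "e \<in> A" "e (p z) = 0" "\<And>y. y \<notin> U \<Longrightarrow> e y = 1"
      using separate_A[OF U] by blast
    have "e * r = r"
    proof
      fix y show "(e * r) y = r y"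
        by (cases "y \<in> U") (simp_all add: r_def t_def pointwise sum_fun_apply e(3) had[of y])
    qed
    then have "vanishing_order A (p z) (n + n) r" by (intro vanishing_order_power[OF A e(1,2) r])
    then have "w * r \<in> G"
      using G_A[OF Suc.prems(1)] by (intro G_high vanishing_order_mult_left[OF A])
    moreover have "(w * t i) * g i \<in> G" if i: "i < d" for i
    proof (rule Suc.IH[where j = "Suc j"])
      show "w * t i \<in> G" by (rule G_mult[OF Suc.prems(1) t(2)[OF i]])
      show "vanishing_order A (p z) (Suc j) (w * t i)"
        using vanishing_order.step[OF t(1,3)[OF i] Suc.prems(2)] by (simp add: mult.commute)
    qed (use Suc.prems(3) g i in auto)
    ultimately have "w * (\<lambda>_. b (p z)) + (\<Sum>i<d. (w * t i) * g i) + w * r \<in> G"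
      using G_mult[OF Suc.prems(1) G_const] by (intro G_add G_sum) auto
    moreover have "w * b = w * (\<lambda>_. b (p z)) + (\<Sum>i<d. (w * t i) * g i) + w * r"
      by (simp add: r_def sum_distrib_left algebra_simps)
    ultimately show ?case by simp
  qed
  have "1 * u \<in> G"
    by (rule taylor[where j = 0 and m = "n + n"])
      (auto intro: G_const[of 1, folded one_fun_def] vanishing_order.base Ac u)
  then show ?thesis using G_D[OF _ f a] by simp
qed


text \<open>Both \<open>vdiff u\<close> and \<open>substituted u\<close> commute with
  \<open>vdiff v\<close>, since all of them are multiplications on \<open>S \<otimes> A\<close>. So
  the congruence modulo \<open>I\<^sup>2\<close> propagates to higher powers of
  \<open>I\<close>.\<close>

lemma vdiff_minus_substituted:
  assumes "u \<in> A"
  shows "bidiff S A p k l B \<Longrightarrow> vanishes_to_order W (n + 2) B \<Longrightarrow>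
    vanishes_to_order W n (\<lambda>f a. vdiff u B f a - substituted u B f a)"
proof (induction n arbitrary: B)
  case 0
  have "vanishes_to_order W 2 B" using 0(2) by (simp only: add_0)
  then show ?case
    using vdiff_eq_substituted[OF 0(1) _ assms] by (simp add: minus_apply)
next
  case (Suc n)
  have "vanishes_to_order W n (vdiff v (\<lambda>f a. vdiff u B f a - substituted u B f a))" if v: "v \<in> A" for v
  proof (rule vanishes_cong)
    show "vanishes_to_order W n (\<lambda>f a. vdiff u (vdiff v B) f a - substituted u (vdiff v B) f a)"
      using Suc.prems(2) v by (intro Suc.IH bidiff_vdiff[OF Suc.prems(1)]) simp_all
    show "vdiff v (\<lambda>f a. vdiff u B f a - substituted u B f a) f a z =
        (vdiff u (vdiff v B) f a - substituted u (vdiff v B) f a) z" for f a z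
      by (simp add: vdiff_commute[of u v] vdiff_substituted[symmetric])
        (simp add: vdiff_apply[of v] minus_apply)
  qed
  then show ?case by simp
qed

text \<open>For a multiplier \<open>t = p\<^sup>*u \<otimes> 1 - 1 \<otimes> u\<close> the Leibniz
  rule gives \<open>(n + 1 + \<theta>)(t y) = t (n + \<theta>) y + (t + \<theta> t) y\<close>, and
  \<open>t + \<theta> t\<close> lies in \<open>I\<^sup>2\<close> over \<open>W\<close> as far as
  \<open>B\<close> can see. By induction \<open>n + \<theta>\<close> maps \<open>I\<^sup>n\<close>
  into \<open>I\<^sup>n\<^sup>+\<^sup>1\<close>, here in dual form.\<close>

lemma theta_step:
  "bidiff S A p k l B \<Longrightarrow> vanishes_to_order W (Suc n) B \<Longrightarrow>
    vanishes_to_order W n (\<lambda>f a. (\<lambda>_. of_nat n) * B f a + theta B f a)"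
proof (induction n arbitrary: B)
  case 0
  have "vdiff (x i) B (X i f) a z = 0" if "f \<in> S" "a \<in> A" "z \<in> W" "i < d" for f a z i
    using 0(2) that x_in X_in by simp
  then have "theta B f a z = 0" if "f \<in> S" "a \<in> A" "z \<in> W" for f a z
    using that by (simp add: theta_eq_vdiff pointwise sum_fun_apply)
  then show ?case by (simp add: plus_fun_apply times_fun_apply)
next
  case (Suc n)
  have "vanishes_to_order W n (vdiff u (\<lambda>f a. (\<lambda>_. of_nat (Suc n)) * B f a + theta B f a))"
    if u: "u \<in> A" for u
  proof (rule vanishes_cong[OF vanishes_add])
    show "vanishes_to_order W n (\<lambda>f a. (\<lambda>_. of_nat n) * vdiff u B f a + theta (vdiff u B) f a)"
      using Suc.prems(2) u by (intro Suc.IH bidiff_vdiff[OF Suc.prems(1)]) simp_all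
    show "vanishes_to_order W n (\<lambda>f a. vdiff u B f a - substituted u B f a)"
      using Suc.prems by (intro vdiff_minus_substituted u) simp_all
    fix f a z assume "f \<in> S" "a \<in> A" "z \<in> W"
    then have "theta (vdiff u B) f a = vdiff u (theta B) f a + substituted u B f a"
      using vdiff_theta[OF Suc.prems(1) u] by simp
    then show "vdiff u (\<lambda>f a. (\<lambda>_. of_nat (Suc n)) * B f a + theta B f a) f a z =
      ((\<lambda>_. of_nat n) * vdiff u B f a + theta (vdiff u B) f a + (vdiff u B f a - substituted u B f a)) z"
      by (simp add: vdiff_apply plus_fun_apply times_fun_apply minus_apply algebra_simps)
  qed
  then show ?case by simp
qed

section \<open>The splitting as a product of the factors 1 + \<theta>/k\<close>

definition contraction :: "nat \<Rightarrow> ('p, 'm) bioperator \<Rightarrow>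
    ('p, 'm) bioperator" where
  "contraction n B f a = B f a + (\<lambda>_. 1 / of_nat n) * theta B f a"

text \<open>\<open>splitting N B f a\<close> is the value of \<open>B\<close> on \<open>(1 \<otimes> a) s(f)\<close>, where \<open>s(f)\<close> is the product over \<open>k \<le> N\<close>.\<close>

primrec splitting :: "nat \<Rightarrow> ('p, 'm) bioperator \<Rightarrow>
    ('p, 'm) bioperator" where
  "splitting 0 B = B"
| "splitting (Suc n) B = splitting n (contraction (Suc n) B)"

lemma bidiff_contraction: "bidiff S A p k l B \<Longrightarrow> bidiff S A p (k + 2) l (contraction n B)"
  unfolding contraction_def[abs_def]
  by (intro bidiff_add bidiff_mult_left bidiff_theta Sc) (auto intro: bidiff_mono)

text \<open>Each of the \<open>N\<close> factors contains one derivation \<open>X i\<close>, whose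
  order bound is 2. Only the first slot is differentiated.\<close>

lemma bidiff_splitting: "bidiff S A p k l B \<Longrightarrow> bidiff S A p (k + 2 * N) l (splitting N B)"
proof (induction N arbitrary: k B)
  case (Suc N)
  show ?case using Suc.IH[OF bidiff_contraction[OF Suc.prems]] by simp
qed simp

lemma contraction_vanishes:
  assumes "bidiff S A p k l B" "vanishes_to_order W (Suc (Suc n)) B"
  shows "vanishes_to_order W (Suc n) (contraction (Suc n) B)"
proof (rule vanishes_cong[OF vanishes_mult_left[OF theta_step[OF assms]]])
  have [simp]: "1 + complex_of_nat n \<noteq> 0" by (metis of_nat_Suc of_nat_neq_0)
  show "contraction (Suc n) B f a z =
      ((\<lambda>_. 1 / of_nat (Suc n)) * ((\<lambda>_. of_nat (Suc n)) * B f a + theta B f a)) z" for f a z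
    by (simp add: contraction_def plus_fun_apply times_fun_apply field_simps)
qed

text \<open>On arguments the factor with \<open>k = 1\<close> acts before the one with
  \<open>k = 2\<close>, and so on. Each factor raises the power of \<open>I\<close> by one, so
  dually each contraction gives up one order of vanishing until only \<open>I\<close> is
  left.\<close>

lemma splitting_vanishes:
  "bidiff S A p k l B \<Longrightarrow> vanishes_to_order W (Suc N) B \<Longrightarrow> vanishes_to_order W 1 (splitting N B)"
proof (induction N arbitrary: k B)
  case (Suc N)
  show ?case
    using Suc.IH[OF bidiff_contraction[OF Suc.prems(1)] contraction_vanishes[OF Suc.prems]] by simp
qed simp

text \<open>The difference \<open>p\<^sup>*a f \<otimes> 1 - f \<otimes> a\<close> lies in
  \<open>I\<close>, and the product of factors sends it into a power of \<open>I\<close> that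
  \<open>B\<close> annihilates. \<open>N\<close> is compared with the orders of \<open>B\<close>
  itself, not with the larger ones of \<open>splitting N B\<close>, so its choice is not
  circular.\<close>

lemma splitting_linear_over_base:
  assumes B: "bidiff S A p k l B" and "k + l \<le> N" and f: "f \<in> S" and a: "a \<in> A" and z: "z \<in> W"
  shows "splitting N B ((a \<circ> p) * f) 1 z = splitting N B f a z"
proof -
  have "vanishes_to_order W 1 (splitting N B)"
    by (rule splitting_vanishes[OF B bidiff_vanishes[OF B]]) (use assms(2) in simp)
  then have "vdiff a (splitting N B) f 1 z = 0"
    using f a z Ac(5) by simp
  then show ?thesis by (simp add: vdiff_apply)
qed

lemma splitting_add:
  "splitting N (\<lambda>f a. B f a + C f a) = (\<lambda>f a. splitting N B f a + splitting N C f a)"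
proof (induction N arbitrary: B C)
  case (Suc N)
  have "contraction (Suc N) (\<lambda>f a. B f a + C f a) =
      (\<lambda>f a. contraction (Suc N) B f a + contraction (Suc N) C f a)"
    by (intro ext) (simp add: contraction_def theta_def sum.distrib sum_subtractf pointwise sum_fun_apply
        algebra_simps)
  then show ?case using Suc.IH by simp
qed simp

lemma splitting_mult_left:
  "splitting N (\<lambda>f a. h * B f a) = (\<lambda>f a. h * splitting N B f a)"
proof (induction N arbitrary: B)
  case (Suc N)
  have "contraction (Suc N) (\<lambda>f a. h * B f a) = (\<lambda>f a. h * contraction (Suc N) B f a)"
    by (intro ext) (simp add: contraction_def theta_def sum_subtractf pointwise sum_fun_apply
        algebra_simps sum_distrib_left)
  then show ?case using Suc.IH by simp
qed simp

lemma splitting_shift: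
  "splitting N (\<lambda>f a. B f (b * a)) = (\<lambda>f a. splitting N B f (b * a))"
proof (induction N arbitrary: B)
  case (Suc N)
  have "contraction (Suc N) (\<lambda>f a. B f (b * a)) = (\<lambda>f a. contraction (Suc N) B f (b * a))"
    by (intro ext) (simp add: contraction_def theta_def mult.left_commute)
  then show ?case using Suc.IH by simp
qed simp

text \<open>An operator that depends only on the product \<open>(a \<circ> p) * f\<close>
  annihilates \<open>I\<close>, where \<theta> takes its values. Of each factor only the summand 1
  survives.\<close>

lemma splitting_balanced:
  "splitting N (\<lambda>f a. D ((a \<circ> p) * f)) = (\<lambda>f a. D ((a \<circ> p) * f))"
proof (induction N)
  case (Suc N)
  have "contraction (Suc N) (\<lambda>f a. D ((a \<circ> p) * f)) = (\<lambda>f a. D ((a \<circ> p) * f))"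
    by (intro ext) (simp add: contraction_def theta_def ac_simps)
  then show ?case using Suc.IH by simp
qed simp

text \<open>Derivations annihilate 1, so \<open>\<theta>(1 \<otimes> a) = 0\<close> and
  \<open>s(1) = 1 \<otimes> 1\<close>. Preservation of the fibration rests on this
  normalisation.\<close>

lemma splitting_one:
  "bidiff S A p k l B \<Longrightarrow> a \<in> A \<Longrightarrow> splitting N B 1 a = B 1 a"
proof (induction N arbitrary: k B)
  case (Suc N)
  have "theta B 1 a = 0"
    unfolding theta_def
    by (intro sum.neutral) (simp add: X_one bidiff_simps[OF Suc.prems(1)] x_in Ac Suc.prems(2))
  then have "contraction (Suc N) B 1 a = B 1 a" by (simp add: contraction_def)
  then show ?case
    using Suc.IH[OF bidiff_contraction[OF Suc.prems(1)] Suc.prems(2)] by simp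
qed simp

lemma splitting_cong:
  "(\<And>f a. f \<in> S \<Longrightarrow> a \<in> A \<Longrightarrow> B f a = C f a) \<Longrightarrow> f \<in> S \<Longrightarrow> a \<in> A \<Longrightarrow> splitting N B f a = splitting N C f a"
proof (induction N arbitrary: B C f a)
  case (Suc N)
  have "contraction (Suc N) B g b = contraction (Suc N) C g b" if "g \<in> S" "b \<in> A" for g b
  proof -
    have "theta B g b = theta C g b"
      unfolding theta_def
      by (intro sum.cong refl arg_cong2[of _ _ _ _ "(-)"] Suc.prems(1) X_in Sc Ac pull x_in that) auto
    then show ?thesis using Suc.prems(1)[OF that] by (simp add: contraction_def)
  qed
  then show ?case
    using Suc.IH[of "contraction (Suc N) B" "contraction (Suc N) C" f a] Suc.prems(2,3) by simp
qed simp

text \<open>The splitting evaluates \<open>\<phi> b\<close> at other \<open>f\<close> and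
  \<open>a\<close> and forms finite sums and multiples of the values. The argument \<open>b\<close>
  is a spectator, so linearity and order in \<open>b\<close> are inherited; primitives of 2-cocycles
  thereby remain differential in their last slot.\<close>

lemma splitting_parameter:
  assumes "\<And>f a. f \<in> S \<Longrightarrow> a \<in> A \<Longrightarrow> linear_op A' S (\<lambda>b. \<phi> b f a) \<and> diff_op_along A' q m (\<lambda>b. \<phi> b f a)"
    and A': "function_algebra A'"
  shows "f \<in> S \<Longrightarrow> a \<in> A \<Longrightarrow> linear_op A' S (\<lambda>b. splitting N (\<phi> b) f a) \<and>
    diff_op_along A' q m (\<lambda>b. splitting N (\<phi> b) f a)"
  using assms(1)
proof (induction N arbitrary: \<phi> f a)
  case (Suc N)
  have "linear_op A' S (\<lambda>b. contraction (Suc N) (\<phi> b) f a) \<and>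
      diff_op_along A' q m (\<lambda>b. contraction (Suc N) (\<phi> b) f a)" if f: "f \<in> S" and a: "a \<in> A" for f a
  proof -
    have 1: "linear_op A' S (\<lambda>b. \<phi> b f a)" "diff_op_along A' q m (\<lambda>b. \<phi> b f a)"
      using Suc.prems(3)[OF f a] by auto
    have 2: "linear_op A' S (\<lambda>b. \<phi> b (X i f) (x i * a) - \<phi> b ((x i \<circ> p) * X i f) a)"
      "diff_op_along A' q m (\<lambda>b. \<phi> b (X i f) (x i * a) - \<phi> b ((x i \<circ> p) * X i f) a)" if i: "i < d" for i
    proof -
      have 3: "X i f \<in> S" "x i * a \<in> A" "(x i \<circ> p) * X i f \<in> S"
        by (intro X_in[OF i f] Ac(3)[OF x_in[OF i] a] Sc(3)[OF pull[OF x_in[OF i]] X_in[OF i f]])+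
      show "linear_op A' S (\<lambda>b. \<phi> b (X i f) (x i * a) - \<phi> b ((x i \<circ> p) * X i f) a)"
        using Suc.prems(3)[OF 3(1,2)] Suc.prems(3)[OF 3(3) a] by (simp only: linear_op_diff[OF _ _ S])
      show "diff_op_along A' q m (\<lambda>b. \<phi> b (X i f) (x i * a) - \<phi> b ((x i \<circ> p) * X i f) a)"
        using Suc.prems(3)[OF 3(1,2)] Suc.prems(3)[OF 3(3) a] by (simp only: diff_op_along_diff[OF A'])
    qed
    have 4: "linear_op A' S (\<lambda>b. theta (\<phi> b) f a)" "diff_op_along A' q m (\<lambda>b. theta (\<phi> b) f a)"
      unfolding theta_def
      by (rule linear_op_sum[OF _ S], rule 2(1), simp, rule diff_op_along_sum[OF A'], rule 2(2), simp)
    show ?thesis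
      unfolding contraction_def using 1 4
      by (simp only: linear_op_add[OF _ _ S] linear_op_mult_left[OF _ _ S] Sc(1) diff_op_along_add[OF A']
          diff_op_along_mult_left[OF A'])
  qed
  from Suc.IH[OF Suc.prems(1,2) this] show ?case by simp
qed simp

end


text \<open>\<open>\<eta>\<close> is a partition of unity in a weak sense: \<open>\<eta> n\<close>
  vanishes pointwise off \<open>W n\<close>, which suffices because the functions to be glued are
  already global elements of \<open>S\<close>. The sum is prescribed over any initial segment
  containing all nonzero terms, which keeps all sums finite.\<close>

locale framed_submersion = pulled_back_algebra S A p
  for S :: "('p::topological_space \<Rightarrow> complex) set" and A :: "('m::topological_space \<Rightarrow> complex) set"
    and p :: "'p \<Rightarrow> 'm" +
  fixes W :: "nat \<Rightarrow> 'p set" and d :: nat and x :: "nat \<Rightarrow> nat \<Rightarrow> 'm \<Rightarrow> complex"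
    and X :: "nat \<Rightarrow> nat \<Rightarrow> ('p \<Rightarrow> complex) \<Rightarrow> ('p \<Rightarrow> complex)"
    and \<eta> :: "nat \<Rightarrow> 'p \<Rightarrow> complex"
  assumes frame: "local_frame S A p (W n) d (x n) (X n)"
    and S_locally: "(\<And>z. \<exists>g\<in>S. \<exists>U. open U \<and> z \<in> U \<and> (\<forall>y\<in>U. f y = g y)) \<Longrightarrow> f \<in> S"
    and eta_in: "\<eta> n \<in> S"
    and eta_support: "\<eta> n z \<noteq> 0 \<Longrightarrow> z \<in> W n"
    and eta_locally_finite: "\<exists>U m. open U \<and> z \<in> U \<and> (\<forall>n\<ge>m. \<forall>y\<in>U. \<eta> n y = 0)"
    and eta_sum: "(\<And>n. n \<ge> m \<Longrightarrow> \<eta> n z = 0) \<Longrightarrow> (\<Sum>n<m. \<eta> n z) = 1"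
begin

text \<open>\<open>LEAST\<close> selects a finite initial segment that depends on
  \<open>\<eta>\<close> and \<open>z\<close> alone. Linearity of \<open>glue\<close> in
  \<open>F\<close> is then that of finite sums.\<close>

definition glue :: "(nat \<Rightarrow> 'p \<Rightarrow> complex) \<Rightarrow> 'p \<Rightarrow> complex" where
  "glue F z = (\<Sum>n<(LEAST m. \<forall>n\<ge>m. \<eta> n z = 0). \<eta> n z * F n z)"

lemma glue_eq:
  assumes "\<And>n. n \<ge> m \<Longrightarrow> \<eta> n z = 0"
  shows "glue F z = (\<Sum>n<m. \<eta> n z * F n z)"
proof -
  define l where "l = (LEAST m. \<forall>n\<ge>m. \<eta> n z = 0)"
  have zero: "\<forall>n\<ge>l. \<eta> n z = 0" unfolding l_def by (rule LeastI[of _ m]) (use assms in blast)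
  have "l \<le> m" unfolding l_def by (rule Least_le) (use assms in blast)
  then have "(\<Sum>n<l. \<eta> n z * F n z) = (\<Sum>n<m. \<eta> n z * F n z)"
    using zero by (intro sum.mono_neutral_left) auto
  then show ?thesis unfolding glue_def l_def .
qed

lemma eta_eventually_zero:
  obtains m where "\<And>n. n \<ge> m \<Longrightarrow> \<eta> n z = 0"
  using eta_locally_finite[of z] by blast

text \<open>Wherever \<open>z\<close> lies outside \<open>W n\<close>, the weight
  \<open>\<eta> n z\<close> is zero. Identities known over each patch separately can therefore be
  glued.\<close>

lemma glue_cong:
  assumes "\<And>n. z \<in> W n \<Longrightarrow> F n z = G n z"
  shows "glue F z = glue G z"
  unfolding glue_def
proof (intro sum.cong refl)
  show "\<eta> n z * F n z = \<eta> n z * G n z" for n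
    using assms[of n] eta_support[of n z] by (cases "\<eta> n z = 0") auto
qed

lemma glue_const: "glue (\<lambda>n. f) z = f z"
proof -
  obtain m where m: "\<And>n. n \<ge> m \<Longrightarrow> \<eta> n z = 0" using eta_eventually_zero[of z] by metis
  show ?thesis using glue_eq[OF m] eta_sum[OF m] by (simp flip: sum_distrib_right)
qed

lemma glue_add: "glue (\<lambda>n. F n + G n) = glue F + glue G"
  by (rule ext) (simp add: glue_def pointwise distrib_left sum.distrib)

lemma glue_diff: "glue (\<lambda>n. F n - G n) = glue F - glue G"
  by (rule ext) (simp add: glue_def pointwise right_diff_distrib sum_subtractf)

lemma glue_mult: "glue (\<lambda>n. h * F n) = h * glue F"
  by (rule ext) (simp add: glue_def pointwise sum_distrib_left mult.left_commute)

lemma glue_in: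
  assumes "\<And>n. F n \<in> S"
  shows "glue F \<in> S"
proof (rule S_locally)
  fix z
  obtain U m where U: "open U" "z \<in> U" "\<And>n y. n \<ge> m \<Longrightarrow> y \<in> U \<Longrightarrow> \<eta> n y = 0"
    using eta_locally_finite[of z] by blast
  have "\<forall>y\<in>U. glue F y = (\<Sum>n<m. \<eta> n * F n) y"
    using glue_eq[OF U(3)] by (simp add: pointwise sum_fun_apply)
  moreover have "(\<Sum>n<m. \<eta> n * F n) \<in> S" by (intro Sc eta_in assms)
  ultimately show "\<exists>g\<in>S. \<exists>U. open U \<and> z \<in> U \<and> (\<forall>y\<in>U. glue F y = g y)"
    using U by blast
qed

lemma linear_op_glue:
  assumes "\<And>n. linear_op A' S (D n)"
  shows "linear_op A' S (\<lambda>b. glue (\<lambda>n. D n b))"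
proof (rule linear_opI)
  note D = linear_opD[OF assms]
  show "glue (\<lambda>n. D n b) \<in> S" if "b \<in> A'" for b by (intro glue_in D that)
  show "glue (\<lambda>n. D n (f + g)) = glue (\<lambda>n. D n f) + glue (\<lambda>n. D n g)" if "f \<in> A'" "g \<in> A'" for f g
    using that by (simp only: D(2) glue_add)
  show "glue (\<lambda>n. D n ((\<lambda>_. c) * f)) = (\<lambda>_. c) * glue (\<lambda>n. D n f)" if "f \<in> A'" for c f
    using that by (simp only: D(3) glue_mult)
qed

lemma diff_op_along_glue:
  assumes A': "function_algebra A'"
  shows "(\<And>n. diff_op_along A' q k (D n)) \<Longrightarrow> diff_op_along A' q k (\<lambda>b. glue (\<lambda>n. D n b))"
proof (induction k arbitrary: D)
  case 0
  have "glue (\<lambda>n. D n b) = glue (\<lambda>n. 0)" if "b \<in> A'" for b using 0 that by simp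
  moreover have "glue (\<lambda>n. 0) = 0" by (rule ext) (simp add: glue_def pointwise)
  ultimately show ?case by simp
next
  case (Suc k)
  have "diff_op_along A' q k (\<lambda>b. glue (\<lambda>n. D n (g * b)) - (g \<circ> q) * glue (\<lambda>n. D n b))"
    if g: "g \<in> A'" for g
  proof (rule diff_op_along_cong[OF A' Suc.IH])
    show "diff_op_along A' q k (\<lambda>b. D n (g * b) - (g \<circ> q) * D n b)" for n
      using Suc.prems g by simp
    show "glue (\<lambda>n. D n (g * b) - (g \<circ> q) * D n b) =
        glue (\<lambda>n. D n (g * b)) - (g \<circ> q) * glue (\<lambda>n. D n b)" for b
      by (simp only: glue_diff glue_mult)
  qed
  then show ?case by simp
qed

section \<open>The homotopy operator and triviality of Hochschild cocycles in degrees one and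
  two\<close>

definition homotopy :: "nat \<Rightarrow> ('p, 'm) bioperator \<Rightarrow>
    ('p \<Rightarrow> complex) \<Rightarrow> ('p \<Rightarrow> complex)" where
  "homotopy N B f = glue (\<lambda>n. local_frame.splitting p d (x n) (X n) N B f 1)"

lemma homotopy_operator:
  assumes "bidiff S A p k l B"
  shows "linear_op S S (homotopy N B)" "diff_op_along S id (k + 2 * N) (homotopy N B)"
proof -
  note B = bidiffD[OF local_frame.bidiff_splitting[OF frame assms]]
  show "linear_op S S (homotopy N B)"
    using linear_op_glue[OF B(1)[OF Ac(5)]] unfolding homotopy_def[abs_def] .
  show "diff_op_along S id (k + 2 * N) (homotopy N B)"
    using diff_op_along_glue[OF S B(3)[OF Ac(5)]] unfolding homotopy_def[abs_def] .
qed

lemma homotopy_zero: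
  assumes zero: "\<And>f a. f \<in> S \<Longrightarrow> a \<in> A \<Longrightarrow> B f a = 0" and f: "f \<in> S"
  shows "homotopy N B f = 0"
proof -
  have "local_frame.splitting p d (x n) (X n) N B f 1 = 0" for n
  proof -
    interpret local_frame S A p "W n" d "x n" "X n" by (rule frame)
    \<comment> \<open>Only the values of \<open>B\<close> on \<open>S\<close> and \<open>A\<close>
      enter the splitting, so \<open>B\<close> may be replaced by a multiple with coefficient zero,
      to which left linearity applies.\<close>
    have "splitting N B f 1 = splitting N (\<lambda>f a. 0 * B f a) f 1"
      using zero by (intro splitting_cong[where B = B and C = "\<lambda>f a. 0 * B f a"] f Ac) simp
    also have "\<dots> = 0"
      using splitting_mult_left[of N 0 B] by (simp only: mult_zero_left)
    finally show ?thesis .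
  qed
  then have "homotopy N B f = glue (\<lambda>n. 0)" by (simp only: homotopy_def)
  then show ?thesis by (simp only: glue_const fun_eq_iff) simp
qed

text \<open>Evaluate the cocycle identity, as a function of the pair \<open>(f, a)\<close>, on
  \<open>s(f)\<close>. The term depending on the product alone returns \<open>B f b\<close>. The
  term with \<open>a * b\<close> is \<open>B\<close> on \<open>(1 \<otimes> b) s(f)\<close>, which
  agrees with \<open>B\<close> on \<open>s(p\<^sup>*b f)\<close>. All of this holds patchwise and is
  left \<open>S\<close>-linear, so it survives gluing.\<close>

lemma cocycle1_is_coboundary:
  assumes B: "bidiff S A p k l B" and N: "k + l \<le> N"
    and cocycle: "\<And>f a b. f \<in> S \<Longrightarrow> a \<in> A \<Longrightarrow> b \<in> A \<Longrightarrow>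
      B ((a \<circ> p) * f) b - B f (a * b) + B f a * (b \<circ> p) = 0"
    and f: "f \<in> S" and b: "b \<in> A"
  shows "B f b = homotopy N B ((b \<circ> p) * f) - (b \<circ> p) * homotopy N B f"
proof
  fix z
  have eq: "B f b z = (local_frame.splitting p d (x n) (X n) N B ((b \<circ> p) * f) 1 -
      (b \<circ> p) * local_frame.splitting p d (x n) (X n) N B f 1) z" if z: "z \<in> W n" for n
  proof -
    interpret local_frame S A p "W n" d "x n" "X n" by (rule frame)
    have "B f b = splitting N (\<lambda>f a. B ((a \<circ> p) * f) b) f 1"
      using splitting_balanced[of N "\<lambda>g. B g b"] by simp
    also have "\<dots> = splitting N (\<lambda>f a. B f (b * a) + (- (b \<circ> p)) * B f a) f 1"
    proof (rule splitting_cong)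
      show "B ((a \<circ> p) * f) b = B f (b * a) + (- (b \<circ> p)) * B f a" if "f \<in> S" "a \<in> A" for f a
        using cocycle[OF that b] by (simp add: algebra_simps)
    qed (fact f Ac)+
    also have "\<dots> = splitting N B f b + (- (b \<circ> p)) * splitting N B f 1"
      by (simp only: splitting_add splitting_mult_left splitting_shift mult_1_right)
    finally show ?thesis
      using splitting_linear_over_base[OF B N f b z] by (simp add: pointwise)
  qed
  have "B f b z = glue (\<lambda>n. B f b) z" by (rule glue_const[symmetric])
  also have "\<dots> = glue (\<lambda>n. local_frame.splitting p d (x n) (X n) N B ((b \<circ> p) * f) 1 -
      (b \<circ> p) * local_frame.splitting p d (x n) (X n) N B f 1) z"
    by (rule glue_cong) (rule eq)
  finally show "B f b z = (homotopy N B ((b \<circ> p) * f) - (b \<circ> p) * homotopy N B f) z"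
    by (simp only: glue_diff glue_mult homotopy_def)
qed

context
  fixes k l m N :: nat
    and \<phi> :: "('p \<Rightarrow> complex) \<Rightarrow> ('m \<Rightarrow> complex) \<Rightarrow> ('m \<Rightarrow> complex) \<Rightarrow> ('p \<Rightarrow> complex)"
  assumes phi: "\<And>b. b \<in> A \<Longrightarrow> bidiff S A p k l (\<lambda>f a. \<phi> f a b)"
    and phi_last: "\<And>f a. f \<in> S \<Longrightarrow> a \<in> A \<Longrightarrow> linear_op A S (\<phi> f a) \<and> diff_op_along A p m (\<phi> f a)"
begin

text \<open>The splitting acts on the pair \<open>(f, a)\<close>, with \<open>b\<close> as a
  parameter: the order in \<open>f\<close> grows by \<open>2 * N\<close>, the order \<open>m\<close>
  in \<open>b\<close> is unchanged.\<close>

lemma homotopy_bidiff: "bidiff S A p (k + 2 * N) m (\<lambda>f b. homotopy N (\<lambda>f a. \<phi> f a b) f)"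
proof (rule bidiffI)
  fix f assume f: "f \<in> S"
  have par: "linear_op A S (\<lambda>b. local_frame.splitting p d (x n) (X n) N (\<lambda>f a. \<phi> f a b) f 1) \<and>
      diff_op_along A p m (\<lambda>b. local_frame.splitting p d (x n) (X n) N (\<lambda>f a. \<phi> f a b) f 1)" for n
    by (rule local_frame.splitting_parameter[OF frame, where \<phi> = "\<lambda>b f a. \<phi> f a b"])
      (simp_all add: phi_last A f Ac)
  show "linear_op A S (\<lambda>b. homotopy N (\<lambda>f a. \<phi> f a b) f)"
    unfolding homotopy_def by (rule linear_op_glue) (use par in blast)
  show "diff_op_along A p m (\<lambda>b. homotopy N (\<lambda>f a. \<phi> f a b) f)"
    unfolding homotopy_def by (rule diff_op_along_glue[OF A]) (use par in blast)
qed (use homotopy_operator[OF phi] in blast)+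

text \<open>\<open>A\<close>-linearity of \<open>s\<close> at \<open>f = 1\<close> and
  \<open>s(1) = 1 \<otimes> 1\<close> reduce \<open>s(p\<^sup>*a)\<close> to
  \<open>1 \<otimes> a\<close>. This value of the primitive is what forces the corrected action to
  agree with the star product on pullbacks.\<close>

lemma homotopy_pullback:
  assumes N: "k + l \<le> N" and a: "a \<in> A" and b: "b \<in> A"
  shows "homotopy N (\<lambda>f a. \<phi> f a b) (a \<circ> p) = \<phi> 1 a b"
proof
  fix z
  have eq: "local_frame.splitting p d (x n) (X n) N (\<lambda>f a. \<phi> f a b) (a \<circ> p) 1 z = \<phi> 1 a b z"
    if z: "z \<in> W n" for n
  proof -
    interpret local_frame S A p "W n" d "x n" "X n" by (rule frame)
    show ?thesis
      using splitting_linear_over_base[OF phi[OF b] N Sc(5) a z] splitting_one[OF phi[OF b] a, of N] by simp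
  qed
  have "homotopy N (\<lambda>f a. \<phi> f a b) (a \<circ> p) z = glue (\<lambda>n. \<phi> 1 a b) z"
    unfolding homotopy_def by (rule glue_cong) (rule eq)
  then show "homotopy N (\<lambda>f a. \<phi> f a b) (a \<circ> p) z = \<phi> 1 a b z"
    by (simp only: glue_const)
qed

text \<open>As in degree one, with \<open>b\<close> and \<open>c\<close> held fixed: evaluated on
  \<open>s(f)\<close>, the balanced term returns \<open>\<phi> f b c\<close>, and
  \<open>A\<close>-linearity of \<open>s\<close> turns the term shifted by \<open>b\<close> into the
  first homotopy term.\<close>

lemma cocycle2_is_coboundary:
  assumes N: "k + l \<le> N"
    and cocycle: "\<And>f a b c. f \<in> S \<Longrightarrow> a \<in> A \<Longrightarrow> b \<in> A \<Longrightarrow> c \<in> A \<Longrightarrow>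
      \<phi> ((a \<circ> p) * f) b c - \<phi> f (a * b) c + \<phi> f a (b * c) - \<phi> f a b * (c \<circ> p) = 0"
    and f: "f \<in> S" and b: "b \<in> A" and c: "c \<in> A"
  shows "\<phi> f b c = homotopy N (\<lambda>f a. \<phi> f a c) ((b \<circ> p) * f) - homotopy N (\<lambda>f a. \<phi> f a (b * c)) f
    + (c \<circ> p) * homotopy N (\<lambda>f a. \<phi> f a b) f"
proof
  fix z
  have eq: "\<phi> f b c z = (local_frame.splitting p d (x n) (X n) N (\<lambda>f a. \<phi> f a c) ((b \<circ> p) * f) 1
      - local_frame.splitting p d (x n) (X n) N (\<lambda>f a. \<phi> f a (b * c)) f 1
      + (c \<circ> p) * local_frame.splitting p d (x n) (X n) N (\<lambda>f a. \<phi> f a b) f 1) z"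
    if z: "z \<in> W n" for n
  proof -
    interpret local_frame S A p "W n" d "x n" "X n" by (rule frame)
    have "\<phi> f b c = splitting N (\<lambda>f a. \<phi> ((a \<circ> p) * f) b c) f 1"
      using splitting_balanced[of N "\<lambda>g. \<phi> g b c"] by simp
    also have "\<dots> = splitting N (\<lambda>f a. \<phi> f (b * a) c + ((- 1) * \<phi> f a (b * c) + (c \<circ> p) * \<phi> f a b)) f 1"
    proof (rule splitting_cong)
      show "\<phi> ((a \<circ> p) * f) b c = \<phi> f (b * a) c + ((- 1) * \<phi> f a (b * c) + (c \<circ> p) * \<phi> f a b)"
        if "f \<in> S" "a \<in> A" for f a
        using cocycle[OF that b c] by (simp add: algebra_simps)
    qed (fact f Ac)+
    also have "\<dots> = splitting N (\<lambda>f a. \<phi> f a c) f b +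
        ((- 1) * splitting N (\<lambda>f a. \<phi> f a (b * c)) f 1 + (c \<circ> p) * splitting N (\<lambda>f a. \<phi> f a b) f 1)"
      using splitting_shift[of N "\<lambda>f a. \<phi> f a c" b]
      by (simp only: splitting_add splitting_mult_left mult_1_right)
    finally show ?thesis
      using splitting_linear_over_base[OF phi[OF c] N f b z] by (simp add: pointwise)
  qed
  have "\<phi> f b c z = glue (\<lambda>n. \<phi> f b c) z" by (rule glue_const[symmetric])
  also have "\<dots> = glue (\<lambda>n. local_frame.splitting p d (x n) (X n) N (\<lambda>f a. \<phi> f a c) ((b \<circ> p) * f) 1
      - local_frame.splitting p d (x n) (X n) N (\<lambda>f a. \<phi> f a (b * c)) f 1
      + (c \<circ> p) * local_frame.splitting p d (x n) (X n) N (\<lambda>f a. \<phi> f a b) f 1) z"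
    by (rule glue_cong) (rule eq)
  finally show "\<phi> f b c z = (homotopy N (\<lambda>f a. \<phi> f a c) ((b \<circ> p) * f) -
      homotopy N (\<lambda>f a. \<phi> f a (b * c)) f + (c \<circ> p) * homotopy N (\<lambda>f a. \<phi> f a b) f) z"
    by (simp only: glue_add glue_diff glue_mult homotopy_def)
qed

end

end

section \<open>Formal power series of operators\<close>

unbundle no vec_syntax
unbundle fps_syntax

text \<open>Dependent choice for conditions that at stage \<open>r\<close> see only the entries up
  to \<open>r\<close>. In the auxiliary \<open>g n\<close> the entries below \<open>n\<close> are
  final, and the diagonal of these partial sequences is the solution.\<close>

lemma dependent_sequence:
  fixes Q :: "nat \<Rightarrow> (nat \<Rightarrow> 'x) \<Rightarrow> bool"
  assumes step: "\<And>r \<rho>. (\<And>s. s < r \<Longrightarrow> Q s \<rho>) \<Longrightarrow> \<exists>y. Q r (\<rho>(r := y))"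
    and local: "\<And>r \<rho> \<rho>'. (\<And>s. s \<le> r \<Longrightarrow> \<rho> s = \<rho>' s) \<Longrightarrow> Q r \<rho> \<Longrightarrow> Q r \<rho>'"
  shows "\<exists>\<rho>. \<forall>r. Q r \<rho>"
proof -
  define g where "g = rec_nat (\<lambda>_. undefined :: 'x) (\<lambda>r \<rho>. \<rho>(r := SOME y. Q r (\<rho>(r := y))))"
  have g: "g (Suc r) = (g r)(r := SOME y. Q r ((g r)(r := y)))" for r
    by (simp add: g_def)
  have Q: "Q s (g n)" if "s < n" for s n
    using that
  proof (induction n arbitrary: s)
    case (Suc n)
    show ?case
    proof (cases "s = n")
      case True
      have "Q n ((g n)(n := SOME y. Q n ((g n)(n := y))))"
        by (rule someI_ex[OF step]) (rule Suc.IH)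
      then show ?thesis by (simp only: True g)
    next
      case False
      then have "Q s (g n)" using Suc by simp
      then show ?thesis by (rule local[rotated]) (use False Suc.prems in \<open>auto simp: g\<close>)
    qed
  qed simp
  have stable: "g n s = g (Suc s) s" if "s < n" for s n
    using that by (induction n) (auto simp: g less_Suc_eq)
  define \<rho> where "\<rho> r = g (Suc r) r" for r
  have "Q r \<rho>" for r
  proof (rule local[OF _ Q[of r "Suc r"]])
    show "g (Suc r) s = \<rho> s" if "s \<le> r" for s
      unfolding \<rho>_def using that by (intro stable) simp
  qed simp
  then show ?thesis by blast
qed

section \<open>Formal functions and maps linear in the parameter\<close>

definition formal :: "'a set \<Rightarrow> 'a fps set" where
  "formal S = {f. \<forall>n. f $ n \<in> S}"

lemma formalD: "f \<in> formal S \<Longrightarrow> f $ n \<in> S"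
  by (simp add: formal_def)

lemma formal_functions_eq: "formal_functions M = formal (smooth_functions M)"
  by (simp add: formal_functions_def formal_def)

lemma formal_const: "function_algebra S \<Longrightarrow> f \<in> S \<Longrightarrow> fps_const f \<in> formal S"
  by (simp add: formal_def function_algebraD)

lemma formal_diff: "function_algebra S \<Longrightarrow> f \<in> formal S \<Longrightarrow> g \<in> formal S \<Longrightarrow> f - g \<in> formal S"
  by (simp add: formal_def function_algebraD)

lemma formal_shift: "f \<in> formal S \<Longrightarrow> fps_shift n f \<in> formal S"
  by (simp add: formal_def)

lemma formal_X: "function_algebra S \<Longrightarrow> f \<in> formal S \<Longrightarrow> fps_X * f \<in> formal S"
  by (simp add: formal_def function_algebraD)

lemma fps_decompose: "f = fps_const (f $ 0) + fps_X * fps_shift 1 f"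
  for f :: "('a \<Rightarrow> complex) fps"
  by (rule fps_ext) simp

text \<open>Write \<open>F\<close> as its constant term plus \<lambda> times a shifted series; the
  factor \<lambda> moves coefficients up by one. Finitely many such splittings reach any given
  coefficient, so additivity and compatibility with \<lambda> replace a continuity argument.\<close>

lemma formal_leading_coefficient:
  fixes \<Psi> :: "('a \<Rightarrow> complex) fps \<Rightarrow> ('b \<Rightarrow> complex) fps"
  assumes Q: "function_algebra Q"
    and add: "\<And>F G. F \<in> formal Q \<Longrightarrow> G \<in> formal Q \<Longrightarrow> \<Psi> (F + G) = \<Psi> F + \<Psi> G"
    and X: "\<And>F. F \<in> formal Q \<Longrightarrow> \<Psi> (fps_X * F) = fps_X * \<Psi> F"
    and zero: "\<And>q n. q \<in> Q \<Longrightarrow> n < r \<Longrightarrow> \<Psi> (fps_const q) $ n = 0"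
    and F: "F \<in> formal Q"
  shows "n < r \<Longrightarrow> \<Psi> F $ n = 0" "\<Psi> F $ r = \<Psi> (fps_const (F $ 0)) $ r"
proof -
  have eq: "\<Psi> F = \<Psi> (fps_const (F $ 0)) + fps_X * \<Psi> (fps_shift 1 F)" if F: "F \<in> formal Q" for F
  proof -
    have "\<Psi> F = \<Psi> (fps_const (F $ 0) + fps_X * fps_shift 1 F)"
      using fps_decompose[of F] by simp
    also have "\<dots> = \<Psi> (fps_const (F $ 0)) + \<Psi> (fps_X * fps_shift 1 F)"
      by (intro add formal_const formal_X Q formal_shift formalD F)
    also have "\<Psi> (fps_X * fps_shift 1 F) = fps_X * \<Psi> (fps_shift 1 F)"
      by (intro X formal_shift F)
    finally show ?thesis .
  qed
  have low: "\<Psi> F $ n = 0" if "n < r" "F \<in> formal Q" for n F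
    using that
  proof (induction n arbitrary: F)
    case 0
    then show ?case using eq[OF 0(2)] zero[OF formalD[OF 0(2), of 0], of 0] by simp
  next
    case (Suc n)
    then show ?case
      using eq[OF Suc.prems(2)] zero[OF formalD[OF Suc.prems(2), of 0] Suc.prems(1)]
        Suc.IH[OF _ formal_shift[OF Suc.prems(2)]] by simp
  qed
  show "n < r \<Longrightarrow> \<Psi> F $ n = 0" using low F by blast
  show "\<Psi> F $ r = \<Psi> (fps_const (F $ 0)) $ r"
    using eq[OF F] low[OF _ formal_shift[OF F]] by (cases r) simp_all
qed

lemma formal_biop_nth:
  "formal_biop B f a $ n = (\<Sum>r\<le>n. \<Sum>i\<le>n - r. B r (f $ i) (a $ (n - r - i)))"
  by (simp add: formal_biop_def)

lemma formal_op_nth: "formal_op T f $ n = (\<Sum>r\<le>n. T r (f $ (n - r)))"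
  by (simp add: formal_op_def)

locale bilinear_family =
  fixes S :: "('a \<Rightarrow> complex) set" and A :: "('b \<Rightarrow> complex) set" and S' :: "('c \<Rightarrow> complex) set"
    and B :: "nat \<Rightarrow> ('a \<Rightarrow> complex) \<Rightarrow> ('b \<Rightarrow> complex) \<Rightarrow> ('c \<Rightarrow> complex)"
  assumes S: "function_algebra S" and A: "function_algebra A" and S': "function_algebra S'"
    and left: "a \<in> A \<Longrightarrow> linear_op S S' (\<lambda>f. B r f a)"
    and right: "f \<in> S \<Longrightarrow> linear_op A S' (B r f)"
begin

lemma zero_simps: "a \<in> A \<Longrightarrow> B r 0 a = 0" "f \<in> S \<Longrightarrow> B r f 0 = 0"
  using linear_opD'(1)[OF left S] linear_opD'(1)[OF right A] by blast+

lemma biop_in: "f \<in> formal S \<Longrightarrow> a \<in> formal A \<Longrightarrow> formal_biop B f a \<in> formal S'"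
  unfolding formal_def
  by (auto simp: formal_biop_nth intro!: function_algebraD(8)[OF S'] linear_opD(1)[OF right])

lemma biop_add_left:
  assumes "f \<in> formal S" "g \<in> formal S" "a \<in> formal A"
  shows "formal_biop B (f + g) a = formal_biop B f a + formal_biop B g a"
  using linear_opD(2)[OF left] assms
  by (intro fps_ext) (simp add: formal_biop_nth formalD sum.distrib)

lemma biop_add_right:
  assumes "f \<in> formal S" "a \<in> formal A" "b \<in> formal A"
  shows "formal_biop B f (a + b) = formal_biop B f a + formal_biop B f b"
  using linear_opD(2)[OF right] assms
  by (intro fps_ext) (simp add: formal_biop_nth formalD sum.distrib)

lemma biop_diff_left:
  assumes "f \<in> formal S" "g \<in> formal S" "a \<in> formal A"
  shows "formal_biop B (f - g) a = formal_biop B f a - formal_biop B g a"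
  using biop_add_left[OF formal_diff[OF S assms(1,2)] assms(2,3)] by simp

lemma biop_X_left:
  assumes "f \<in> formal S" "a \<in> formal A"
  shows "formal_biop B (fps_X * f) a = fps_X * formal_biop B f a"
proof (rule fps_ext)
  fix n
  show "formal_biop B (fps_X * f) a $ n = (fps_X * formal_biop B f a) $ n"
  proof (cases n)
    case 0
    then show ?thesis using assms by (simp add: formal_biop_nth zero_simps formalD)
  next
    case (Suc m)
    have "(\<Sum>i\<le>Suc m - r. B r ((fps_X * f) $ i) (a $ (Suc m - r - i))) =
        (\<Sum>i\<le>m - r. B r (f $ i) (a $ (m - r - i)))" if "r \<le> m" for r
    proof -
      have "Suc m - r = Suc (m - r)" using that by simp
      then show ?thesis
        using assms by (simp add: sum.atMost_Suc_shift zero_simps formalD del: sum.atMost_Suc)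
    qed
    then show ?thesis using assms by (simp add: Suc formal_biop_nth zero_simps formalD)
  qed
qed

lemma biop_X_right:
  assumes "f \<in> formal S" "a \<in> formal A"
  shows "formal_biop B f (fps_X * a) = fps_X * formal_biop B f a"
proof (rule fps_ext)
  fix n
  show "formal_biop B f (fps_X * a) $ n = (fps_X * formal_biop B f a) $ n"
  proof (cases n)
    case 0
    then show ?thesis using assms by (simp add: formal_biop_nth zero_simps formalD)
  next
    case (Suc m)
    have "(\<Sum>i\<le>Suc m - r. B r (f $ i) ((fps_X * a) $ (Suc m - r - i))) =
        (\<Sum>i\<le>m - r. B r (f $ i) (a $ (m - r - i)))" if "r \<le> m" for r
    proof -
      have eq: "Suc m - r = Suc (m - r)" using that by simp
      have "(\<Sum>i\<le>m - r. B r (f $ i) ((fps_X * a) $ (Suc (m - r) - i))) =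
          (\<Sum>i\<le>m - r. B r (f $ i) (a $ (m - r - i)))"
        by (intro sum.cong refl) (simp add: Suc_diff_le)
      then show ?thesis
        unfolding eq using assms by (simp add: zero_simps formalD)
    qed
    then show ?thesis using assms by (simp add: Suc formal_biop_nth zero_simps formalD)
  qed
qed

lemma biop_const_right:
  assumes "f \<in> formal S" "a \<in> A"
  shows "formal_biop B f (fps_const a) $ n = (\<Sum>r\<le>n. B r (f $ (n - r)) a)"
  unfolding formal_biop_nth
proof (intro sum.cong refl)
  fix r
  have "(\<Sum>i\<le>n - r. B r (f $ i) (fps_const a $ (n - r - i))) =
    (\<Sum>i\<le>n - r. if i = n - r then B r (f $ (n - r)) a else 0)"
    using assms by (intro sum.cong refl) (auto simp: zero_simps formalD)
  then show "(\<Sum>i\<le>n - r. B r (f $ i) (fps_const a $ (n - r - i))) = B r (f $ (n - r)) a" by simp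
qed

lemma biop_const_left:
  assumes "f \<in> S" "a \<in> formal A"
  shows "formal_biop B (fps_const f) a $ n = (\<Sum>r\<le>n. B r f (a $ (n - r)))"
  unfolding formal_biop_nth
proof (intro sum.cong refl)
  fix r
  have "(\<Sum>i\<le>n - r. B r (fps_const f $ i) (a $ (n - r - i))) =
    (\<Sum>i\<le>n - r. if i = 0 then B r f (a $ (n - r)) else 0)"
    using assms by (intro sum.cong refl) (auto simp: zero_simps formalD)
  then show "(\<Sum>i\<le>n - r. B r (fps_const f $ i) (a $ (n - r - i))) = B r f (a $ (n - r))" by simp
qed

lemma biop_const_const:
  assumes "f \<in> S" "a \<in> A"
  shows "formal_biop B (fps_const f) (fps_const a) $ n = B n f a"
proof -
  have "(\<Sum>r\<le>n. B r f (fps_const a $ (n - r))) = (\<Sum>r\<le>n. if r = n then B n f a else 0)"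
    using assms by (intro sum.cong refl) (auto simp: zero_simps)
  then show ?thesis
    using biop_const_left[OF assms(1) formal_const[OF A assms(2)]] by simp
qed

lemma biop_leading:
  assumes "f \<in> formal S" "a \<in> formal A" "\<And>m. m < n \<Longrightarrow> f $ m = 0"
  shows "formal_biop B f a $ n = B 0 (f $ n) (a $ 0)"
proof -
  have "(\<Sum>i\<le>n - r. B r (f $ i) (a $ (n - r - i))) = (if r = 0 then B 0 (f $ n) (a $ 0) else 0)"
    if "r \<le> n" for r
  proof (cases "r = 0")
    case True
    have "(\<Sum>i\<le>n. B 0 (f $ i) (a $ (n - i))) = (\<Sum>i\<le>n. if i = n then B 0 (f $ n) (a $ 0) else 0)"
      using assms by (intro sum.cong refl) (auto simp: zero_simps formalD)
    then show ?thesis using True by simp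
  next
    case False
    then show ?thesis using assms that by (intro sum.neutral[THEN trans]) (auto simp: zero_simps formalD)
  qed
  then show ?thesis by (simp add: formal_biop_nth)
qed

lemma biop_scalar:
  assumes f: "f \<in> formal S" and a: "a \<in> formal A"
  shows "formal_biop B (formal_scalar c * f) a = formal_scalar c * formal_biop B f a"
    and "formal_biop B f (formal_scalar c * a) = formal_scalar c * formal_biop B f a"
proof -
  have scalar_in: "formal_scalar c * g \<in> formal Q" if "function_algebra Q" "g \<in> formal Q"
    for c and Q :: "('z \<Rightarrow> complex) set" and g
    using that unfolding formal_def
    by (auto simp: fps_mult_nth formal_scalar_def intro!: function_algebraD)
  \<comment> \<open>This reduces a scalar series to a constant and a multiple of \<lambda>. The
    inductions on the coefficient index below keep \<open>c\<close> arbitrary because its tail takes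
    its place.\<close>
  have scalar_eq: "formal_scalar c * g = fps_const (\<lambda>_. c $ 0) * g + fps_X * (formal_scalar (fps_shift 1 c) * g)"
    for c and g :: "('z \<Rightarrow> complex) fps"
  proof -
    have "formal_scalar c = fps_const (\<lambda>_. c $ 0) + fps_X * (formal_scalar (fps_shift 1 c) :: ('z \<Rightarrow> complex) fps)"
      by (rule fps_ext) (simp add: formal_scalar_def)
    then show ?thesis by (simp add: algebra_simps)
  qed
  have const_in: "fps_const (\<lambda>_. k) * g \<in> formal Q" if "function_algebra Q" "g \<in> formal Q"
    for k and Q :: "('z \<Rightarrow> complex) set" and g
    using that unfolding formal_def by (auto intro!: function_algebraD)
  have const_left: "formal_biop B (fps_const (\<lambda>_. k) * f) a = fps_const (\<lambda>_. k) * formal_biop B f a" for k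
    using linear_opD(3)[OF left] f a
    by (intro fps_ext) (simp add: formal_biop_nth formalD sum_distrib_left)
  have const_right: "formal_biop B f (fps_const (\<lambda>_. k) * a) = fps_const (\<lambda>_. k) * formal_biop B f a" for k
    using linear_opD(3)[OF right] f a
    by (intro fps_ext) (simp add: formal_biop_nth formalD sum_distrib_left)
  note A_in = scalar_in[OF A a] scalar_in[OF S f] const_in[OF A a] const_in[OF S f]
  have "formal_biop B (formal_scalar c * f) a $ n = (formal_scalar c * formal_biop B f a) $ n" for n c
  proof (induction n arbitrary: c)
    case 0
    show ?case
      unfolding scalar_eq[of c f] scalar_eq[of c "formal_biop B f a"]
      by (simp add: biop_add_left[OF A_in(4) formal_X[OF S A_in(2)] a] biop_X_left[OF A_in(2) a] const_left)
  next
    case (Suc n)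
    show ?case
      unfolding scalar_eq[of c f] scalar_eq[of c "formal_biop B f a"]
      by (simp add: biop_add_left[OF A_in(4) formal_X[OF S A_in(2)] a] biop_X_left[OF A_in(2) a] const_left
          Suc.IH)
  qed
  then show "formal_biop B (formal_scalar c * f) a = formal_scalar c * formal_biop B f a"
    by (rule fps_ext)
  have "formal_biop B f (formal_scalar c * a) $ n = (formal_scalar c * formal_biop B f a) $ n" for n c
  proof (induction n arbitrary: c)
    case 0
    show ?case
      unfolding scalar_eq[of c a] scalar_eq[of c "formal_biop B f a"]
      by (simp add: biop_add_right[OF f A_in(3) formal_X[OF A A_in(1)]] biop_X_right[OF f A_in(1)] const_right)
  next
    case (Suc n)
    show ?case
      unfolding scalar_eq[of c a] scalar_eq[of c "formal_biop B f a"]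
      by (simp add: biop_add_right[OF f A_in(3) formal_X[OF A A_in(1)]] biop_X_right[OF f A_in(1)] const_right
          Suc.IH)
  qed
  then show "formal_biop B f (formal_scalar c * a) = formal_scalar c * formal_biop B f a"
    by (rule fps_ext)
qed

end

locale linear_family =
  fixes S :: "('a \<Rightarrow> complex) set" and T :: "nat \<Rightarrow> ('a \<Rightarrow> complex) \<Rightarrow> ('a \<Rightarrow> complex)"
  assumes S: "function_algebra S" and T: "linear_op S S (T r)"
begin

lemma T_zero: "T r 0 = 0"
  by (rule linear_opD'(1)[OF T S])

lemma op_in: "f \<in> formal S \<Longrightarrow> formal_op T f \<in> formal S"
  unfolding formal_def
  by (auto simp: formal_op_nth intro!: function_algebraD(8)[OF S] linear_opD(1)[OF T])

lemma op_add:
  assumes "f \<in> formal S" "g \<in> formal S"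
  shows "formal_op T (f + g) = formal_op T f + formal_op T g"
  using linear_opD(2)[OF T] assms
  by (intro fps_ext) (simp add: formal_op_nth formalD sum.distrib)

lemma op_X:
  assumes "f \<in> formal S"
  shows "formal_op T (fps_X * f) = fps_X * formal_op T f"
proof (rule fps_ext)
  fix n
  show "formal_op T (fps_X * f) $ n = (fps_X * formal_op T f) $ n"
  proof (cases n)
    case (Suc m)
    have "(\<Sum>r\<le>m. T r ((fps_X * f) $ (Suc m - r))) = (\<Sum>r\<le>m. T r (f $ (m - r)))"
      by (intro sum.cong refl) (simp add: Suc_diff_le)
    then show ?thesis by (simp add: Suc formal_op_nth T_zero)
  qed (simp add: formal_op_nth T_zero)
qed

lemma op_const: "formal_op T (fps_const f) $ n = T n f"
proof -
  have "(\<Sum>r\<le>n. T r (fps_const f $ (n - r))) = (\<Sum>r\<le>n. if r = n then T n f else 0)"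
    by (intro sum.cong refl) (auto simp: T_zero)
  then show ?thesis by (simp add: formal_op_nth)
qed

end

text \<open>The one-variable result is applied in \<open>F\<close> with \<open>G\<close> constant,
  and what it yields is the hypothesis for applying it in \<open>G\<close>.\<close>

lemma formal_leading_coefficient2:
  fixes \<Psi> :: "('a \<Rightarrow> complex) fps \<Rightarrow> ('b \<Rightarrow> complex) fps \<Rightarrow> ('c \<Rightarrow> complex) fps"
  assumes Q: "function_algebra Q" "function_algebra R"
    and add_left: "\<And>F F' G. F \<in> formal Q \<Longrightarrow> F' \<in> formal Q \<Longrightarrow> G \<in> formal R \<Longrightarrow> \<Psi> (F + F') G = \<Psi> F G + \<Psi> F' G"
    and X_left: "\<And>F G. F \<in> formal Q \<Longrightarrow> G \<in> formal R \<Longrightarrow> \<Psi> (fps_X * F) G = fps_X * \<Psi> F G"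
    and add_right: "\<And>F G G'. F \<in> formal Q \<Longrightarrow> G \<in> formal R \<Longrightarrow> G' \<in> formal R \<Longrightarrow> \<Psi> F (G + G') = \<Psi> F G + \<Psi> F G'"
    and X_right: "\<And>F G. F \<in> formal Q \<Longrightarrow> G \<in> formal R \<Longrightarrow> \<Psi> F (fps_X * G) = fps_X * \<Psi> F G"
    and zero: "\<And>f g n. f \<in> Q \<Longrightarrow> g \<in> R \<Longrightarrow> n < r \<Longrightarrow> \<Psi> (fps_const f) (fps_const g) $ n = 0"
    and F: "F \<in> formal Q" and G: "G \<in> formal R"
  shows "n < r \<Longrightarrow> \<Psi> F G $ n = 0" "\<Psi> F G $ r = \<Psi> (fps_const (F $ 0)) (fps_const (G $ 0)) $ r"
proof -
  have 1: "n < r \<Longrightarrow> \<Psi> F (fps_const g) $ n = 0"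
    "\<Psi> F (fps_const g) $ r = \<Psi> (fps_const (F $ 0)) (fps_const g) $ r" if g: "g \<in> R" for g n
  proof -
    note c = formal_const[OF Q(2) g]
    note 2 = formal_leading_coefficient[where \<Psi> = "\<lambda>F. \<Psi> F (fps_const g)",
        OF Q(1) add_left[OF _ _ c] X_left[OF _ c] zero[OF _ g] F]
    show "n < r \<Longrightarrow> \<Psi> F (fps_const g) $ n = 0"
      "\<Psi> F (fps_const g) $ r = \<Psi> (fps_const (F $ 0)) (fps_const g) $ r"
      using 2 by blast+
  qed
  note 3 = formal_leading_coefficient[where \<Psi> = "\<Psi> F", OF Q(2) add_right[OF F] X_right[OF F] 1(1) G]
  show "n < r \<Longrightarrow> \<Psi> F G $ n = 0" using 3(1) by blast
  show "\<Psi> F G $ r = \<Psi> (fps_const (F $ 0)) (fps_const (G $ 0)) $ r"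
    using 3(2) 1(2)[OF formalD[OF G]] by simp
qed

lemma formal_leading_coefficient3:
  fixes \<Psi> :: "('a \<Rightarrow> complex) fps \<Rightarrow> ('b \<Rightarrow> complex) fps \<Rightarrow> ('d \<Rightarrow> complex) fps \<Rightarrow> ('c \<Rightarrow> complex) fps"
  assumes Q: "function_algebra Q" "function_algebra R" "function_algebra R'"
    and add1: "\<And>F F' G H. F \<in> formal Q \<Longrightarrow> F' \<in> formal Q \<Longrightarrow> G \<in> formal R \<Longrightarrow> H \<in> formal R' \<Longrightarrow>
      \<Psi> (F + F') G H = \<Psi> F G H + \<Psi> F' G H"
    and X1: "\<And>F G H. F \<in> formal Q \<Longrightarrow> G \<in> formal R \<Longrightarrow> H \<in> formal R' \<Longrightarrow> \<Psi> (fps_X * F) G H = fps_X * \<Psi> F G H"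
    and add2: "\<And>F G G' H. F \<in> formal Q \<Longrightarrow> G \<in> formal R \<Longrightarrow> G' \<in> formal R \<Longrightarrow> H \<in> formal R' \<Longrightarrow>
      \<Psi> F (G + G') H = \<Psi> F G H + \<Psi> F G' H"
    and X2: "\<And>F G H. F \<in> formal Q \<Longrightarrow> G \<in> formal R \<Longrightarrow> H \<in> formal R' \<Longrightarrow> \<Psi> F (fps_X * G) H = fps_X * \<Psi> F G H"
    and add3: "\<And>F G H H'. F \<in> formal Q \<Longrightarrow> G \<in> formal R \<Longrightarrow> H \<in> formal R' \<Longrightarrow> H' \<in> formal R' \<Longrightarrow>
      \<Psi> F G (H + H') = \<Psi> F G H + \<Psi> F G H'"
    and X3: "\<And>F G H. F \<in> formal Q \<Longrightarrow> G \<in> formal R \<Longrightarrow> H \<in> formal R' \<Longrightarrow> \<Psi> F G (fps_X * H) = fps_X * \<Psi> F G H"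
    and zero: "\<And>f g h n. f \<in> Q \<Longrightarrow> g \<in> R \<Longrightarrow> h \<in> R' \<Longrightarrow> n < r \<Longrightarrow>
      \<Psi> (fps_const f) (fps_const g) (fps_const h) $ n = 0"
    and F: "F \<in> formal Q" and G: "G \<in> formal R" and H: "H \<in> formal R'"
  shows "n < r \<Longrightarrow> \<Psi> F G H $ n = 0"
    "\<Psi> F G H $ r = \<Psi> (fps_const (F $ 0)) (fps_const (G $ 0)) (fps_const (H $ 0)) $ r"
proof -
  have 1: "n < r \<Longrightarrow> \<Psi> F G (fps_const h) $ n = 0"
    "\<Psi> F G (fps_const h) $ r = \<Psi> (fps_const (F $ 0)) (fps_const (G $ 0)) (fps_const h) $ r"
    if h: "h \<in> R'" for h n
  proof -
    note c = formal_const[OF Q(3) h]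
    note 2 = formal_leading_coefficient2[where \<Psi> = "\<lambda>F G. \<Psi> F G (fps_const h)",
        OF Q(1,2) add1[OF _ _ _ c] X1[OF _ _ c] add2[OF _ _ _ c] X2[OF _ _ c] zero[OF _ _ h] F G]
    show "n < r \<Longrightarrow> \<Psi> F G (fps_const h) $ n = 0"
      "\<Psi> F G (fps_const h) $ r = \<Psi> (fps_const (F $ 0)) (fps_const (G $ 0)) (fps_const h) $ r"
      using 2 by blast+
  qed
  note 3 = formal_leading_coefficient[where \<Psi> = "\<Psi> F G", OF Q(3) add3[OF F G] X3[OF F G] 1(1) H]
  show "n < r \<Longrightarrow> \<Psi> F G H $ n = 0" using 3(1) by blast
  show "\<Psi> F G H $ r = \<Psi> (fps_const (F $ 0)) (fps_const (G $ 0)) (fps_const (H $ 0)) $ r"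
    using 3(2) 1(2)[OF formalD[OF H]] by simp
qed

section \<open>The obstruction to a module structure\<close>

definition associator ::
  "(nat \<Rightarrow> ('p, 'm) bioperator) \<Rightarrow>
   (nat \<Rightarrow> ('m, 'm) bioperator) \<Rightarrow>
   ('p \<Rightarrow> complex) fps \<Rightarrow> ('m \<Rightarrow> complex) fps \<Rightarrow> ('m \<Rightarrow> complex) fps \<Rightarrow> ('p \<Rightarrow> complex) fps" where
  "associator \<rho> C F a b =
     formal_biop \<rho> (formal_biop \<rho> F a) b - formal_biop \<rho> F (formal_biop C a b)"

text \<open>The order \<open>n\<close> coefficient of the associator on constant series. For
  \<open>n > 0\<close> and given \<open>\<rho> 0\<close> and \<open>C 0\<close>, the operator
  \<open>\<rho> n\<close> enters it exactly through its Hochschild coboundary.\<close>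

definition associator_coeff ::
  "(nat \<Rightarrow> ('p, 'm) bioperator) \<Rightarrow>
   (nat \<Rightarrow> ('m, 'm) bioperator) \<Rightarrow> nat \<Rightarrow>
   ('p \<Rightarrow> complex) \<Rightarrow> ('m \<Rightarrow> complex) \<Rightarrow> ('m \<Rightarrow> complex) \<Rightarrow> ('p \<Rightarrow> complex)" where
  "associator_coeff \<rho> C n f a b =
     (\<Sum>s\<le>n. \<rho> s (\<rho> (n - s) f a) b) - (\<Sum>s\<le>n. \<rho> s f (C (n - s) a b))"

text \<open>Vanishing below order \<open>r\<close> makes the coefficient at \<open>r\<close> blind
  to the higher coefficients of the arguments. In this way identities between formal series become
  cocycle identities between functions.\<close>

lemma associator_leading:
  assumes "bilinear_family S A S \<rho>" "bilinear_family A A A C"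
    and zero: "\<And>f a b n. f \<in> S \<Longrightarrow> a \<in> A \<Longrightarrow> b \<in> A \<Longrightarrow> n < r \<Longrightarrow> associator_coeff \<rho> C n f a b = 0"
    and F: "F \<in> formal S" and a: "a \<in> formal A" and b: "b \<in> formal A"
  shows "n < r \<Longrightarrow> associator \<rho> C F a b $ n = 0"
    "associator \<rho> C F a b $ r = associator_coeff \<rho> C r (F $ 0) (a $ 0) (b $ 0)"
proof -
  interpret \<rho>: bilinear_family S A S \<rho> by fact
  interpret C: bilinear_family A A A C by fact
  have const: "associator \<rho> C (fps_const f) (fps_const a) (fps_const b) $ n = associator_coeff \<rho> C n f a b"
    if "f \<in> S" "a \<in> A" "b \<in> A" for f a b n
  proof -
    note c = formal_const[OF \<rho>.S that(1)] formal_const[OF \<rho>.A that(2)] formal_const[OF \<rho>.A that(3)]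
    show ?thesis
      unfolding associator_def associator_coeff_def fps_sub_nth
        \<rho>.biop_const_right[OF \<rho>.biop_in[OF c(1,2)] that(3)]
        \<rho>.biop_const_left[OF that(1) C.biop_in[OF c(2,3)]]
        \<rho>.biop_const_const[OF that(1,2)] C.biop_const_const[OF that(2,3)] ..
  qed
  note lin = associator_def \<rho>.biop_in C.biop_in \<rho>.biop_add_left \<rho>.biop_add_right \<rho>.biop_X_left
    \<rho>.biop_X_right C.biop_add_left C.biop_add_right C.biop_X_left C.biop_X_right right_diff_distrib
  note leading = formal_leading_coefficient3[where \<Psi> = "associator \<rho> C", OF \<rho>.S \<rho>.A \<rho>.A _ _ _ _ _ _ _ F a b]
  show "associator \<rho> C F a b $ n = 0" if "n < r"
    by (rule leading(1)[OF _ _ _ _ _ _ _ that]) (simp_all only: const zero, simp_all add: lin)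
  have "associator \<rho> C F a b $ r =
      associator \<rho> C (fps_const (F $ 0)) (fps_const (a $ 0)) (fps_const (b $ 0)) $ r"
    by (rule leading(2)) (simp_all only: const zero, simp_all add: lin)
  then show "associator \<rho> C F a b $ r = associator_coeff \<rho> C r (F $ 0) (a $ 0) (b $ 0)"
    by (simp only: const formalD F a b)
qed

section \<open>Orders of compositions\<close>

context pulled_back_algebra
begin

lemma bidiff_postcompose:
  assumes "bidiff S A p k l B" "linear_op S S D" "diff_op_along S id j D"
  shows "bidiff S A p (j + k) (j + l) (\<lambda>f a. D (B f a))"
proof (rule bidiffI)
  fix a assume a: "a \<in> A"
  show "linear_op S S (\<lambda>f. D (B f a))"
    by (rule linear_op_compose[OF bidiffD(1)[OF assms(1) a] assms(2)])
  show "diff_op_along S id (j + k) (\<lambda>f. D (B f a))"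
    using diff_op_along_compose[OF S S _ bidiffD(3)[OF assms(1) a] assms(3)]
      linear_opD(2)[OF assms(2)] bidiff_simps(1)[OF assms(1) _ a] by simp
next
  fix f assume f: "f \<in> S"
  show "linear_op A S (\<lambda>a. D (B f a))"
    by (rule linear_op_compose[OF bidiffD(2)[OF assms(1) f] assms(2)])
  show "diff_op_along A p (j + l) (\<lambda>a. D (B f a))"
    using diff_op_along_compose[OF A S pull bidiffD(4)[OF assms(1) f] assms(3)]
      linear_opD(2)[OF assms(2)] bidiff_simps(1)[OF assms(1) f] by simp
qed

lemma bidiff_precompose_snd:
  assumes "bidiff S A p k l B" "linear_op A A E" "diff_op_along A id j E"
  shows "bidiff S A p k (l + j) (\<lambda>f a. B f (E a))"
proof (rule bidiffI)
  fix f assume f: "f \<in> S"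
  show "linear_op A S (\<lambda>a. B f (E a))"
    by (rule linear_op_compose[OF assms(2) bidiffD(2)[OF assms(1) f]])
  show "diff_op_along A p (l + j) (\<lambda>a. B f (E a))"
    using diff_op_along_compose[OF A A _ assms(3) bidiffD(4)[OF assms(1) f]]
      linear_opD(1)[OF assms(2)] bidiff_simps(3)[OF assms(1) f] by simp
next
  fix a assume "a \<in> A"
  then have "E a \<in> A" by (rule linear_opD(1)[OF assms(2)])
  then show "linear_op S S (\<lambda>f. B f (E a))" "diff_op_along S id k (\<lambda>f. B f (E a))"
    by (simp_all add: bidiffD[OF assms(1)])
qed

lemma bidiff_pullback_mult: "bidiff S A p 1 1 (\<lambda>f a. f * (a \<circ> p))"
proof (rule bidiffI)
  fix a assume a: "a \<in> A"
  show "linear_op S S (\<lambda>f. f * (a \<circ> p))"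
    using linear_op_mult[OF S pull[OF a]] by (simp add: mult.commute)
  show "diff_op_along S id 1 (\<lambda>f. f * (a \<circ> p))" by (simp add: mult.assoc)
next
  fix f assume f: "f \<in> S"
  show "linear_op A S (\<lambda>a. f * (a \<circ> p))"
    by (rule linear_opI) (simp_all add: Sc f pull algebra_simps)
  show "diff_op_along A p 1 (\<lambda>a. f * (a \<circ> p))" by (simp add: algebra_simps)
qed

lemma bidiff_family_bilinear:
  "(\<And>r. \<exists>k l. bidiff S A p k l (\<rho> r)) \<Longrightarrow> bilinear_family S A S \<rho>"
  using bidiffD(1,2) by unfold_locales (metis S A)+

lemma bidiff_uniform_bound:
  fixes r :: nat
  assumes "\<And>s. s \<le> r \<Longrightarrow> \<exists>k l. bidiff S A p k l (\<rho> s)"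
  obtains K where "\<And>s L. s \<le> r \<Longrightarrow> K \<le> L \<Longrightarrow> bidiff S A p L L (\<rho> s)"
proof -
  from assms obtain k l where kl: "\<And>s. s \<le> r \<Longrightarrow> bidiff S A p (k s) (l s) (\<rho> s)" by metis
  define K where "K = (\<Sum>s\<le>r. k s + l s)"
  have "bidiff S A p L L (\<rho> s)" if "s \<le> r" "K \<le> L" for s L
  proof (rule bidiff_mono[OF kl[OF that(1)]])
    have "k s + l s \<le> K" unfolding K_def using that(1) by (intro member_le_sum[where f = "\<lambda>s. k s + l s"]) auto
    then show "k s \<le> L" "l s \<le> L" using that(2) by auto
  qed
  then show ?thesis by (rule that)
qed

lemma base_algebra: "pulled_back_algebra A A id"
  using A separate_A by unfold_locales simp_all

end

section \<open>Existence and uniqueness by induction on the order in the parameter\<close>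

locale star_submersion = framed_submersion S A p W d x X \<eta>
  for S :: "('p::topological_space \<Rightarrow> complex) set" and A :: "('m::topological_space \<Rightarrow> complex) set"
    and p W d x X \<eta> +
  fixes C :: "nat \<Rightarrow> ('m, 'm) bioperator"
  assumes C_bidiff: "\<exists>k l. bidiff A A id k l (C r)"
    and C_zero: "a \<in> A \<Longrightarrow> b \<in> A \<Longrightarrow> C 0 a b = a * b"
    and C_assoc: "F \<in> formal A \<Longrightarrow> G \<in> formal A \<Longrightarrow> H \<in> formal A \<Longrightarrow>
      formal_biop C (formal_biop C F G) H = formal_biop C F (formal_biop C G H)"
    and C_one: "r > 0 \<Longrightarrow> a \<in> A \<Longrightarrow> C r 1 a = 0" "r > 0 \<Longrightarrow> a \<in> A \<Longrightarrow> C r a 1 = 0"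
begin

sublocale base: pulled_back_algebra A A id
  by (rule base_algebra)

sublocale C: bilinear_family A A A C
  using base.bidiff_family_bilinear[OF C_bidiff] .

text \<open>The last two conditions strengthen the induction. Compatibility with pullbacks, together
  with the unit of the star product, gives \<open>\<rho> s 1 a = 0\<close> for \<open>s > 0\<close>;
  the condition on \<open>\<rho> r f 1\<close> makes the unit act as the identity.\<close>

definition quantization_up_to :: "nat \<Rightarrow> (nat \<Rightarrow> ('p, 'm) bioperator) \<Rightarrow> bool" where
  "quantization_up_to r \<rho> \<longleftrightarrow> (\<exists>k l. bidiff S A p k l (\<rho> r)) \<and>
     (r = 0 \<longrightarrow> (\<forall>f\<in>S. \<forall>a\<in>A. \<rho> 0 f a = f * (a \<circ> p))) \<and>
     (\<forall>f\<in>S. \<forall>a\<in>A. \<forall>b\<in>A. associator_coeff \<rho> C r f a b = 0) \<and>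
     (\<forall>a\<in>A. \<forall>b\<in>A. \<rho> r (a \<circ> p) b = C r a b \<circ> p) \<and>
     (r > 0 \<longrightarrow> (\<forall>f\<in>S. \<rho> r f 1 = 0))"

lemma quantization_up_to_local:
  assumes "\<And>s. s \<le> r \<Longrightarrow> \<rho> s = \<rho>' s" "quantization_up_to r \<rho>"
  shows "quantization_up_to r \<rho>'"
proof -
  have "associator_coeff \<rho> C r f a b = associator_coeff \<rho>' C r f a b" for f a b
    unfolding associator_coeff_def using assms(1) by (intro arg_cong2[of _ _ _ _ "(-)"] sum.cong) auto
  then show ?thesis using assms unfolding quantization_up_to_def by (simp add: assms(1)[symmetric])
qed

text \<open>Expand the four associators for formal series: all terms cancel in pairs, two of them by
  associativity of the star product. The coefficient at order \<open>r\<close> of this identity is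
  the cocycle condition.\<close>

lemma associator_coeff_cocycle:
  assumes \<rho>: "bilinear_family S A S \<rho>" and \<rho>0: "\<And>f a. f \<in> S \<Longrightarrow> a \<in> A \<Longrightarrow> \<rho> 0 f a = f * (a \<circ> p)"
    and zero: "\<And>f a b n. f \<in> S \<Longrightarrow> a \<in> A \<Longrightarrow> b \<in> A \<Longrightarrow> n < r \<Longrightarrow> associator_coeff \<rho> C n f a b = 0"
    and f: "f \<in> S" and a: "a \<in> A" and b: "b \<in> A" and c: "c \<in> A"
  shows "associator_coeff \<rho> C r ((a \<circ> p) * f) b c - associator_coeff \<rho> C r f (a * b) c
    + associator_coeff \<rho> C r f a (b * c) - associator_coeff \<rho> C r f a b * (c \<circ> p) = 0"
proof -
  interpret \<rho>: bilinear_family S A S \<rho> by fact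
  have lead: "n < r \<Longrightarrow> associator \<rho> C F a b $ n = 0"
    "associator \<rho> C F a b $ r = associator_coeff \<rho> C r (F $ 0) (a $ 0) (b $ 0)"
    if "F \<in> formal S" "a \<in> formal A" "b \<in> formal A" for F a b n
    by (rule associator_leading[OF \<rho> C.bilinear_family_axioms]; simp add: zero that)+
  define F G H K where "F = fps_const f" and "G = fps_const a" and "H = fps_const b" and "K = fps_const c"
  have F: "F \<in> formal S" and G: "G \<in> formal A" and H: "H \<in> formal A" and K: "K \<in> formal A"
    unfolding F_def G_def H_def K_def by (intro formal_const S A f a b c)+
  let ?m = "formal_biop \<rho>" and ?s = "formal_biop C"
  have "associator \<rho> C (?m F G) H K - associator \<rho> C F (?s G H) K + associator \<rho> C F G (?s H K)
      - ?m (associator \<rho> C F G H) K = 0"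
    unfolding associator_def
    by (simp add: \<rho>.biop_diff_left \<rho>.biop_in C.biop_in F G H K C_assoc)
  then have "(associator \<rho> C (?m F G) H K - associator \<rho> C F (?s G H) K + associator \<rho> C F G (?s H K)
      - ?m (associator \<rho> C F G H) K) $ r = 0" by simp
  moreover have "associator \<rho> C (?m F G) H K $ r = associator_coeff \<rho> C r ((a \<circ> p) * f) b c"
    using lead(2)[OF \<rho>.biop_in[OF F G] H K] \<rho>.biop_const_const[OF f a, of 0]
    by (simp add: F_def G_def H_def K_def \<rho>0 f a mult.commute)
  moreover have "associator \<rho> C F (?s G H) K $ r = associator_coeff \<rho> C r f (a * b) c"
    using lead(2)[OF F C.biop_in[OF G H] K] C.biop_const_const[OF a b, of 0]
    by (simp add: F_def G_def H_def K_def C_zero a b)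
  moreover have "associator \<rho> C F G (?s H K) $ r = associator_coeff \<rho> C r f a (b * c)"
    using lead(2)[OF F G C.biop_in[OF H K]] C.biop_const_const[OF b c, of 0]
    by (simp add: F_def G_def H_def K_def C_zero b c)
  moreover have "?m (associator \<rho> C F G H) K $ r = associator_coeff \<rho> C r f a b * (c \<circ> p)"
  proof -
    have in_S: "associator \<rho> C F G H \<in> formal S"
      unfolding associator_def by (intro formal_diff S \<rho>.biop_in C.biop_in F G H)
    \<comment> \<open>The inner associator has no coefficients below \<open>r\<close>, so at order
      \<open>r\<close> only \<open>\<rho> 0\<close> can act on it.\<close>
    have "?m (associator \<rho> C F G H) K $ r = \<rho> 0 (associator \<rho> C F G H $ r) (K $ 0)"
      by (rule \<rho>.biop_leading[OF in_S K]) (rule lead(1)[OF F G H])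
    also have "associator \<rho> C F G H $ r = associator_coeff \<rho> C r f a b"
      using lead(2)[OF F G H] by (simp add: F_def G_def H_def)
    finally show ?thesis
      using formalD[OF in_S, of r] lead(2)[OF F G H] c
      by (simp add: F_def G_def H_def K_def \<rho>0)
  qed
  ultimately show ?thesis by (simp add: algebra_simps)
qed

text \<open>Only finitely many operators occur up to order \<open>r\<close>, so their bounds can be
  made uniform. Each composite of two of them is then bounded by twice the common bound.\<close>

lemma associator_coeff_operator:
  assumes "\<And>s. s \<le> r \<Longrightarrow> \<exists>k l. bidiff S A p k l (\<rho> s)"
  obtains K where "\<And>b. b \<in> A \<Longrightarrow> bidiff S A p K K (\<lambda>f a. associator_coeff \<rho> C r f a b)"
    "\<And>f a. f \<in> S \<Longrightarrow> a \<in> A \<Longrightarrow>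
      linear_op A S (associator_coeff \<rho> C r f a) \<and> diff_op_along A p K (associator_coeff \<rho> C r f a)"
proof -
  obtain L1 where L1: "\<And>s L. s \<le> r \<Longrightarrow> L1 \<le> L \<Longrightarrow> bidiff S A p L L (\<rho> s)"
    using bidiff_uniform_bound[of r \<rho>] assms by blast
  obtain L2 where L2: "\<And>s L. s \<le> r \<Longrightarrow> L2 \<le> L \<Longrightarrow> bidiff A A id L L (C s)"
    using base.bidiff_uniform_bound[of r C] C_bidiff by blast
  define L where "L = max L1 L2"
  have \<rho>: "bidiff S A p L L (\<rho> s)" and C: "bidiff A A id L L (C s)" if "s \<le> r" for s
    using L1[OF that] L2[OF that] by (auto simp: L_def)
  have diff_le: "r - s \<le> r" for s by simp
  have 1: "bidiff S A p (L + L) (L + L) (\<lambda>f a. associator_coeff \<rho> C r f a b)" if b: "b \<in> A" for b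
    unfolding associator_coeff_def
  proof (intro bidiff_diff bidiff_sum)
    fix s assume "s \<in> {..r}"
    then have s: "s \<le> r" by simp
    show "bidiff S A p (L + L) (L + L) (\<lambda>f a. \<rho> s (\<rho> (r - s) f a) b)"
      by (rule bidiff_postcompose[OF \<rho>[OF diff_le] bidiffD(1,3)[OF \<rho>[OF s] b]])
    show "bidiff S A p (L + L) (L + L) (\<lambda>f a. \<rho> s f (C (r - s) a b))"
      by (rule bidiff_mono[OF bidiff_precompose_snd[OF \<rho>[OF s] base.bidiffD(1,3)[OF C[OF diff_le] b]]])
        auto
  qed
  have 2: "linear_op A S (associator_coeff \<rho> C r f a) \<and> diff_op_along A p (L + L) (associator_coeff \<rho> C r f a)"
    if f: "f \<in> S" and a: "a \<in> A" for f a
  proof -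
    have t1: "linear_op A S (\<rho> s (\<rho> (r - s) f a))" "diff_op_along A p (L + L) (\<rho> s (\<rho> (r - s) f a))"
      if s: "s \<le> r" for s
    proof -
      note g = bidiff_simps(1)[OF \<rho>[OF diff_le] f a]
      show "linear_op A S (\<rho> s (\<rho> (r - s) f a))" by (rule bidiffD(2)[OF \<rho>[OF s] g])
      show "diff_op_along A p (L + L) (\<rho> s (\<rho> (r - s) f a))"
        by (rule diff_op_along_mono[OF A bidiffD(4)[OF \<rho>[OF s] g]]) simp
    qed
    have t2: "linear_op A S (\<lambda>b. \<rho> s f (C (r - s) a b))" "diff_op_along A p (L + L) (\<lambda>b. \<rho> s f (C (r - s) a b))"
      if s: "s \<le> r" for s
      using bidiffD(2,4)[OF bidiff_precompose_snd[OF \<rho>[OF s] base.bidiffD(2,4)[OF C[OF diff_le] a]] f]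
      by blast+
    have "linear_op A S (\<lambda>b. \<Sum>s\<le>r. \<rho> s (\<rho> (r - s) f a) b)" "linear_op A S (\<lambda>b. \<Sum>s\<le>r. \<rho> s f (C (r - s) a b))"
      by (rule linear_op_sum[OF _ S]; simp add: t1 t2)+
    moreover have "diff_op_along A p (L + L) (\<lambda>b. \<Sum>s\<le>r. \<rho> s (\<rho> (r - s) f a) b)"
      "diff_op_along A p (L + L) (\<lambda>b. \<Sum>s\<le>r. \<rho> s f (C (r - s) a b))"
      by (rule diff_op_along_sum[OF A]; simp add: t1 t2)+
    ultimately show ?thesis
      unfolding associator_coeff_def[abs_def]
      by (simp only: linear_op_diff[OF _ _ S] diff_op_along_diff[OF A])
  qed
  show ?thesis by (rule that[OF 1 2])
qed

lemma quantization_step: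
  assumes prev: "\<And>s. s < r \<Longrightarrow> quantization_up_to s \<rho>"
  shows "\<exists>y. quantization_up_to r (\<rho>(r := y))"
proof (cases "r = 0")
  case True
  have "quantization_up_to 0 (\<rho>(0 := \<lambda>f a. f * (a \<circ> p)))"
    unfolding quantization_up_to_def
    using bidiff_pullback_mult
    by (auto simp: associator_coeff_def C_zero mult.assoc)
  then show ?thesis using True by blast
next
  case False
  then have r: "0 < r" by simp
  \<comment> \<open>With zero in place of the unknown entry, \<open>\<phi>\<close> below is the
    obstruction caused by the lower orders alone, and the choice of \<open>\<rho> r\<close> will add
    a coboundary to it.\<close>
  define \<rho>' where "\<rho>' = (\<lambda>s. if s < r then \<rho> s else (\<lambda>f a. 0))"
  have prev': "quantization_up_to s \<rho>'" if "s < r" for s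
    by (rule quantization_up_to_local[OF _ prev[OF that]]) (use that in \<open>simp add: \<rho>'_def\<close>)
  have ex: "\<exists>k l. bidiff S A p k l (\<rho>' s)" for s
  proof (cases "s < r")
    case True
    then show ?thesis using prev' by (simp add: quantization_up_to_def)
  next
    case False
    then show ?thesis using bidiff_zero by (auto simp: \<rho>'_def)
  qed
  interpret \<rho>': bilinear_family S A S \<rho>' by (rule bidiff_family_bilinear[OF ex])
  have \<rho>'_r: "\<rho>' r f a = 0" for f a by (simp add: \<rho>'_def)
  have \<rho>'0: "\<rho>' 0 f a = f * (a \<circ> p)" if "f \<in> S" "a \<in> A" for f a
    using prev'[OF r] that by (simp add: quantization_up_to_def)
  have \<rho>'_pull: "\<rho>' s (a \<circ> p) b = C s a b \<circ> p" if "s < r" "a \<in> A" "b \<in> A" for s a b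
    using prev'[OF that(1)] that by (simp add: quantization_up_to_def)
  have \<rho>'_one_right: "\<rho>' s f 1 = 0" if "s > 0" "f \<in> S" for s f
    using prev'[of s] that by (cases "s < r") (simp_all add: quantization_up_to_def \<rho>'_def)
  have \<rho>'_one_left: "\<rho>' s 1 a = 0" if "s > 0" "a \<in> A" for s a
    using \<rho>'_pull[of s 1 a] that Ac(5) C_one(1) by (cases "s < r") (simp_all add: \<rho>'_def)
  have zero: "associator_coeff \<rho>' C n f a b = 0" if "f \<in> S" "a \<in> A" "b \<in> A" "n < r" for f a b n
    using prev'[OF that(4)] that by (simp add: quantization_up_to_def)
  define \<phi> where "\<phi> = associator_coeff \<rho>' C r"
  obtain K where "\<And>b. b \<in> A \<Longrightarrow> bidiff S A p K K (\<lambda>f a. associator_coeff \<rho>' C r f a b)"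
    "\<And>f a. f \<in> S \<Longrightarrow> a \<in> A \<Longrightarrow>
      linear_op A S (associator_coeff \<rho>' C r f a) \<and> diff_op_along A p K (associator_coeff \<rho>' C r f a)"
    by (rule associator_coeff_operator[of r \<rho>', OF ex]) (rule that; blast)
  note K = this[folded \<phi>_def]
  \<comment> \<open>The total order of \<open>\<phi>\<close> in the two slots on which the splitting
    acts.\<close>
  define N where "N = K + K"
  define \<psi> where "\<psi> = (\<lambda>f b. homotopy N (\<lambda>f a. \<phi> f a b) f)"
  have \<psi>: "bidiff S A p (K + 2 * N) K \<psi>"
    unfolding \<psi>_def by (rule homotopy_bidiff[OF K])
  \<comment> \<open>The coboundary of \<open>\<psi>\<close> equals the obstruction, so the
    correction carries the opposite sign.\<close>
  define y where "y = (\<lambda>f b. - 1 * \<psi> f b)"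
  have y: "bidiff S A p (K + 2 * N) K y"
    unfolding y_def by (intro bidiff_mult_left \<psi> Sc)
  have cob: "\<phi> f a b = \<psi> ((a \<circ> p) * f) b - \<psi> f (a * b) + (b \<circ> p) * \<psi> f a"
    if "f \<in> S" "a \<in> A" "b \<in> A" for f a b
    unfolding \<psi>_def
  proof (rule cocycle2_is_coboundary[OF K])
    show "\<phi> ((a \<circ> p) * f) b c - \<phi> f (a * b) c + \<phi> f a (b * c) - \<phi> f a b * (c \<circ> p) = 0"
      if "f \<in> S" "a \<in> A" "b \<in> A" "c \<in> A" for f a b c
      unfolding \<phi>_def by (rule associator_coeff_cocycle[OF \<rho>'.bilinear_family_axioms \<rho>'0 zero that])
  qed (simp_all add: N_def that)
  let ?\<rho> = "\<rho>(r := y)"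
  have same: "?\<rho> s = \<rho>' s" if "s < r" for s using that by (simp add: \<rho>'_def)
  have assoc: "associator_coeff ?\<rho> C r f a b = 0" if f: "f \<in> S" and a: "a \<in> A" and b: "b \<in> A" for f a b
  proof -
    \<comment> \<open>The new operator occurs in the first sum of the associator at the two ends
      \<open>s = 0\<close> and \<open>s = r\<close> only.\<close>
    have split: "(\<Sum>s\<le>r. h s) = h 0 + (\<Sum>s\<in>{1..<r}. h s) + h r" for h :: "nat \<Rightarrow> 'p \<Rightarrow> complex"
    proof -
      have "{..r} = insert 0 (insert r {1..<r})" using r by auto
      then show ?thesis using r by (simp add: algebra_simps)
    qed
    have "(\<Sum>s\<in>{1..<r}. ?\<rho> s (?\<rho> (r - s) f a) b) = (\<Sum>s\<in>{1..<r}. \<rho>' s (\<rho>' (r - s) f a) b)"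
    proof (intro sum.cong refl)
      fix s assume "s \<in> {1..<r}"
      then have "s < r" "r - s < r" by auto
      then show "?\<rho> s (?\<rho> (r - s) f a) b = \<rho>' s (\<rho>' (r - s) f a) b" by (simp only: same)
    qed
    then have 1: "(\<Sum>s\<le>r. ?\<rho> s (?\<rho> (r - s) f a) b) =
        (\<Sum>s\<le>r. \<rho>' s (\<rho>' (r - s) f a) b) + y f a * (b \<circ> p) + y ((a \<circ> p) * f) b"
      using r \<rho>'0[OF bidiff_simps(1)[OF y f a] b] \<rho>'0[OF f a] \<rho>'0[OF Sc(4) b] same[of 0]
      by (simp add: split \<rho>'_r mult.commute)
    have 2: "(\<Sum>s\<le>r. ?\<rho> s f (C (r - s) a b)) = (\<Sum>s\<le>r. \<rho>' s f (C (r - s) a b)) + y f (a * b)"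
    proof -
      have "(\<Sum>s<r. ?\<rho> s f (C (r - s) a b)) = (\<Sum>s<r. \<rho>' s f (C (r - s) a b))"
        by (intro sum.cong refl) (simp add: \<rho>'_def)
      then show ?thesis
        by (simp add: lessThan_Suc_atMost[symmetric] \<rho>'_r C_zero a b)
    qed
    have "associator_coeff ?\<rho> C r f a b =
        \<phi> f a b + y f a * (b \<circ> p) + y ((a \<circ> p) * f) b - y f (a * b)"
      unfolding associator_coeff_def[of ?\<rho>] 1 2 \<phi>_def associator_coeff_def[of \<rho>'] by simp
    then show ?thesis
      using cob[OF f a b] by (simp add: y_def algebra_simps)
  qed
  have pull_r: "y (a \<circ> p) b = C r a b \<circ> p" if a: "a \<in> A" and b: "b \<in> A" for a b
  proof -
    \<comment> \<open>Positive orders annihilate the unit and the entry at \<open>r\<close> is zero.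
      Only \<open>s = 0\<close> in the second sum survives, so the obstruction on the unit is
      \<open>- (C r a b \<circ> p)\<close>, and the sign of \<open>y\<close> turns it into the
      required value.\<close>
    have "\<rho>' s (\<rho>' (r - s) 1 a) b = 0" if "s \<le> r" for s
    proof (cases "s = r")
      case False
      then have "\<rho>' (r - s) 1 a = 0" using that \<rho>'_one_left a by simp
      then show ?thesis using \<rho>'.zero_simps(1)[OF b] by simp
    qed (simp add: \<rho>'_r)
    then have 1: "(\<Sum>s\<le>r. \<rho>' s (\<rho>' (r - s) 1 a) b) = 0" by simp
    have C_in: "C s a b \<in> A" for s using linear_opD(1)[OF C.right[OF a] b] .
    have 2: "(\<Sum>s\<le>r. \<rho>' s 1 (C (r - s) a b)) = (\<Sum>s\<le>r. if s = 0 then C r a b \<circ> p else 0)"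
      by (intro sum.cong refl) (auto simp: \<rho>'_one_left C_in \<rho>'0 Sc(5))
    have "\<psi> (a \<circ> p) b = \<phi> 1 a b"
      unfolding \<psi>_def by (rule homotopy_pullback[OF K _ a b]) (simp_all add: N_def)
    also have "\<dots> = - (C r a b \<circ> p)"
      unfolding \<phi>_def associator_coeff_def 1 2 by simp
    finally show ?thesis by (simp add: y_def)
  qed
  have one_r: "y f 1 = 0" if f: "f \<in> S" for f
  proof -
    \<comment> \<open>All lower operators, on \<open>P\<close> as well as on \<open>M\<close>, are
      normalised in the last argument. The obstruction with last argument 1 is therefore zero, and
      so is its homotopy.\<close>
    have "\<phi> f a 1 = 0" if f: "f \<in> S" and a: "a \<in> A" for f a
    proof -
      have "\<rho>' s (\<rho>' (r - s) f a) 1 = 0" for s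
      proof (cases "s = 0")
        case True
        then show ?thesis using \<rho>'0[OF Sc(4) Ac(5)] by (simp add: \<rho>'_r)
      next
        case False
        then show ?thesis using \<rho>'_one_right linear_opD(1)[OF \<rho>'.left[OF a] f] by simp
      qed
      moreover have "\<rho>' s f (C (r - s) a 1) = 0" if "s \<le> r" for s
      proof (cases "s = r")
        case False
        then have "C (r - s) a 1 = 0" using C_one(2)[OF _ a] that by simp
        then show ?thesis using \<rho>'.zero_simps(2)[OF f] by simp
      qed (simp add: \<rho>'_r)
      ultimately show ?thesis unfolding \<phi>_def associator_coeff_def by simp
    qed
    then have "\<psi> f 1 = 0"
      unfolding \<psi>_def by (intro homotopy_zero Ac f)
    then show ?thesis by (simp add: y_def)
  qed
  have "quantization_up_to r ?\<rho>"
    unfolding quantization_up_to_def using y assoc pull_r one_r False by auto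
  then show ?thesis by blast
qed

lemma quantization_exists: "\<exists>\<rho>. \<forall>r. quantization_up_to r \<rho>"
  by (rule dependent_sequence[OF quantization_step quantization_up_to_local])


lemma quantization_module:
  assumes \<rho>: "\<And>r. quantization_up_to r \<rho>"
  shows "bilinear_family S A S \<rho>"
    and "F \<in> formal S \<Longrightarrow> a \<in> formal A \<Longrightarrow> b \<in> formal A \<Longrightarrow>
      formal_biop \<rho> (formal_biop \<rho> F a) b = formal_biop \<rho> F (formal_biop C a b)"
    and "F \<in> formal S \<Longrightarrow> formal_biop \<rho> F 1 = F"
    and "a \<in> formal A \<Longrightarrow> b \<in> formal A \<Longrightarrow>
      formal_biop \<rho> (formal_pullback p a) b = formal_pullback p (formal_biop C a b)"
proof -
  have ex: "\<exists>k l. bidiff S A p k l (\<rho> r)" for r using \<rho> by (simp add: quantization_up_to_def)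
  show bil: "bilinear_family S A S \<rho>" by (rule bidiff_family_bilinear[OF ex])
  interpret \<rho>: bilinear_family S A S \<rho> by (rule bil)
  have \<rho>0: "\<rho> 0 f a = f * (a \<circ> p)" if "f \<in> S" "a \<in> A" for f a
    using \<rho>[of 0] that by (simp add: quantization_up_to_def)
  have zero: "associator_coeff \<rho> C n f a b = 0" if "f \<in> S" "a \<in> A" "b \<in> A" for n f a b
    using \<rho>[of n] that by (simp add: quantization_up_to_def)
  show "formal_biop \<rho> (formal_biop \<rho> F a) b = formal_biop \<rho> F (formal_biop C a b)"
    if F: "F \<in> formal S" and a: "a \<in> formal A" and b: "b \<in> formal A"
  proof (rule fps_ext)
    fix n
    \<comment> \<open>The coefficient \<open>n\<close> falls below the threshold
      \<open>Suc n\<close>, under which everything vanishes.\<close>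
    have "associator \<rho> C F a b $ n = 0"
      by (rule associator_leading(1)[OF bil C.bilinear_family_axioms _ F a b, where r = "Suc n"])
        (simp_all add: zero)
    then show "formal_biop \<rho> (formal_biop \<rho> F a) b $ n = formal_biop \<rho> F (formal_biop C a b) $ n"
      by (simp add: associator_def)
  qed
  show "formal_biop \<rho> F 1 = F" if F: "F \<in> formal S"
  proof (rule fps_ext)
    fix n
    have "formal_biop \<rho> F (fps_const 1) $ n = (\<Sum>s\<le>n. \<rho> s (F $ (n - s)) 1)"
      by (rule \<rho>.biop_const_right[OF F Ac(5)])
    also have "\<dots> = (\<Sum>s\<le>n. if s = 0 then F $ n else 0)"
    proof (intro sum.cong refl)
      fix s
      show "\<rho> s (F $ (n - s)) 1 = (if s = 0 then F $ n else 0)"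
        using \<rho>[of s] \<rho>0[OF formalD[OF F] Ac(5)] formalD[OF F]
        by (cases "s = 0") (simp_all add: quantization_up_to_def)
    qed
    finally show "formal_biop \<rho> F 1 $ n = F $ n" by simp
  qed
  show "formal_biop \<rho> (formal_pullback p a) b = formal_pullback p (formal_biop C a b)"
    if a: "a \<in> formal A" and b: "b \<in> formal A"
  proof (rule fps_ext)
    fix n
    have sum_pull: "(\<Sum>i\<in>I. h i) \<circ> p = (\<Sum>i\<in>I. h i \<circ> p)" for h :: "nat \<Rightarrow> 'm \<Rightarrow> complex" and I
      by (rule ext) (simp add: sum_fun_apply comp_apply)
    show "formal_biop \<rho> (formal_pullback p a) b $ n = formal_pullback p (formal_biop C a b) $ n"
      using \<rho> formalD[OF a] formalD[OF b]
      by (simp add: formal_biop_nth formal_pullback_def sum_pull quantization_up_to_def)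
  qed
qed

end

section \<open>The obstruction to an equivalence\<close>

definition intertwiner_coeff ::
  "(nat \<Rightarrow> ('p, 'm) bioperator) \<Rightarrow>
   (nat \<Rightarrow> ('p, 'm) bioperator) \<Rightarrow>
   (nat \<Rightarrow> ('p \<Rightarrow> complex) \<Rightarrow> ('p \<Rightarrow> complex)) \<Rightarrow> nat \<Rightarrow>
   ('p, 'm) bioperator" where
  "intertwiner_coeff \<rho> \<rho>' T n f a =
     (\<Sum>s\<le>n. \<rho>' s (T (n - s) f) a) - (\<Sum>s\<le>n. T s (\<rho> (n - s) f a))"

definition intertwiner ::
  "(nat \<Rightarrow> ('p, 'm) bioperator) \<Rightarrow>
   (nat \<Rightarrow> ('p, 'm) bioperator) \<Rightarrow>
   (nat \<Rightarrow> ('p \<Rightarrow> complex) \<Rightarrow> ('p \<Rightarrow> complex)) \<Rightarrow>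
   ('p \<Rightarrow> complex) fps \<Rightarrow> ('m \<Rightarrow> complex) fps \<Rightarrow> ('p \<Rightarrow> complex) fps" where
  "intertwiner \<rho> \<rho>' T F a = formal_biop \<rho>' (formal_op T F) a - formal_op T (formal_biop \<rho> F a)"

text \<open>The counterpart of \<open>associator_leading\<close> for the defect of \<open>T\<close>,
  a map that is bilinear over the parameter instead of trilinear.\<close>

lemma intertwiner_leading:
  assumes "bilinear_family S A S \<rho>" "bilinear_family S A S \<rho>'" "linear_family S T"
    and zero: "\<And>f a n. f \<in> S \<Longrightarrow> a \<in> A \<Longrightarrow> n < r \<Longrightarrow> intertwiner_coeff \<rho> \<rho>' T n f a = 0"
    and F: "F \<in> formal S" and a: "a \<in> formal A"
  shows "n < r \<Longrightarrow> intertwiner \<rho> \<rho>' T F a $ n = 0"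
    "intertwiner \<rho> \<rho>' T F a $ r = intertwiner_coeff \<rho> \<rho>' T r (F $ 0) (a $ 0)"
proof -
  interpret \<rho>: bilinear_family S A S \<rho> by fact
  interpret \<rho>': bilinear_family S A S \<rho>' by fact
  interpret T: linear_family S T by fact
  have const: "intertwiner \<rho> \<rho>' T (fps_const f) (fps_const a) $ n = intertwiner_coeff \<rho> \<rho>' T n f a"
    if "f \<in> S" "a \<in> A" for f a n
  proof -
    note c = formal_const[OF \<rho>.S that(1)] formal_const[OF \<rho>.A that(2)]
    show ?thesis
      unfolding intertwiner_def intertwiner_coeff_def fps_sub_nth
        \<rho>'.biop_const_right[OF T.op_in[OF c(1)] that(2)] formal_op_nth[of T "formal_biop \<rho> _ _"]
        \<rho>.biop_const_const[OF that] T.op_const ..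
  qed
  note lin = intertwiner_def \<rho>.biop_in \<rho>'.biop_in T.op_in \<rho>.biop_add_left \<rho>.biop_add_right \<rho>.biop_X_left
    \<rho>.biop_X_right \<rho>'.biop_add_left \<rho>'.biop_add_right \<rho>'.biop_X_left \<rho>'.biop_X_right
    T.op_add T.op_X right_diff_distrib
  note leading = formal_leading_coefficient2[where \<Psi> = "intertwiner \<rho> \<rho>' T", OF \<rho>.S \<rho>.A _ _ _ _ _ F a]
  show "intertwiner \<rho> \<rho>' T F a $ n = 0" if "n < r"
    by (rule leading(1)[OF _ _ _ _ _ that]) (simp_all only: const zero, simp_all add: lin)
  have "intertwiner \<rho> \<rho>' T F a $ r = intertwiner \<rho> \<rho>' T (fps_const (F $ 0)) (fps_const (a $ 0)) $ r"
    by (rule leading(2)) (simp_all only: const zero, simp_all add: lin)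
  then show "intertwiner \<rho> \<rho>' T F a $ r = intertwiner_coeff \<rho> \<rho>' T r (F $ 0) (a $ 0)"
    by (simp only: const formalD F a)
qed

lemma (in pulled_back_algebra) operator_uniform_bound:
  fixes r :: nat
  assumes "\<And>s. s \<le> r \<Longrightarrow> \<exists>k. diff_op_along S id k (T s)"
  obtains K where "\<And>s L. s \<le> r \<Longrightarrow> K \<le> L \<Longrightarrow> diff_op_along S id L (T s)"
proof -
  from assms obtain k where k: "\<And>s. s \<le> r \<Longrightarrow> diff_op_along S id (k s) (T s)" by metis
  have "diff_op_along S id L (T s)" if "s \<le> r" "(\<Sum>s\<le>r. k s) \<le> L" for s L
  proof (rule diff_op_along_mono[OF S k[OF that(1)]])
    have "k s \<le> (\<Sum>s\<le>r. k s)" using that(1) by (intro member_le_sum) auto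
    then show "k s \<le> L" using that(2) by simp
  qed
  then show ?thesis by (rule that)
qed

section \<open>Construction of equivalences\<close>

context star_submersion
begin

context
  fixes \<rho> \<rho>' :: "nat \<Rightarrow> ('p, 'm) bioperator"
  assumes rho: "\<And>r. \<exists>k l. bidiff S A p k l (\<rho> r)" "\<And>r. \<exists>k l. bidiff S A p k l (\<rho>' r)"
    and rho0: "\<And>f a. f \<in> S \<Longrightarrow> a \<in> A \<Longrightarrow> \<rho> 0 f a = f * (a \<circ> p)"
      "\<And>f a. f \<in> S \<Longrightarrow> a \<in> A \<Longrightarrow> \<rho>' 0 f a = f * (a \<circ> p)"
    and module: "\<And>F a b. F \<in> formal S \<Longrightarrow> a \<in> formal A \<Longrightarrow> b \<in> formal A \<Longrightarrow>
        formal_biop \<rho> (formal_biop \<rho> F a) b = formal_biop \<rho> F (formal_biop C a b)"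
      "\<And>F a b. F \<in> formal S \<Longrightarrow> a \<in> formal A \<Longrightarrow> b \<in> formal A \<Longrightarrow>
        formal_biop \<rho>' (formal_biop \<rho>' F a) b = formal_biop \<rho>' F (formal_biop C a b)"
begin

interpretation \<rho>: bilinear_family S A S \<rho> by (rule bidiff_family_bilinear[OF rho(1)])
interpretation \<rho>': bilinear_family S A S \<rho>' by (rule bidiff_family_bilinear[OF rho(2)])

definition equivalence_up_to :: "nat \<Rightarrow> (nat \<Rightarrow> ('p \<Rightarrow> complex) \<Rightarrow> ('p \<Rightarrow> complex)) \<Rightarrow> bool" where
  "equivalence_up_to r T \<longleftrightarrow> linear_op S S (T r) \<and> (\<exists>k. diff_op_along S id k (T r)) \<and>
     (r = 0 \<longrightarrow> (\<forall>f\<in>S. T 0 f = f)) \<and>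
     (\<forall>f\<in>S. \<forall>a\<in>A. intertwiner_coeff \<rho> \<rho>' T r f a = 0)"

lemma equivalence_up_to_local:
  assumes "\<And>s. s \<le> r \<Longrightarrow> T s = T' s" "equivalence_up_to r T"
  shows "equivalence_up_to r T'"
proof -
  have "intertwiner_coeff \<rho> \<rho>' T r f a = intertwiner_coeff \<rho> \<rho>' T' r f a" for f a
    unfolding intertwiner_coeff_def using assms(1) by (intro arg_cong2[of _ _ _ _ "(-)"] sum.cong) auto
  then show ?thesis using assms unfolding equivalence_up_to_def by (simp add: assms(1)[symmetric])
qed

text \<open>The defect \<open>D(F, a) = T F \<bullet>' a - T (F \<bullet> a)\<close> satisfies
  \<open>D(F \<bullet> a, b) - D(F, a \<star> b) + D(F, a) \<bullet>' b = 0\<close> by the module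
  laws of both actions. Its coefficient at order \<open>r\<close> is the 1-cocycle
  condition.\<close>

lemma intertwiner_coeff_cocycle:
  assumes T: "linear_family S T" and T0: "\<And>f. f \<in> S \<Longrightarrow> T 0 f = f"
    and zero: "\<And>f a n. f \<in> S \<Longrightarrow> a \<in> A \<Longrightarrow> n < r \<Longrightarrow> intertwiner_coeff \<rho> \<rho>' T n f a = 0"
    and f: "f \<in> S" and a: "a \<in> A" and b: "b \<in> A"
  shows "intertwiner_coeff \<rho> \<rho>' T r ((a \<circ> p) * f) b - intertwiner_coeff \<rho> \<rho>' T r f (a * b)
    + intertwiner_coeff \<rho> \<rho>' T r f a * (b \<circ> p) = 0"
proof -
  interpret T: linear_family S T by fact
  have lead: "n < r \<Longrightarrow> intertwiner \<rho> \<rho>' T F a $ n = 0"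
    "intertwiner \<rho> \<rho>' T F a $ r = intertwiner_coeff \<rho> \<rho>' T r (F $ 0) (a $ 0)"
    if "F \<in> formal S" "a \<in> formal A" for F a n
    by (rule intertwiner_leading[OF \<rho>.bilinear_family_axioms \<rho>'.bilinear_family_axioms T];
        simp add: zero that)+
  define F G H where "F = fps_const f" and "G = fps_const a" and "H = fps_const b"
  have F: "F \<in> formal S" and G: "G \<in> formal A" and H: "H \<in> formal A"
    unfolding F_def G_def H_def by (intro formal_const S A f a b)+
  let ?D = "intertwiner \<rho> \<rho>' T"
  have in_S: "?D F G \<in> formal S"
    unfolding intertwiner_def by (intro formal_diff S \<rho>'.biop_in \<rho>.biop_in T.op_in F G)
  have "?D (formal_biop \<rho> F G) H - ?D F (formal_biop C G H) + formal_biop \<rho>' (?D F G) H = 0"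
    unfolding intertwiner_def
    by (simp add: \<rho>'.biop_diff_left \<rho>'.biop_in \<rho>.biop_in T.op_in F G H module)
  then have "(?D (formal_biop \<rho> F G) H - ?D F (formal_biop C G H) + formal_biop \<rho>' (?D F G) H) $ r = 0"
    by simp
  moreover have "?D (formal_biop \<rho> F G) H $ r = intertwiner_coeff \<rho> \<rho>' T r ((a \<circ> p) * f) b"
    using lead(2)[OF \<rho>.biop_in[OF F G] H] \<rho>.biop_const_const[OF f a, of 0]
    by (simp add: F_def G_def H_def rho0 f a mult.commute)
  moreover have "?D F (formal_biop C G H) $ r = intertwiner_coeff \<rho> \<rho>' T r f (a * b)"
    using lead(2)[OF F C.biop_in[OF G H]] C.biop_const_const[OF a b, of 0]
    by (simp add: F_def G_def H_def C_zero a b)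
  moreover have "formal_biop \<rho>' (?D F G) H $ r = intertwiner_coeff \<rho> \<rho>' T r f a * (b \<circ> p)"
  proof -
    have "formal_biop \<rho>' (?D F G) H $ r = \<rho>' 0 (?D F G $ r) (H $ 0)"
      by (rule \<rho>'.biop_leading[OF in_S H]) (rule lead(1)[OF F G])
    then show ?thesis
      using formalD[OF in_S, of r] lead(2)[OF F G] b
      by (simp add: F_def G_def H_def rho0)
  qed
  ultimately show ?thesis by (simp add: algebra_simps)
qed

lemma equivalence_step:
  assumes prev: "\<And>s. s < r \<Longrightarrow> equivalence_up_to s T"
  shows "\<exists>y. equivalence_up_to r (T(r := y))"
proof (cases "r = 0")
  case True
  have "linear_op S S (\<lambda>f. f)" by (rule linear_opI) simp_all
  moreover have "diff_op_along S id 1 (\<lambda>f. f)" by simp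
  ultimately have "equivalence_up_to 0 (T(0 := \<lambda>f. f))"
    unfolding equivalence_up_to_def by (auto simp: intertwiner_coeff_def rho0 intro!: exI[of _ 1])
  then show ?thesis using True by blast
next
  case False
  then have r: "0 < r" by simp
  \<comment> \<open>As in the construction of the module structure, the zero entry at
    \<open>r\<close> isolates the obstruction caused by lower orders.\<close>
  define T' where "T' = (\<lambda>s. if s < r then T s else (\<lambda>f. 0))"
  have prev': "equivalence_up_to s T'" if "s < r" for s
    by (rule equivalence_up_to_local[OF _ prev[OF that]]) (use that in \<open>simp add: T'_def\<close>)
  have lin: "linear_op S S (T' s)" for s
  proof (cases "s < r")
    case True
    then show ?thesis using prev' by (simp add: equivalence_up_to_def)
  next
    case False
    then show ?thesis using linear_op_zero[OF S] by (simp add: T'_def)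
  qed
  have ex: "\<exists>k. diff_op_along S id k (T' s)" for s
  proof (cases "s < r")
    case True
    then show ?thesis using prev' by (simp add: equivalence_up_to_def)
  next
    case False
    then show ?thesis using diff_op_along_zero[OF S] by (auto simp: T'_def)
  qed
  interpret T': linear_family S T' by unfold_locales (rule S lin)+
  have T'_r: "T' r f = 0" for f by (simp add: T'_def)
  have T'0: "T' 0 f = f" if "f \<in> S" for f
    using prev'[OF r] that by (simp add: equivalence_up_to_def)
  have zero: "intertwiner_coeff \<rho> \<rho>' T' n f a = 0" if "f \<in> S" "a \<in> A" "n < r" for f a n
    using prev'[OF that(3)] that by (simp add: equivalence_up_to_def)
  define \<kappa> where "\<kappa> = intertwiner_coeff \<rho> \<rho>' T' r"
  obtain K where \<kappa>: "bidiff S A p K K \<kappa>"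
  proof -
    obtain L1 where L1: "\<And>s L. s \<le> r \<Longrightarrow> L1 \<le> L \<Longrightarrow> bidiff S A p L L (\<rho> s)"
      using bidiff_uniform_bound[of r \<rho>] rho(1) by blast
    obtain L2 where L2: "\<And>s L. s \<le> r \<Longrightarrow> L2 \<le> L \<Longrightarrow> bidiff S A p L L (\<rho>' s)"
      using bidiff_uniform_bound[of r \<rho>'] rho(2) by blast
    obtain L3 where L3: "\<And>s L. s \<le> r \<Longrightarrow> L3 \<le> L \<Longrightarrow> diff_op_along S id L (T' s)"
      using operator_uniform_bound[of r T'] ex by blast
    define L where "L = max L1 (max L2 L3)"
    have L: "bidiff S A p L L (\<rho> s)" "bidiff S A p L L (\<rho>' s)" "diff_op_along S id L (T' s)"
      if "s \<le> r" for s
      using L1[OF that] L2[OF that] L3[OF that] by (auto simp: L_def)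
    have le: "r - s \<le> r" for s by simp
    have "bidiff S A p (L + L) (L + L) (intertwiner_coeff \<rho> \<rho>' T' r)"
      unfolding intertwiner_coeff_def[abs_def]
    proof (intro bidiff_diff bidiff_sum)
      fix s assume "s \<in> {..r}"
      then have s: "s \<le> r" by simp
      show "bidiff S A p (L + L) (L + L) (\<lambda>f a. \<rho>' s (T' (r - s) f) a)"
        by (rule bidiff_mono[OF bidiff_precompose[OF L(2)[OF s] lin L(3)[OF le]]]) auto
      show "bidiff S A p (L + L) (L + L) (\<lambda>f a. T' s (\<rho> (r - s) f a))"
        by (rule bidiff_postcompose[OF L(1)[OF le] lin L(3)[OF s]])
    qed
    then show ?thesis using that unfolding \<kappa>_def by blast
  qed
  define N where "N = K + K"
  \<comment> \<open>A new term \<open>y\<close> changes the obstruction by minus its coboundary, so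
    here the primitive is taken with a plus sign.\<close>
  define y where "y = homotopy N \<kappa>"
  have y_op: "linear_op S S y" "diff_op_along S id (K + 2 * N) y"
    unfolding y_def by (rule homotopy_operator[OF \<kappa>])+
  have cob: "\<kappa> f a = y ((a \<circ> p) * f) - (a \<circ> p) * y f" if "f \<in> S" "a \<in> A" for f a
    unfolding y_def
  proof (rule cocycle1_is_coboundary[OF \<kappa>])
    show "\<kappa> ((a \<circ> p) * f) b - \<kappa> f (a * b) + \<kappa> f a * (b \<circ> p) = 0"
      if "f \<in> S" "a \<in> A" "b \<in> A" for f a b
      unfolding \<kappa>_def by (rule intertwiner_coeff_cocycle[OF T'.linear_family_axioms T'0 zero that])
  qed (simp_all add: N_def that)
  let ?T = "T(r := y)"
  have inter: "intertwiner_coeff \<rho> \<rho>' ?T r f a = 0" if f: "f \<in> S" and a: "a \<in> A" for f a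
  proof -
    have 1: "(\<Sum>s\<le>r. \<rho>' s (?T (r - s) f) a) = y f * (a \<circ> p) + (\<Sum>s\<le>r. \<rho>' s (T' (r - s) f) a)"
    proof -
      have "(\<Sum>s\<in>{1..r}. \<rho>' s (?T (r - s) f) a) = (\<Sum>s\<in>{1..r}. \<rho>' s (T' (r - s) f) a)"
      proof (intro sum.cong refl)
        fix s assume "s \<in> {1..r}"
        then have "r - s < r" using r by auto
        then show "\<rho>' s (?T (r - s) f) a = \<rho>' s (T' (r - s) f) a" by (simp add: T'_def)
      qed
      moreover have "{..r} = insert 0 {1..r}" by auto
      ultimately show ?thesis
        using linear_opD(1)[OF y_op(1) f] a
        by (simp add: rho0 T'_r \<rho>'.zero_simps)
    qed
    have 2: "(\<Sum>s\<le>r. ?T s (\<rho> (r - s) f a)) = (\<Sum>s\<le>r. T' s (\<rho> (r - s) f a)) + y ((a \<circ> p) * f)"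
    proof -
      have "(\<Sum>s<r. ?T s (\<rho> (r - s) f a)) = (\<Sum>s<r. T' s (\<rho> (r - s) f a))"
        by (intro sum.cong refl) (simp add: T'_def)
      then show ?thesis
        by (simp add: lessThan_Suc_atMost[symmetric] T'_r rho0 f a mult.commute)
    qed
    have "intertwiner_coeff \<rho> \<rho>' ?T r f a = \<kappa> f a + y f * (a \<circ> p) - y ((a \<circ> p) * f)"
      unfolding intertwiner_coeff_def[of \<rho> \<rho>' ?T] 1 2 \<kappa>_def intertwiner_coeff_def[of \<rho> \<rho>' T'] by simp
    then show ?thesis using cob[OF f a] by (simp add: algebra_simps)
  qed
  have "equivalence_up_to r ?T"
    unfolding equivalence_up_to_def using y_op inter False by auto
  then show ?thesis by blast
qed

lemma quantizations_equivalent: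
  "\<exists>T. (\<forall>r. linear_op S S (T r) \<and> (\<exists>k. diff_op_along S id k (T r))) \<and> (\<forall>f\<in>S. T 0 f = f) \<and>
     (\<forall>F\<in>formal S. \<forall>a\<in>formal A. formal_op T (formal_biop \<rho> F a) = formal_biop \<rho>' (formal_op T F) a)"
proof -
  have "\<exists>T. \<forall>r. equivalence_up_to r T"
    by (rule dependent_sequence[OF equivalence_step equivalence_up_to_local])
  then obtain T where T: "\<And>r. equivalence_up_to r T" by blast
  have lin: "linear_family S T"
    using T S by unfold_locales (simp_all add: equivalence_up_to_def)
  have zero: "intertwiner_coeff \<rho> \<rho>' T n f a = 0" if "f \<in> S" "a \<in> A" for n f a
    using T[of n] that by (simp add: equivalence_up_to_def)
  have "formal_op T (formal_biop \<rho> F a) = formal_biop \<rho>' (formal_op T F) a"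
    if F: "F \<in> formal S" and a: "a \<in> formal A" for F a
  proof (rule fps_ext)
    fix n
    have "intertwiner \<rho> \<rho>' T F a $ n = 0"
      by (rule intertwiner_leading(1)[OF \<rho>.bilinear_family_axioms \<rho>'.bilinear_family_axioms lin _ F a,
            where r = "Suc n"]) (simp_all add: zero)
    then show "formal_op T (formal_biop \<rho> F a) $ n = formal_biop \<rho>' (formal_op T F) a $ n"
      by (simp add: intertwiner_def)
  qed
  moreover have "\<forall>r. linear_op S S (T r) \<and> (\<exists>k. diff_op_along S id k (T r))" "\<forall>f\<in>S. T 0 f = f"
    using T by (simp_all add: equivalence_up_to_def)
  ultimately show ?thesis by blast
qed

end

end

declare pointwise [simp]

section \<open>Calculus on relatively open subsets of a subspace\<close>

text \<open>The derivative in \<open>Ck_on\<close> is existential and arbitrary off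
  \<open>V\<close>. In directions of \<open>V\<close> this is a canonical representative; it depends
  only on \<open>f\<close> along a line near \<open>x\<close>, so statements about it can be
  localised.\<close>

definition dir_deriv :: "'e \<Rightarrow> ('e::real_normed_vector \<Rightarrow> 'b::real_normed_vector) \<Rightarrow> 'e \<Rightarrow> 'b" where
  "dir_deriv v f x = vector_derivative (\<lambda>t. f (x + t *\<^sub>R v)) (at 0)"

lemma line_preimage_open:
  fixes V :: "'e::real_normed_vector set"
  assumes "subspace V" "openin (top_of_set V) W" "x \<in> W" "v \<in> V"
  obtains T where "open T" "(0::real) \<in> T" "\<And>t. t \<in> T \<Longrightarrow> x + t *\<^sub>R v \<in> W"
proof -
  obtain O' where O': "open O'" "W = V \<inter> O'"
    using assms(2) by (auto simp: openin_open)
  let ?T = "(\<lambda>t::real. x + t *\<^sub>R v) -` O'"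
  have "open ?T"
    by (intro open_vimage O'(1)) (intro continuous_intros)
  moreover have "0 \<in> ?T" using assms(3) O' by auto
  moreover have "x + t *\<^sub>R v \<in> W" if "t \<in> ?T" for t
    using that O' assms by (auto intro!: subspace_add subspace_mul)
  ultimately show ?thesis by (rule that)
qed

text \<open>For small parameters the line through \<open>x\<close> in the direction \<open>v\<close>
  stays in \<open>W\<close>, and the chain rule along this line determines the value
  \<open>f' v\<close>.\<close>

lemma dir_deriv_eq:
  assumes "subspace V" "openin (top_of_set V) W" "x \<in> W" "v \<in> V"
    and "(f has_derivative f') (at x within W)"
  shows "dir_deriv v f x = f' v"
proof -
  obtain T where T: "open T" "(0::real) \<in> T" "\<And>t. t \<in> T \<Longrightarrow> x + t *\<^sub>R v \<in> W"
    using line_preimage_open[OF assms(1-4)] by blast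
  have 1: "((\<lambda>t. x + t *\<^sub>R v) has_derivative (\<lambda>t. t *\<^sub>R v)) (at 0 within T)"
    by (auto intro!: derivative_eq_intros)
  have "((\<lambda>t. f (x + t *\<^sub>R v)) has_derivative (\<lambda>t. f' (t *\<^sub>R v))) (at 0 within T)"
    by (rule has_derivative_in_compose[OF 1]) (use T assms(5) in \<open>auto intro: has_derivative_subset\<close>)
  moreover have "f' (t *\<^sub>R v) = t *\<^sub>R f' v" for t
    using has_derivative_linear[OF assms(5)] by (simp add: linear_scale)
  ultimately have "((\<lambda>t. f (x + t *\<^sub>R v)) has_vector_derivative f' v) (at 0)"
    using T by (simp add: has_vector_derivative_def at_within_open[of 0 T])
  then show ?thesis
    by (simp add: dir_deriv_def vector_derivative_at)
qed

lemma at_within_relatively_open: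
  assumes "openin (top_of_set W) W'" "x \<in> W'"
  shows "at x within W' = at x within W"
proof -
  obtain O' where "open O'" "W' = W \<inter> O'"
    using assms(1) by (auto simp: openin_open)
  then show ?thesis
    using at_within_nhd[of x O' W' W] assms(2) by auto
qed

text \<open>On \<open>V\<close> every derivative within \<open>W\<close> agrees with the directional
  derivatives. They can replace the existential witness, so that no choice of derivative
  remains.\<close>

lemma Ck_on_Suc_iff:
  assumes "subspace V" "openin (top_of_set V) W"
  shows "Ck_on (Suc k) V W f \<longleftrightarrow>
    (\<forall>x\<in>W. f differentiable (at x within W)) \<and> (\<forall>v\<in>V. Ck_on k V W (dir_deriv v f))"
    (is "?L \<longleftrightarrow> ?R")
proof -
  have cong: "Ck_on k V W f \<longleftrightarrow> Ck_on k V W g" if "\<And>x. x \<in> W \<Longrightarrow> f x = g x"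
    for k and f g :: "'a \<Rightarrow> 'b"
  proof -
    have "Ck_on k V W g" if "Ck_on k V W f" "\<And>x. x \<in> W \<Longrightarrow> f x = g x"
      for f g :: "'a \<Rightarrow> 'b"
    proof (cases k)
      case 0
      then show ?thesis using that continuous_on_cong[of W W f g] by auto
    next
      case (Suc n)
      have "(g has_derivative f') (at x within W)"
        if "(f has_derivative f') (at x within W)" "x \<in> W" for f' x
        using has_derivative_transform[of x W g f f'] that \<open>\<And>x. x \<in> W \<Longrightarrow> f x = g x\<close> by auto
      then show ?thesis using that(1) Suc by fastforce
    qed
    then show ?thesis using that by (metis (no_types, lifting))
  qed
  show ?thesis
  proof
    assume ?L
    then obtain f' where f': "\<forall>x\<in>W. (f has_derivative f' x) (at x within W)"
      "\<forall>v\<in>V. Ck_on k V W (\<lambda>x. f' x v)" by auto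
    have "Ck_on k V W (dir_deriv v f)" if "v \<in> V" for v
      using cong[of "dir_deriv v f" "\<lambda>x. f' x v" k] dir_deriv_eq[OF assms] f' that by blast
    then show ?R using f' by (auto simp: differentiable_def)
  next
    assume R: ?R
    then have "\<forall>x\<in>W. \<exists>D. (f has_derivative D) (at x within W)"
      by (auto simp: differentiable_def)
    then obtain f' where f': "\<forall>x\<in>W. (f has_derivative f' x) (at x within W)" by metis
    have "Ck_on k V W (\<lambda>x. f' x v)" if "v \<in> V" for v
      using cong[of "dir_deriv v f" "\<lambda>x. f' x v" k] dir_deriv_eq[OF assms] f' that R by blast
    with f' show ?L by auto
  qed
qed

lemma Ck_on_cong:
  assumes "Ck_on k V W f" "\<And>x. x \<in> W \<Longrightarrow> f x = g x"
  shows "Ck_on k V W g"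
proof (cases k)
  case 0
  then show ?thesis using assms continuous_on_cong[of W W f g] by auto
next
  case (Suc n)
  have "(g has_derivative f') (at x within W)"
    if "(f has_derivative f') (at x within W)" "x \<in> W" for f' x
    using has_derivative_transform[of x W g f f'] that assms by auto
  then show ?thesis using assms(1) Suc by fastforce
qed

lemma Ck_on_SucD: "Ck_on (Suc k) V W f \<Longrightarrow> Ck_on k V W f"
proof (induction k arbitrary: f)
  case 0
  then obtain f' where "\<forall>x\<in>W. (f has_derivative f' x) (at x within W)" by auto
  then show ?case
    using has_derivative_continuous_on[of W f f'] by simp
next
  case (Suc k)
  then obtain f' where "\<forall>x\<in>W. (f has_derivative f' x) (at x within W)"
      "\<forall>v\<in>V. Ck_on (Suc k) V W (\<lambda>x. f' x v)" by auto
  with Suc.IH show ?case by (auto intro!: exI[of _ f'])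
qed

lemma Ck_on_subset: "Ck_on k V W f \<Longrightarrow> W' \<subseteq> W \<Longrightarrow> Ck_on k V W' f"
proof (induction k arbitrary: f)
  case 0
  then show ?case by (auto intro: continuous_on_subset)
next
  case (Suc k)
  then obtain f' where f': "\<forall>x\<in>W. (f has_derivative f' x) (at x within W)"
      "\<forall>v\<in>V. Ck_on k V W (\<lambda>x. f' x v)" by auto
  have "\<forall>x\<in>W'. (f has_derivative f' x) (at x within W')"
    using f'(1) Suc.prems(2) by (meson has_derivative_subset subset_iff)
  with f'(2) Suc.IH Suc.prems(2) show ?case by (auto intro!: exI[of _ f'])
qed

lemma Ck_on_const: "Ck_on k V W (\<lambda>x. c)"
proof (induction k arbitrary: c)
  case (Suc k)
  show ?case using Suc by (auto intro!: exI[of _ "\<lambda>x v. 0"])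
qed auto

lemma Ck_on_add:
  "Ck_on k V W f \<Longrightarrow> Ck_on k V W g \<Longrightarrow> Ck_on k V W (\<lambda>x. f x + g x)"
proof (induction k arbitrary: f g)
  case 0
  then show ?case by (auto intro: continuous_intros)
next
  case (Suc k)
  obtain f' where f': "\<forall>x\<in>W. (f has_derivative f' x) (at x within W)"
      "\<forall>v\<in>V. Ck_on k V W (\<lambda>x. f' x v)" using Suc.prems by auto
  obtain g' where g': "\<forall>x\<in>W. (g has_derivative g' x) (at x within W)"
      "\<forall>v\<in>V. Ck_on k V W (\<lambda>x. g' x v)" using Suc.prems by auto
  show ?case using f' g' Suc.IH
    by (auto intro!: exI[of _ "\<lambda>x v. f' x v + g' x v"] has_derivative_add)
qed

lemma Ck_on_bounded_linear:
  assumes "bounded_linear h"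
  shows "Ck_on k V W f \<Longrightarrow> Ck_on k V W (\<lambda>x. h (f x))"
proof (induction k arbitrary: f)
  case 0
  then show ?case using assms by (auto intro: bounded_linear.continuous_on)
next
  case (Suc k)
  obtain f' where f': "\<forall>x\<in>W. (f has_derivative f' x) (at x within W)"
      "\<forall>v\<in>V. Ck_on k V W (\<lambda>x. f' x v)" using Suc.prems by auto
  show ?case using f' Suc.IH
    by (auto intro!: exI[of _ "\<lambda>x v. h (f' x v)"] bounded_linear.has_derivative[OF assms])
qed

lemma Ck_on_bounded_bilinear:
  assumes "bounded_bilinear h"
  shows "Ck_on k V W f \<Longrightarrow> Ck_on k V W g \<Longrightarrow> Ck_on k V W (\<lambda>x. h (f x) (g x))"
proof (induction k arbitrary: f g)
  case 0
  then show ?case using assms by (auto intro: bounded_bilinear.continuous_on)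
next
  case (Suc k)
  obtain f' where f': "\<forall>x\<in>W. (f has_derivative f' x) (at x within W)"
      "\<forall>v\<in>V. Ck_on k V W (\<lambda>x. f' x v)" using Suc.prems by auto
  obtain g' where g': "\<forall>x\<in>W. (g has_derivative g' x) (at x within W)"
      "\<forall>v\<in>V. Ck_on k V W (\<lambda>x. g' x v)" using Suc.prems by auto
  show ?case using f' g' Suc.IH Ck_on_SucD[OF Suc.prems(1)] Ck_on_SucD[OF Suc.prems(2)]
    by (auto intro!: exI[of _ "\<lambda>x v. h (f x) (g' x v) + h (f' x v) (g x)"]
        bounded_bilinear.FDERIV[OF assms] Ck_on_add)
qed

lemmas Ck_on_mult = Ck_on_bounded_bilinear[OF bounded_bilinear_mult]
lemmas Ck_on_scaleR = Ck_on_bounded_bilinear[OF bounded_bilinear_scaleR]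

lemma Ck_on_sum:
  "(\<And>i. i \<in> I \<Longrightarrow> Ck_on k V W (f i)) \<Longrightarrow> Ck_on k V W (\<lambda>x. \<Sum>i\<in>I. f i x)"
  by (induction I rule: infinite_finite_induct) (simp_all add: Ck_on_const Ck_on_add)

lemma Ck_on_id: "Ck_on k V W (\<lambda>x. x)"
proof (cases k)
  case (Suc n)
  then show ?thesis by (auto intro!: exI[of _ "\<lambda>x v. v"] Ck_on_const)
qed auto

lemma Ck_on_inverse:
  fixes u :: "'e::euclidean_space \<Rightarrow> 'b::real_normed_field"
  shows "Ck_on k V W u \<Longrightarrow> \<forall>x\<in>W. u x \<noteq> 0 \<Longrightarrow> Ck_on k V W (\<lambda>x. inverse (u x))"
proof (induction k)
  case 0
  then show ?case by (auto intro: continuous_intros)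
next
  case (Suc k)
  obtain f' where f': "\<forall>x\<in>W. (u has_derivative f' x) (at x within W)"
      "\<forall>v\<in>V. Ck_on k V W (\<lambda>x. f' x v)" using Suc.prems by auto
  have I: "Ck_on k V W (\<lambda>x. inverse (u x))"
    using Suc.IH Ck_on_SucD Suc.prems by blast
  have "\<forall>v\<in>V. Ck_on k V W (\<lambda>x. - (inverse (u x) * f' x v * inverse (u x)))"
    using f'(2) I by (auto intro!: Ck_on_mult Ck_on_bounded_linear[OF bounded_linear_minus[OF bounded_linear_ident]])
  then show ?case using f'(1) Suc.prems(2)
    by (auto intro!: exI[of _ "\<lambda>x v. - (inverse (u x) * f' x v * inverse (u x))"] has_derivative_inverse)
qed

text \<open>Derivatives chosen on different neighbourhoods could disagree off \<open>V\<close>.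
  Directional derivatives are one function on all of \<open>W\<close>, and the induction runs
  through that function.\<close>

lemma Ck_on_locally:
  assumes "subspace V" "openin (top_of_set V) W"
    and "\<And>x. x \<in> W \<Longrightarrow> \<exists>W'. openin (top_of_set V) W' \<and> x \<in> W' \<and> W' \<subseteq> W \<and> Ck_on k V W' f"
  shows "Ck_on k V W f"
  using assms(3)
proof (induction k arbitrary: f)
  case 0
  have "continuous (at x within W) f" if x: "x \<in> W" for x
  proof -
    obtain W' where W': "openin (top_of_set V) W'" "x \<in> W'" "W' \<subseteq> W" "continuous_on W' f"
      using 0[OF x] by auto
    have "openin (top_of_set W) W'"
      using W'(1,3) assms(2) by (metis openin_subset_trans openin_imp_subset)
    then have "at x within W' = at x within W"
      using W'(2) by (rule at_within_relatively_open)
    moreover have "continuous (at x within W') f"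
      using W'(2,4) by (simp add: continuous_on_eq_continuous_within)
    ultimately show ?thesis by simp
  qed
  then show ?case by (simp add: continuous_on_eq_continuous_within)
next
  case (Suc k)
  have *: "f differentiable (at x within W)" if x: "x \<in> W" for x
  proof -
    from Suc.prems[OF x] obtain W' where
      W': "openin (top_of_set V) W'" "x \<in> W'" "W' \<subseteq> W" "Ck_on (Suc k) V W' f"
      by (elim exE conjE) (rule that)
    have "openin (top_of_set W) W'"
      using W'(1,3) assms(2) by (metis openin_subset_trans openin_imp_subset)
    then have "at x within W' = at x within W"
      using W'(2) by (rule at_within_relatively_open)
    moreover have "f differentiable (at x within W')"
      using W'(2,4) by (auto simp: differentiable_def)
    ultimately show ?thesis by simp
  qed
  have "Ck_on k V W (dir_deriv v f)" if v: "v \<in> V" for v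
  proof (rule Suc.IH)
    fix x assume x: "x \<in> W"
    from Suc.prems[OF x] obtain W' where
      W': "openin (top_of_set V) W'" "x \<in> W'" "W' \<subseteq> W" "Ck_on (Suc k) V W' f"
      by (elim exE conjE) (rule that)
    have "Ck_on k V W' (dir_deriv v f)"
      using iffD1[OF Ck_on_Suc_iff[OF assms(1) W'(1)] W'(4)] v by blast
    with W' show "\<exists>W'. openin (top_of_set V) W' \<and> x \<in> W' \<and> W' \<subseteq> W \<and> Ck_on k V W' (dir_deriv v f)"
      by blast
  qed
  with * show ?case by (intro iffD2[OF Ck_on_Suc_iff[OF assms(1,2)]]) auto
qed

section \<open>Maps between subspaces and the chain rule\<close>

lemma orthonormal_expansion_subspace:
  fixes V :: "'e::euclidean_space set"
  assumes "subspace V"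
  obtains B where "finite B" "B \<subseteq> V" "\<And>x y. x \<in> B \<Longrightarrow> y \<in> B \<Longrightarrow> x \<bullet> y = (if x = y then 1 else 0)"
    "\<And>x. x \<in> V \<Longrightarrow> x = (\<Sum>e\<in>B. (x \<bullet> e) *\<^sub>R e)"
proof -
  obtain B where B: "B \<subseteq> V" "pairwise orthogonal B" "\<And>x. x \<in> B \<Longrightarrow> norm x = 1"
     "independent B" "card B = dim V" "span B = V"
    using orthonormal_basis_subspace[OF assms] by blast
  have fin: "finite B" using B(4) by (rule independent_imp_finite)
  have on: "x \<bullet> y = (if x = y then 1 else 0)" if "x \<in> B" "y \<in> B" for x y
    using B(2,3) that by (auto simp: pairwise_def orthogonal_def norm_eq_1)
  have "x = (\<Sum>e\<in>B. (x \<bullet> e) *\<^sub>R e)" if "x \<in> V" for x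
  proof -
    have "x \<in> range (\<lambda>c. \<Sum>e\<in>B. c e *\<^sub>R e)"
      using that B(6) span_finite[OF fin] by simp
    then obtain c where c: "x = (\<Sum>e\<in>B. c e *\<^sub>R e)"
      by (rule rangeE)
    have "x \<bullet> e = c e" if "e \<in> B" for e
    proof -
      have "x \<bullet> e = (\<Sum>e'\<in>B. c e' * (e' \<bullet> e))" by (simp add: c inner_sum_left)
      also have "\<dots> = (\<Sum>e'\<in>B. if e' = e then c e' else 0)"
        using on that by (intro sum.cong) auto
      finally show ?thesis using fin that by simp
    qed
    then have "(\<Sum>e\<in>B. (x \<bullet> e) *\<^sub>R e) = (\<Sum>e\<in>B. c e *\<^sub>R e)"
      by (intro sum.cong) auto
    then show ?thesis by (metis c)
  qed
  with fin B(1) on show ?thesis by (rule that)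
qed

text \<open>The orthogonal projection onto \<open>V'\<close> fixes the values of \<open>g\<close> on
  \<open>W\<close>. Composed with \<open>g'\<close> it gives another derivative of \<open>g\<close>,
  and uniqueness on \<open>V\<close> places \<open>g' v\<close> in \<open>V'\<close>.\<close>

lemma derivative_in_subspace:
  fixes g :: "'e::euclidean_space \<Rightarrow> 'f::euclidean_space"
  assumes "subspace V" "openin (top_of_set V) W" "subspace V'" "g ` W \<subseteq> V'"
    and "x \<in> W" "v \<in> V" "(g has_derivative g') (at x within W)"
  shows "g' v \<in> V'"
proof -
  obtain B where B: "finite B" "B \<subseteq> V'" "\<And>x. x \<in> V' \<Longrightarrow> x = (\<Sum>e\<in>B. (x \<bullet> e) *\<^sub>R e)"
    using orthonormal_expansion_subspace[OF assms(3)] by metis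
  define pr where "pr = (\<lambda>x. \<Sum>e\<in>B. (x \<bullet> e) *\<^sub>R e)"
  have pr: "bounded_linear pr" unfolding pr_def
    by (intro bounded_linear_sum bounded_linear_scaleR_left[THEN bounded_linear_compose] bounded_linear_inner_left)
  have "((\<lambda>y. pr (g y)) has_derivative (\<lambda>v. pr (g' v))) (at x within W)"
    by (rule bounded_linear.has_derivative[OF pr assms(7)])
  moreover have "pr (g y) = g y" if "y \<in> W" for y
    using B(3)[of "g y"] assms(4) that by (auto simp: pr_def)
  ultimately have "(g has_derivative (\<lambda>v. pr (g' v))) (at x within W)"
    using has_derivative_transform[of x W g "\<lambda>y. pr (g y)"] assms(5) by auto
  then have "g' v = pr (g' v)"
    using dir_deriv_eq[OF assms(1,2,5,6)] assms(7) by metis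
  moreover have "pr y \<in> V'" for y
    unfolding pr_def using B(2) assms(3) by (auto intro!: subspace_sum subspace_mul)
  ultimately show ?thesis by metis
qed

text \<open>In the chain rule the direction \<open>g' x v\<close> varies with \<open>x\<close>.
  Expanding it in an orthonormal basis of \<open>V'\<close> turns the derivative into a finite sum
  of products, with derivatives of \<open>f\<close> in fixed directions to which the induction
  applies.\<close>

lemma Ck_on_compose:
  fixes g :: "'e::euclidean_space \<Rightarrow> 'f::euclidean_space"
  assumes "subspace V" "openin (top_of_set V) W" "subspace V'" "W' \<subseteq> V'" "g ` W \<subseteq> W'"
  shows "Ck_on k V W g \<Longrightarrow> Ck_on k V' W' f \<Longrightarrow> Ck_on k V W (f \<circ> g)"
proof (induction k arbitrary: f)
  case 0
  then show ?case using assms(5) continuous_on_compose[of W g f] continuous_on_subset[of W' f "g ` W"]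
    by simp
next
  case (Suc k)
  obtain f' where f': "\<forall>x\<in>W'. (f has_derivative f' x) (at x within W')"
      "\<forall>v\<in>V'. Ck_on k V' W' (\<lambda>x. f' x v)" using Suc.prems by auto
  obtain g' where g': "\<forall>x\<in>W. (g has_derivative g' x) (at x within W)"
      "\<forall>v\<in>V. Ck_on k V W (\<lambda>x. g' x v)" using Suc.prems by auto
  have gk: "Ck_on k V W g" using Suc.prems Ck_on_SucD by blast
  obtain B where B: "finite B" "B \<subseteq> V'" "\<And>x. x \<in> V' \<Longrightarrow> x = (\<Sum>e\<in>B. (x \<bullet> e) *\<^sub>R e)"
    using orthonormal_expansion_subspace[OF assms(3)] by metis
  have der: "((f \<circ> g) has_derivative (\<lambda>v. f' (g x) (g' x v))) (at x within W)" if "x \<in> W" for x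
  proof -
    have "(f has_derivative f' (g x)) (at (g x) within g ` W)"
      using f'(1) assms(5) that by (intro has_derivative_subset[OF _ assms(5)]) auto
    then show ?thesis
      unfolding comp_def using g'(1) that by (metis has_derivative_in_compose)
  qed
  have "Ck_on k V W (\<lambda>x. f' (g x) (g' x v))" if v: "v \<in> V" for v
  proof (rule Ck_on_cong)
    show "Ck_on k V W (\<lambda>x. \<Sum>e\<in>B. (g' x v \<bullet> e) *\<^sub>R ((\<lambda>y. f' y e) \<circ> g) x)"
      using g'(2) v f'(2) B(2) Suc.IH[OF gk]
      by (intro Ck_on_sum Ck_on_scaleR Ck_on_bounded_linear[OF bounded_linear_inner_left]) auto
    fix x assume x: "x \<in> W"
    have "g' x v \<in> V'"
      using derivative_in_subspace[OF assms(1,2,3) _ x v] g'(1) assms(4,5) x by blast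
    then have "g' x v = (\<Sum>e\<in>B. (g' x v \<bullet> e) *\<^sub>R e)" by (rule B(3))
    moreover have "linear (f' (g x))"
      using f'(1) assms(5) x has_derivative_linear by blast
    then have "f' (g x) (\<Sum>e\<in>B. (g' x v \<bullet> e) *\<^sub>R e) = (\<Sum>e\<in>B. (g' x v \<bullet> e) *\<^sub>R f' (g x) e)"
      by (simp add: linear_scale linear_sum)
    ultimately have "f' (g x) (g' x v) = (\<Sum>e\<in>B. (g' x v \<bullet> e) *\<^sub>R f' (g x) e)"
      by (rule ssubst[where P="\<lambda>z. f' (g x) z = _"])
    then show "(\<Sum>e\<in>B. (g' x v \<bullet> e) *\<^sub>R ((\<lambda>y. f' y e) \<circ> g) x) = f' (g x) (g' x v)"
      by simp
  qed
  with der show ?case by (auto simp del: comp_apply intro!: exI[of _ "\<lambda>x v. f' (g x) (g' x v)"])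
qed

section \<open>Rules for smooth functions\<close>

lemma smooth_on_dir_deriv:
  assumes "subspace V" "openin (top_of_set V) W" "smooth_on V W f" "v \<in> V"
  shows "smooth_on V W (dir_deriv v f)"
proof -
  have "Ck_on k V W (dir_deriv v f)" for k
  proof -
    have "Ck_on (Suc k) V W f" using assms(3) unfolding smooth_on_def by blast
    then show ?thesis using iffD1[OF Ck_on_Suc_iff[OF assms(1,2)]] assms(4) by blast
  qed
  then show ?thesis by (simp add: smooth_on_def)
qed

lemma smooth_on_has_derivative:
  assumes "smooth_on V W f" "x \<in> W"
  obtains f' where "(f has_derivative f') (at x within W)"
proof -
  have "Ck_on (Suc 0) V W f" using assms(1) by (simp only: smooth_on_def)
  with assms(2) show ?thesis using that by auto
qed

lemma smooth_on_cong:
  "smooth_on V W f \<Longrightarrow> (\<And>x. x \<in> W \<Longrightarrow> f x = g x) \<Longrightarrow> smooth_on V W g"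
  unfolding smooth_on_def by (metis Ck_on_cong)

lemma smooth_on_subset: "smooth_on V W f \<Longrightarrow> W' \<subseteq> W \<Longrightarrow> smooth_on V W' f"
  unfolding smooth_on_def by (metis Ck_on_subset)

lemma smooth_on_const: "smooth_on V W (\<lambda>x. c)"
  unfolding smooth_on_def using Ck_on_const by blast

lemma smooth_on_id: "smooth_on V W (\<lambda>x. x)"
  unfolding smooth_on_def using Ck_on_id by blast

lemma smooth_on_add:
  "smooth_on V W f \<Longrightarrow> smooth_on V W g \<Longrightarrow> smooth_on V W (\<lambda>x. f x + g x)"
  unfolding smooth_on_def using Ck_on_add by blast

lemma smooth_on_bounded_linear:
  "bounded_linear h \<Longrightarrow> smooth_on V W f \<Longrightarrow> smooth_on V W (\<lambda>x. h (f x))"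
  unfolding smooth_on_def by (simp add: Ck_on_bounded_linear)

lemma smooth_on_bounded_bilinear:
  "bounded_bilinear h \<Longrightarrow> smooth_on V W f \<Longrightarrow> smooth_on V W g \<Longrightarrow> smooth_on V W (\<lambda>x. h (f x) (g x))"
  unfolding smooth_on_def by (simp add: Ck_on_bounded_bilinear)

lemmas smooth_on_mult = smooth_on_bounded_bilinear[OF bounded_bilinear_mult]

lemma smooth_on_inverse:
  fixes u :: "'e::euclidean_space \<Rightarrow> 'b::real_normed_field"
  shows "smooth_on V W u \<Longrightarrow> \<forall>x\<in>W. u x \<noteq> 0 \<Longrightarrow> smooth_on V W (\<lambda>x. inverse (u x))"
  unfolding smooth_on_def by (simp add: Ck_on_inverse)

lemma smooth_on_locally:
  assumes "subspace V" "openin (top_of_set V) W"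
    and "\<And>x. x \<in> W \<Longrightarrow> \<exists>W'. openin (top_of_set V) W' \<and> x \<in> W' \<and> W' \<subseteq> W \<and> smooth_on V W' f"
  shows "smooth_on V W f"
  unfolding smooth_on_def
proof
  fix k
  show "Ck_on k V W f"
  proof (rule Ck_on_locally[OF assms(1,2)])
    fix x assume "x \<in> W"
    from assms(3)[OF this] show "\<exists>W'. openin (top_of_set V) W' \<and> x \<in> W' \<and> W' \<subseteq> W \<and> Ck_on k V W' f"
      unfolding smooth_on_def by (elim exE conjE) (intro exI conjI, assumption+, rule spec)
  qed
qed

lemma smooth_on_compose:
  fixes g :: "'e::euclidean_space \<Rightarrow> 'f::euclidean_space"
  assumes "subspace V" "openin (top_of_set V) W" "subspace V'" "W' \<subseteq> V'" "g ` W \<subseteq> W'"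
    and "smooth_on V W g" "smooth_on V' W' f"
  shows "smooth_on V W (f \<circ> g)"
  using Ck_on_compose[OF assms(1-5)] assms(6,7) unfolding smooth_on_def by blast

section \<open>Smooth cutoff functions\<close>

text \<open>The polynomial factor in \<open>1 / t\<close> makes this family of flat functions closed
  under differentiation, which is what the induction on the degree of smoothness needs.\<close>

definition flat_poly :: "real poly \<Rightarrow> real \<Rightarrow> real" where
  "flat_poly q t = (if t > 0 then poly q (1 / t) * exp (- (1 / t)) else 0)"

lemma poly_times_exp_tendsto_0: "((\<lambda>s. poly q s * exp (- s)) \<longlongrightarrow> (0::real)) at_top"
proof -
  have "((\<lambda>s. \<Sum>i\<le>degree q. coeff q i * (s ^ i / exp s)) \<longlongrightarrow> (\<Sum>i\<le>degree q. coeff q i * 0)) at_top"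
    by (intro tendsto_sum tendsto_mult tendsto_const tendsto_power_div_exp_0)
  then show ?thesis
    by (simp add: poly_altdef sum_distrib_right sum_divide_distrib exp_minus field_simps)
qed

lemma flat_poly_tendsto_0: "(flat_poly q \<longlongrightarrow> 0) (at 0)"
proof (rule filterlim_split_at)
  have "(flat_poly q \<longlongrightarrow> 0) (at_left 0) \<longleftrightarrow> ((\<lambda>t. 0) \<longlongrightarrow> (0::real)) (at_left (0::real))"
    by (intro tendsto_cong) (auto simp: flat_poly_def eventually_at_filter)
  then show "(flat_poly q \<longlongrightarrow> 0) (at_left 0)" by simp
  have "((\<lambda>t. flat_poly q (inverse t)) \<longlongrightarrow> 0) at_top \<longleftrightarrow> ((\<lambda>s. poly q s * exp (- s)) \<longlongrightarrow> 0) at_top"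
    by (intro tendsto_cong eventually_mono[OF eventually_gt_at_top[of 0]])
      (auto simp: flat_poly_def field_simps)
  then show "(flat_poly q \<longlongrightarrow> 0) (at_right 0)"
    unfolding filterlim_at_right_to_top using poly_times_exp_tendsto_0 by blast
qed

text \<open>With \<open>s = 1 / t\<close> the derivative of \<open>q(s) exp(-s)\<close> in
  \<open>t\<close> is \<open>s\<^sup>2 (q(s) - q'(s)) exp(-s)\<close>, and
  \<open>[:0, 0, 1:]\<close> is the polynomial \<open>s\<^sup>2\<close>.\<close>

lemma flat_poly_derivative:
  "(flat_poly q has_field_derivative flat_poly ([:0, 0, 1:] * (q - pderiv q)) t) (at t)"
proof -
  consider "t > 0" | "t < 0" | "t = 0" by linarith
  then show ?thesis
  proof cases
    case 1
    have "((\<lambda>t. poly q (1 / t) * exp (- (1 / t))) has_field_derivative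
        flat_poly ([:0, 0, 1:] * (q - pderiv q)) t) (at t)"
      using 1 by (auto intro!: derivative_eq_intros DERIV_chain2[OF poly_DERIV]
          simp: flat_poly_def field_simps power2_eq_square)
    then show ?thesis
      by (rule has_field_derivative_transform_within_open[where S = "{0<..}"])
        (use 1 in \<open>auto simp: flat_poly_def\<close>)
  next
    case 2
    have "((\<lambda>t. 0) has_field_derivative flat_poly ([:0, 0, 1:] * (q - pderiv q)) t) (at t)"
      using 2 by (auto simp: flat_poly_def)
    then show ?thesis
      by (rule has_field_derivative_transform_within_open[where S = "{..<0}"])
        (use 2 in \<open>auto simp: flat_poly_def\<close>)
  next
    case 3
    \<comment> \<open>At 0 the difference quotient belongs to the family again, now with the
      polynomial \<open>s q(s)\<close>, so its limit is known.\<close>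
    have "(\<lambda>h. (flat_poly q (0 + h) - flat_poly q 0) / h) = flat_poly (pCons 0 q)"
      by (auto simp: flat_poly_def fun_eq_iff)
    then show ?thesis
      using flat_poly_tendsto_0[of "pCons 0 q"] 3 by (simp add: DERIV_def flat_poly_def)
  qed
qed

lemma smooth_on_flat_poly: "smooth_on UNIV UNIV (flat_poly q)"
proof -
  have "Ck_on k UNIV UNIV (flat_poly q)" for k
  proof (induction k arbitrary: q)
    case 0
    then show ?case
      using DERIV_isCont[OF flat_poly_derivative] by (auto intro!: continuous_at_imp_continuous_on)
  next
    case (Suc k)
    have "Ck_on k UNIV UNIV (\<lambda>x. flat_poly ([:0, 0, 1:] * (q - pderiv q)) x * v)" for v
      by (intro Ck_on_mult Suc.IH Ck_on_const)
    then show ?case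
      using flat_poly_derivative[of q, unfolded has_field_derivative_def]
      by (auto intro!: exI[of _ "\<lambda>x v. flat_poly ([:0, 0, 1:] * (q - pderiv q)) x * v"]
          simp del: mult_pCons_left)
  qed
  then show ?thesis by (simp add: smooth_on_def)
qed

text \<open>The values are 1 up to \<open>t = 1\<close> and 0 from \<open>t = 2\<close> on. The two
  flat functions in the denominator never vanish together.\<close>

definition smooth_step :: "real \<Rightarrow> real" where
  "smooth_step t = flat_poly 1 (2 - t) * inverse (flat_poly 1 (2 - t) + flat_poly 1 (t - 1))"

lemma flat_poly_1: "flat_poly 1 t \<ge> 0" "flat_poly 1 t = 0 \<longleftrightarrow> t \<le> 0"
  by (auto simp: flat_poly_def)

lemma smooth_step_denominator: "flat_poly 1 (2 - t) + flat_poly 1 (t - 1) > 0"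
  using flat_poly_1[of "2 - t"] flat_poly_1[of "t - 1"] by (cases "t < 2") (auto simp: less_le)

lemma smooth_on_smooth_step: "smooth_on UNIV UNIV smooth_step"
proof -
  have affine: "smooth_on UNIV UNIV (flat_poly 1 \<circ> (\<lambda>t. a + b * t))" for a b
    by (intro smooth_on_compose[where V' = UNIV and W' = UNIV] smooth_on_flat_poly smooth_on_add
        smooth_on_const smooth_on_mult smooth_on_id) auto
  have "smooth_on UNIV UNIV (\<lambda>t. flat_poly 1 (2 - t))" "smooth_on UNIV UNIV (\<lambda>t. flat_poly 1 (t - 1))"
    using affine[of 2 "-1"] affine[of "-1" 1] by (simp_all add: comp_def)
  moreover have "\<forall>t\<in>UNIV. flat_poly 1 (2 - t) + flat_poly 1 (t - 1) \<noteq> 0"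
    using smooth_step_denominator by (metis less_irrefl)
  ultimately show ?thesis
    unfolding smooth_step_def[abs_def]
    by (intro smooth_on_mult smooth_on_inverse smooth_on_add)
qed

lemma smooth_step_simps:
  "t \<le> 1 \<Longrightarrow> smooth_step t = 1" "t \<ge> 2 \<Longrightarrow> smooth_step t = 0" "0 \<le> smooth_step t" "smooth_step t \<le> 1"
proof -
  have pos: "flat_poly 1 (2 - t) + flat_poly 1 (t - 1) > 0" by (rule smooth_step_denominator)
  show "0 \<le> smooth_step t" "smooth_step t \<le> 1"
    using pos flat_poly_1(1)[of "2 - t"] flat_poly_1(1)[of "t - 1"]
    by (simp_all add: smooth_step_def field_simps)
  show "smooth_step t = 1" if "t \<le> 1"
  proof -
    have "flat_poly 1 (t - 1) = 0" "flat_poly 1 (2 - t) \<noteq> 0" using that flat_poly_1(2) by simp_all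
    then show ?thesis by (simp add: smooth_step_def)
  qed
  show "smooth_step t = 0" if "t \<ge> 2"
    using that flat_poly_1(2)[of "2 - t"] by (simp add: smooth_step_def)
qed

text \<open>The squared distance is smooth at the centre. Scaled by \<open>2 / r\<^sup>2\<close> it
  is at most 1/2 up to distance \<open>r / 2\<close> and at least 2 from distance \<open>r\<close>
  on, where \<open>smooth_step\<close> is constant.\<close>

definition bump :: "'e::euclidean_space \<Rightarrow> real \<Rightarrow> 'e \<Rightarrow> real" where
  "bump c r y = smooth_step (2 / r\<^sup>2 * ((y - c) \<bullet> (y - c)))"

lemma smooth_on_bump:
  assumes "subspace V" "openin (top_of_set V) W"
  shows "smooth_on V W (bump c r)"
proof -
  have d: "smooth_on V W (\<lambda>y. y - c)"
    using smooth_on_add[OF smooth_on_id smooth_on_const[of _ _ "- c"]] by simp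
  have "smooth_on V W (\<lambda>y. 2 / r\<^sup>2 * ((y - c) \<bullet> (y - c)))"
    by (intro smooth_on_mult smooth_on_const smooth_on_bounded_bilinear[OF bounded_bilinear_inner] d)
  then have "smooth_on V W (smooth_step \<circ> (\<lambda>y. 2 / r\<^sup>2 * ((y - c) \<bullet> (y - c))))"
    by (intro smooth_on_compose[where V' = UNIV and W' = UNIV] assms smooth_on_smooth_step) auto
  then show ?thesis by (simp add: comp_def bump_def[abs_def])
qed

lemma bump_simps:
  assumes "r > 0"
  shows "dist c y \<le> r / 2 \<Longrightarrow> bump c r y = 1" "dist c y \<ge> r \<Longrightarrow> bump c r y = 0"
    "0 \<le> bump c r y" "bump c r y \<le> 1"
proof -
  have eq: "2 / r\<^sup>2 * ((y - c) \<bullet> (y - c)) = 2 * (dist c y / r)\<^sup>2"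
    by (simp add: dist_norm norm_minus_commute power2_norm_eq_inner[symmetric] power_divide)
  show "bump c r y = 1" if "dist c y \<le> r / 2"
  proof -
    have "dist c y / r \<le> 1 / 2" using that assms by (simp add: field_simps)
    then have "(dist c y / r)\<^sup>2 \<le> (1 / 2)\<^sup>2" using assms by (intro power_mono) auto
    also have "(1 / 2 :: real)\<^sup>2 = 1 / 4" by (simp add: power2_eq_square)
    finally have "2 * (dist c y / r)\<^sup>2 \<le> 1" by linarith
    then show ?thesis unfolding bump_def eq by (rule smooth_step_simps(1))
  qed
  show "bump c r y = 0" if "dist c y \<ge> r"
  proof -
    have "1 \<le> dist c y / r" using that assms by (simp add: field_simps)
    then have "1\<^sup>2 \<le> (dist c y / r)\<^sup>2" by (intro power_mono) auto
    then show ?thesis unfolding bump_def eq by (intro smooth_step_simps(2)) simp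
  qed
qed (simp_all add: bump_def smooth_step_simps)

section \<open>Smooth functions on a manifold\<close>

locale smooth_manifold_locale =
  fixes M :: "('a::{t2_space, second_countable_topology}, 'e::euclidean_space) manifold"
  assumes manifold: "smooth_manifold M"
begin

abbreviation "V \<equiv> model M"
abbreviation "S \<equiv> smooth_functions M"

lemma subspace_V: "subspace V"
  using manifold by (simp add: smooth_manifold_def)

lemma chart_exists: obtains U \<phi> where "(U, \<phi>) \<in> charts M" "z \<in> U"
  using manifold by (force simp: smooth_manifold_def)

lemma chart:
  assumes "(U, \<phi>) \<in> charts M"
  shows "open U" "openin (top_of_set V) (\<phi> ` U)" "homeomorphism U (\<phi> ` U) \<phi> (inv_into U \<phi>)"
  using manifold assms by (auto simp: smooth_manifold_def)

lemma chart_inj: "(U, \<phi>) \<in> charts M \<Longrightarrow> z \<in> U \<Longrightarrow> inv_into U \<phi> (\<phi> z) = z"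
  using chart(3) by (auto simp: homeomorphism_def)

lemma chart_open_image:
  assumes "(U, \<phi>) \<in> charts M" "open O'" "O' \<subseteq> U"
  shows "openin (top_of_set V) (\<phi> ` O')"
proof -
  have "openin (top_of_set U) O'" using assms(2,3) by (simp add: openin_open_eq chart(1)[OF assms(1)])
  then have "openin (top_of_set (\<phi> ` U)) (\<phi> ` O')"
    using homeomorphism_imp_open_map[OF chart(3)[OF assms(1)]] by simp
  then show ?thesis using chart(2)[OF assms(1)] openin_trans by blast
qed

lemma transition:
  assumes "(U, \<phi>) \<in> charts M" "(W, \<psi>) \<in> charts M"
  shows "smooth_on V (\<phi> ` (U \<inter> W)) (\<psi> \<circ> inv_into U \<phi>)"
  using manifold assms by (fastforce simp: smooth_manifold_def)

lemma smooth_functionsD: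
  "f \<in> S \<Longrightarrow> (U, \<phi>) \<in> charts M \<Longrightarrow> smooth_on V (\<phi> ` U) (f \<circ> inv_into U \<phi>)"
  by (auto simp: smooth_functions_def)

lemma smooth_functions_locallyI:
  assumes "\<And>U \<phi> z. (U, \<phi>) \<in> charts M \<Longrightarrow> z \<in> U \<Longrightarrow>
    \<exists>N. open N \<and> z \<in> N \<and> N \<subseteq> U \<and> smooth_on V (\<phi> ` N) (f \<circ> inv_into U \<phi>)"
  shows "f \<in> S"
  unfolding smooth_functions_def
proof (clarify)
  fix U \<phi> assume U: "(U, \<phi>) \<in> charts M"
  show "smooth_on V (\<phi> ` U) (f \<circ> inv_into U \<phi>)"
  proof (rule smooth_on_locally[OF subspace_V chart(2)[OF U]])
    fix y assume "y \<in> \<phi> ` U"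
    then obtain z where z: "z \<in> U" "y = \<phi> z" by blast
    obtain N where "open N" "z \<in> N" "N \<subseteq> U" "smooth_on V (\<phi> ` N) (f \<circ> inv_into U \<phi>)"
      using assms[OF U z(1)] by blast
    then show "\<exists>W'. openin (top_of_set V) W' \<and> y \<in> W' \<and> W' \<subseteq> \<phi> ` U \<and> smooth_on V W' (f \<circ> inv_into U \<phi>)"
      using chart_open_image[OF U] z by (intro exI[of _ "\<phi> ` N"]) auto
  qed
qed

lemma smooth_functions_locally:
  assumes "\<And>z. \<exists>g\<in>S. \<exists>N. open N \<and> z \<in> N \<and> (\<forall>y\<in>N. f y = g y)"
  shows "f \<in> S"
proof (rule smooth_functions_locallyI)
  fix U \<phi> z assume U: "(U, \<phi>) \<in> charts M" "z \<in> U"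
  obtain g N where g: "g \<in> S" "open N" "z \<in> N" "\<And>y. y \<in> N \<Longrightarrow> f y = g y"
    using assms by blast
  have "smooth_on V (\<phi> ` (N \<inter> U)) (f \<circ> inv_into U \<phi>)"
    by (rule smooth_on_cong[OF smooth_on_subset[OF smooth_functionsD[OF g(1) U(1)]]])
      (auto simp: chart_inj[OF U(1)] g(4))
  then show "\<exists>N. open N \<and> z \<in> N \<and> N \<subseteq> U \<and> smooth_on V (\<phi> ` N) (f \<circ> inv_into U \<phi>)"
    using g U chart(1)[OF U(1)] by (intro exI[of _ "N \<inter> U"]) auto
qed

lemma function_algebra_smooth_functions: "function_algebra S"
proof -
  have "smooth_on V (\<phi> ` U) ((f + g) \<circ> inv_into U \<phi>)" "smooth_on V (\<phi> ` U) ((f * g) \<circ> inv_into U \<phi>)"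
    if "f \<in> S" "g \<in> S" "(U, \<phi>) \<in> charts M" for f g U \<phi>
    using smooth_on_add[OF smooth_functionsD[OF that(1,3)] smooth_functionsD[OF that(2,3)]]
      smooth_on_mult[OF smooth_functionsD[OF that(1,3)] smooth_functionsD[OF that(2,3)]]
    by (simp_all add: comp_def plus_fun_def times_fun_def)
  moreover have "smooth_on V (\<phi> ` U) ((\<lambda>_. c) \<circ> inv_into U \<phi>)" for c :: complex and U \<phi>
    using smooth_on_const by (simp add: comp_def)
  ultimately show ?thesis
    unfolding function_algebra_def smooth_functions_def by auto
qed

lemma smooth_functions_inverse:
  assumes "f \<in> S" "\<And>z. f z \<noteq> 0"
  shows "(\<lambda>z. inverse (f z)) \<in> S"
proof -
  have "smooth_on V (\<phi> ` U) ((\<lambda>z. inverse (f z)) \<circ> inv_into U \<phi>)" if "(U, \<phi>) \<in> charts M" for U \<phi>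
    using smooth_on_inverse[OF smooth_functionsD[OF assms(1) that]] assms(2) by (simp add: comp_def)
  then show ?thesis by (auto simp: smooth_functions_def)
qed

text \<open>The cutoff lives on the preimage of a compact ball of the model, which is closed because
  the manifold is Hausdorff. That is why extension by zero is smooth beyond \<open>N\<close>.
  Keeping \<open>h\<close> arbitrary makes one cutoff serve for bump functions, coordinates and
  vector fields.\<close>

lemma chart_cutoff:
  assumes U: "(U, \<phi>) \<in> charts M" and N: "open N" "N \<subseteq> U" and z: "z \<in> N"
  shows "\<exists>\<beta> N'. open N' \<and> z \<in> N' \<and> N' \<subseteq> N \<and> (\<forall>y\<in>N'. \<beta> y = 1) \<and> (\<forall>y. y \<notin> N \<longrightarrow> \<beta> y = 0) \<and>
    (\<forall>y. 0 \<le> \<beta> y \<and> \<beta> y \<le> (1::real)) \<and>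
    (\<forall>h. smooth_on V (\<phi> ` N) h \<longrightarrow>
      (\<lambda>y. if y \<in> N then complex_of_real (\<beta> y) * h (\<phi> y) else 0) \<in> S)"
proof -
  have opn: "openin (top_of_set V) (\<phi> ` N)" by (rule chart_open_image[OF U N])
  then obtain r where r: "r > 0" "cball (\<phi> z) r \<inter> V \<subseteq> \<phi> ` N"
    using z unfolding openin_contains_cball by blast
  define K where "K = cball (\<phi> z) r \<inter> V"
  define \<beta> where "\<beta> y = (if y \<in> N then bump (\<phi> z) r (\<phi> y) else 0)" for y
  define N' where "N' = N \<inter> (U \<inter> \<phi> -` ball (\<phi> z) (r / 2))"
  have cont: "continuous_on U \<phi>" using chart(3)[OF U] by (simp add: homeomorphism_def)
  have "open (U \<inter> \<phi> -` ball (\<phi> z) (r / 2))"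
    using continuous_on_open_vimage[OF chart(1)[OF U], of \<phi>] cont by (metis Int_commute open_ball)
  then have N'_open: "open N'" unfolding N'_def using N by blast
  have "compact K" unfolding K_def using closed_subspace[OF subspace_V] by (intro compact_Int_closed) auto
  moreover have K_sub: "K \<subseteq> \<phi> ` N" using r(2) by (simp add: K_def)
  moreover have "continuous_on (\<phi> ` U) (inv_into U \<phi>)"
    using chart(3)[OF U] by (simp add: homeomorphism_def)
  ultimately have "compact (inv_into U \<phi> ` K)"
    using N(2) by (intro compact_continuous_image continuous_on_subset[of "\<phi> ` U" _ K]) auto
  then have closed: "closed (inv_into U \<phi> ` K)" by (rule compact_imp_closed)
  have K_in: "inv_into U \<phi> ` K \<subseteq> N"
    using K_sub N(2) chart_inj[OF U] by fastforce
  have off_K: "\<beta> y = 0" if "y \<notin> inv_into U \<phi> ` K" for y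
  proof (cases "y \<in> N")
    case True
    then have "\<phi> y \<in> V" using openin_imp_subset[OF opn] by blast
    have "\<phi> y \<notin> K" using that True N(2) chart_inj[OF U, of y] by (metis image_eqI subsetD)
    then have "r \<le> dist (\<phi> z) (\<phi> y)" using \<open>\<phi> y \<in> V\<close> by (simp add: K_def)
    then have "bump (\<phi> z) r (\<phi> y) = 0" by (rule bump_simps(2)[OF r(1)])
    then show ?thesis by (simp add: \<beta>_def)
  qed (simp add: \<beta>_def)
  show ?thesis
  proof (intro exI[of _ \<beta>] exI[of _ N'] conjI ballI allI impI)
    show "open N'" by (rule N'_open)
    show "z \<in> N'" using z N(2) r(1) by (auto simp: N'_def)
    show "N' \<subseteq> N" by (simp add: N'_def)
    show "\<beta> y = 1" if "y \<in> N'" for y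
      using that bump_simps(1)[OF r(1), of "\<phi> z" "\<phi> y"] by (auto simp: N'_def \<beta>_def)
    show "\<beta> y = 0" if "y \<notin> N" for y using that by (simp add: \<beta>_def)
    show "0 \<le> \<beta> y" "\<beta> y \<le> 1" for y using bump_simps(3,4)[OF r(1), of "\<phi> z" "\<phi> y"] by (simp_all add: \<beta>_def)
    fix h :: "'e \<Rightarrow> complex" assume h: "smooth_on V (\<phi> ` N) h"
    define F where "F y = (if y \<in> N then complex_of_real (\<beta> y) * h (\<phi> y) else 0)" for y
    have "F \<in> S"
    proof (rule smooth_functions_locallyI)
      fix W \<psi> w assume W: "(W, \<psi>) \<in> charts M" and w: "w \<in> W"
      show "\<exists>N. open N \<and> w \<in> N \<and> N \<subseteq> W \<and> smooth_on V (\<psi> ` N) (F \<circ> inv_into W \<psi>)"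
      proof (cases "w \<in> N")
        case True
        have WN: "open (W \<inter> N)" using chart(1)[OF W] N by blast
        have img: "(\<phi> \<circ> inv_into W \<psi>) ` (\<psi> ` (W \<inter> N)) \<subseteq> \<phi> ` N"
          using chart_inj[OF W] by force
        have tr: "smooth_on V (\<psi> ` (W \<inter> N)) (\<phi> \<circ> inv_into W \<psi>)"
          by (rule smooth_on_subset[OF transition[OF W U]]) (use N(2) in auto)
        have "smooth_on V (\<phi> ` N) (\<lambda>y. complex_of_real (bump (\<phi> z) r y) * h y)"
          by (intro smooth_on_mult smooth_on_bounded_linear[OF bounded_linear_of_real]
              smooth_on_bump subspace_V opn h)
        then have "smooth_on V (\<psi> ` (W \<inter> N))
            ((\<lambda>y. complex_of_real (bump (\<phi> z) r y) * h y) \<circ> (\<phi> \<circ> inv_into W \<psi>))"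
          by (intro smooth_on_compose[OF subspace_V chart_open_image[OF W WN] subspace_V
                openin_imp_subset[OF opn] img tr]) auto
        then have "smooth_on V (\<psi> ` (W \<inter> N)) (F \<circ> inv_into W \<psi>)"
          by (rule smooth_on_cong) (auto simp: chart_inj[OF W] F_def \<beta>_def)
        then show ?thesis using WN w True by blast
      next
        case False
        \<comment> \<open>Off the compact set \<open>F\<close> is identically zero, and this open
          complement contains \<open>w\<close> because the compact set lies inside
          \<open>N\<close>.\<close>
        let ?N = "W - inv_into U \<phi> ` K"
        have "smooth_on V (\<psi> ` ?N) (F \<circ> inv_into W \<psi>)"
          by (rule smooth_on_cong[OF smooth_on_const[of _ _ 0]])
            (auto simp: chart_inj[OF W] F_def off_K)
        moreover have "w \<notin> inv_into U \<phi> ` K" using False K_in by blast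
        ultimately show ?thesis
          using w open_Diff[OF chart(1)[OF W] closed] by (intro exI[of _ ?N]) auto
      qed
    qed
    then show "(\<lambda>y. if y \<in> N then complex_of_real (\<beta> y) * h (\<phi> y) else 0) \<in> S"
      by (simp add: F_def[abs_def])
  qed
qed

lemma smooth_cutoff:
  assumes "open N" "z \<in> N"
  obtains b N' where "b \<in> S" "open N'" "z \<in> N'" "N' \<subseteq> N" "\<And>y. y \<in> N' \<Longrightarrow> b y = 1"
    "\<And>y. y \<notin> N \<Longrightarrow> b y = 0" "\<And>y. norm (b y) \<le> 1"
proof -
  obtain U \<phi> where U: "(U, \<phi>) \<in> charts M" "z \<in> U" by (rule chart_exists)
  obtain \<beta> N' where \<beta>: "open N'" "z \<in> N'" "N' \<subseteq> N \<inter> U" "\<And>y. y \<in> N' \<Longrightarrow> \<beta> y = 1"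
    "\<And>y. y \<notin> N \<inter> U \<Longrightarrow> \<beta> y = 0" "\<And>y. 0 \<le> \<beta> y \<and> \<beta> y \<le> (1::real)"
    "\<And>h. smooth_on V (\<phi> ` (N \<inter> U)) h \<Longrightarrow> (\<lambda>y. if y \<in> N \<inter> U then complex_of_real (\<beta> y) * h (\<phi> y) else 0) \<in> S"
    using chart_cutoff[OF U(1) open_Int[OF assms(1) chart(1)[OF U(1)]] Int_lower2 IntI[OF assms(2) U(2)]]
    by blast
  have "(\<lambda>y. if y \<in> N \<inter> U then complex_of_real (\<beta> y) * 1 else 0) \<in> S"
    by (rule \<beta>(7)) (rule smooth_on_const)
  moreover have "(\<lambda>y. if y \<in> N \<inter> U then complex_of_real (\<beta> y) * 1 else 0) = (\<lambda>y. complex_of_real (\<beta> y))"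
    using \<beta>(5) by (auto simp: fun_eq_iff)
  ultimately have "(\<lambda>y. complex_of_real (\<beta> y)) \<in> S" by simp
  then show ?thesis
    by (rule that) (use \<beta> in auto)
qed

lemma smooth_separation:
  assumes "open N" "z \<in> N"
  shows "\<exists>e\<in>S. e z = 0 \<and> (\<forall>y. y \<notin> N \<longrightarrow> e y = 1)"
proof -
  obtain b N' where b: "b \<in> S" "z \<in> N'" "\<And>y. y \<in> N' \<Longrightarrow> b y = 1" "\<And>y. y \<notin> N \<Longrightarrow> b y = 0"
    using smooth_cutoff[OF assms] by metis
  have "1 - b \<in> S" by (intro function_algebraD[OF function_algebra_smooth_functions] b)
  then show ?thesis by (rule bexI[rotated]) (use b in \<open>simp add: pointwise\<close>)
qed

end

section \<open>Hadamard's lemma\<close>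

lemma dir_deriv_add:
  assumes "subspace V" "openin (top_of_set V) W" "smooth_on V W f" "smooth_on V W g" "x \<in> W" "v \<in> V"
  shows "dir_deriv v (\<lambda>x. f x + g x) x = dir_deriv v f x + dir_deriv v g x"
proof -
  obtain f' where f': "(f has_derivative f') (at x within W)"
    using smooth_on_has_derivative[OF assms(3,5)] .
  obtain g' where g': "(g has_derivative g') (at x within W)"
    using smooth_on_has_derivative[OF assms(4,5)] .
  show ?thesis
    using dir_deriv_eq[OF assms(1,2,5,6)] f' g' has_derivative_add[OF f' g'] by metis
qed

lemma dir_deriv_mult:
  fixes f g :: "'e::euclidean_space \<Rightarrow> 'b::real_normed_algebra"
  assumes "subspace V" "openin (top_of_set V) W" "smooth_on V W f" "smooth_on V W g" "x \<in> W" "v \<in> V"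
  shows "dir_deriv v (\<lambda>x. f x * g x) x = f x * dir_deriv v g x + dir_deriv v f x * g x"
proof -
  obtain f' where f': "(f has_derivative f') (at x within W)"
    using smooth_on_has_derivative[OF assms(3,5)] .
  obtain g' where g': "(g has_derivative g') (at x within W)"
    using smooth_on_has_derivative[OF assms(4,5)] .
  note eq = dir_deriv_eq[OF assms(1,2,5,6)]
  show ?thesis
    unfolding eq[OF f'] eq[OF g'] eq[OF has_derivative_mult[OF f' g']] ..
qed

lemma dir_deriv_const:
  assumes "subspace V" "openin (top_of_set V) W" "x \<in> W" "v \<in> V"
  shows "dir_deriv v (\<lambda>x. c) x = 0"
  using dir_deriv_eq[OF assms has_derivative_const] .

text \<open>The derivative within a subset of \<open>V\<close> can be changed off \<open>V\<close>.\<close>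

lemma has_derivative_orthonormal_expansion:
  fixes f :: "'e::euclidean_space \<Rightarrow> 'b::real_normed_vector"
  assumes V: "subspace V" "openin (top_of_set V) W" and B: "finite B" "B \<subseteq> V"
    "\<And>x. x \<in> V \<Longrightarrow> x = (\<Sum>e\<in>B. (x \<bullet> e) *\<^sub>R e)"
    and f: "smooth_on V W f" and x: "x \<in> W"
  shows "(f has_derivative (\<lambda>v. \<Sum>e\<in>B. (v \<bullet> e) *\<^sub>R dir_deriv e f x)) (at x within W)"
proof -
  obtain f' where f': "(f has_derivative f') (at x within W)"
    using smooth_on_has_derivative[OF f x] .
  have dd: "dir_deriv e f x = f' e" if "e \<in> B" for e
    using dir_deriv_eq[OF V x _ f'] B(2) that by blast
  define L where "L v = (\<Sum>e\<in>B. (v \<bullet> e) *\<^sub>R dir_deriv e f x)" for v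
  have L: "bounded_linear L"
    unfolding L_def[abs_def]
    by (intro bounded_linear_sum bounded_linear_scaleR_left[THEN bounded_linear_compose] bounded_linear_inner_left)
  have lin: "linear f'" using f' by (rule has_derivative_linear)
  have eq: "f' (y - x) = L (y - x)" if "y \<in> W" for y
  proof -
    have "y - x \<in> V"
      using openin_imp_subset[OF V(2)] that x V(1) by (intro subspace_diff) auto
    then have "f' (y - x) = f' (\<Sum>e\<in>B. ((y - x) \<bullet> e) *\<^sub>R e)" by (rule arg_cong[OF B(3)])
    also have "\<dots> = (\<Sum>e\<in>B. ((y - x) \<bullet> e) *\<^sub>R f' e)"
      using lin by (simp add: linear_sum linear_scale)
    finally show ?thesis unfolding L_def using dd by simp
  qed
  have "((\<lambda>y. (1 / norm (y - x)) *\<^sub>R (f y - (f x + f' (y - x)))) \<longlongrightarrow> 0) (at x within W)"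
    using f' by (simp add: has_derivative_within)
  then have "((\<lambda>y. (1 / norm (y - x)) *\<^sub>R (f y - (f x + L (y - x)))) \<longlongrightarrow> 0) (at x within W)"
    by (rule Lim_transform_within[OF _ zero_less_one]) (simp add: eq)
  then have "(f has_derivative L) (at x within W)" using L by (simp add: has_derivative_within)
  then show ?thesis by (simp only: L_def[abs_def])
qed

lemma segment_in_convex:
  assumes "convex U" "c \<in> U" "x \<in> U" "0 \<le> t" "t \<le> (1::real)"
  shows "c + t *\<^sub>R (x - c) \<in> U"
proof -
  have "(1 - t) *\<^sub>R c + t *\<^sub>R x \<in> U" using assms by (intro convexD) auto
  then show ?thesis by (simp add: algebra_simps)
qed

text \<open>Differentiating \<open>F (c + t (x - c))\<close> in \<open>x\<close> produces a factor
  \<open>t\<close>. The weight \<open>t ^ m\<close> absorbs it, with \<open>m\<close> increased at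
  each step of the induction.\<close>

lemma Ck_on_segment_integral:
  fixes F :: "'e::euclidean_space \<Rightarrow> complex"
  assumes V: "subspace V" "openin (top_of_set V) U" and conv: "convex U" and c: "c \<in> U"
  shows "smooth_on V U F \<Longrightarrow>
    Ck_on k V U (\<lambda>x. integral (cbox 0 1) (\<lambda>t. t ^ m *\<^sub>R F (c + t *\<^sub>R (x - c))))"
proof (induction k arbitrary: F m)
  case (0 F m)
  have "continuous_on U F" using 0 Ck_on.simps(1) unfolding smooth_on_def by blast
  then have "continuous_on (U \<times> cbox 0 1) (\<lambda>z. F (c + snd z *\<^sub>R (fst z - c)))"
    by (rule continuous_on_compose2) (auto intro!: continuous_intros segment_in_convex[OF conv c])
  then have "continuous_on (U \<times> cbox 0 1) (\<lambda>(x, t). t ^ m *\<^sub>R F (c + t *\<^sub>R (x - c)))"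
    by (auto simp: case_prod_beta intro!: continuous_intros)
  from integral_continuous_on_param[OF this] show ?case by simp
next
  case (Suc k F m)
  obtain B where B: "finite B" "B \<subseteq> V" "\<And>x. x \<in> V \<Longrightarrow> x = (\<Sum>e\<in>B. (x \<bullet> e) *\<^sub>R e)"
    using orthonormal_expansion_subspace[OF V(1)] by metis
  have dF: "smooth_on V U (dir_deriv e F)" if "e \<in> B" for e
    using smooth_on_dir_deriv[OF V Suc.prems] B(2) that by blast
  have seg: "c + t *\<^sub>R (x - c) \<in> U" if "x \<in> U" "t \<in> cbox 0 1" for x and t :: real
    using segment_in_convex[OF conv c that(1)] that(2) by simp
  have cont: "continuous_on (U \<times> cbox 0 1) (\<lambda>z. G (c + snd z *\<^sub>R (fst z - c)))"
    if "smooth_on V U G" for G :: "'e \<Rightarrow> complex"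
  proof -
    have "continuous_on U G" using that Ck_on.simps(1) unfolding smooth_on_def by blast
    then show ?thesis
      by (rule continuous_on_compose2) (use seg in \<open>auto intro!: continuous_intros\<close>)
  qed
  \<comment> \<open>The derivative in \<open>x\<close> as a bounded linear map depending
    continuously on \<open>x\<close> and \<open>t\<close>, the form required for differentiation
    under the integral. The orthonormal expansion makes it total on the ambient space.\<close>
  define fx where "fx x t = (\<Sum>e\<in>B. blinfun_scaleR_left (t ^ Suc m *\<^sub>R dir_deriv e F (c + t *\<^sub>R (x - c)))
    o\<^sub>L blinfun_inner_right e)" for x and t :: real
  have fx: "blinfun_apply (fx x t) v = (\<Sum>e\<in>B. (v \<bullet> e) *\<^sub>R (t ^ Suc m *\<^sub>R dir_deriv e F (c + t *\<^sub>R (x - c))))"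
    for x t v
    by (simp add: fx_def blinfun.sum_left inner_commute)
  have cont_fx: "continuous_on (U \<times> cbox 0 1) (\<lambda>(x, t). fx x t)"
    unfolding fx_def case_prod_beta
    by (intro continuous_on_sum bounded_bilinear.continuous_on[OF bounded_bilinear_blinfun_compose]
        bounded_linear.continuous_on[OF bounded_linear_blinfun_scaleR_left] continuous_intros cont dF)
  have cont_t: "continuous_on (cbox 0 1) (\<lambda>t. G (c + t *\<^sub>R (x - c)))"
    if "smooth_on V U G" "x \<in> U" for G :: "'e \<Rightarrow> complex" and x
  proof -
    have "continuous_on (cbox 0 1) ((\<lambda>z. G (c + snd z *\<^sub>R (fst z - c))) \<circ> (\<lambda>t. (x, t)))"
      by (rule continuous_on_compose)
        (use that(2) in \<open>auto intro!: continuous_intros continuous_on_subset[OF cont[OF that(1)]]\<close>)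
    then show ?thesis by (simp add: comp_def)
  qed
  have cont_fx_t: "continuous_on (cbox 0 1) (fx x)" if "x \<in> U" for x
  proof -
    have "continuous_on (cbox 0 1) ((\<lambda>(x, t). fx x t) \<circ> (\<lambda>t. (x, t)))"
      by (rule continuous_on_compose)
        (use that in \<open>auto intro!: continuous_intros continuous_on_subset[OF cont_fx]\<close>)
    then show ?thesis by (simp add: comp_def)
  qed
  have der: "((\<lambda>x. t ^ m *\<^sub>R F (c + t *\<^sub>R (x - c))) has_derivative blinfun_apply (fx x t)) (at x within U)"
    if x: "x \<in> U" and t: "t \<in> cbox 0 1" for x t
  proof -
    have 1: "((\<lambda>x. c + t *\<^sub>R (x - c)) has_derivative (\<lambda>v. t *\<^sub>R v)) (at x within U)"
      by (auto intro!: derivative_eq_intros)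
    have "(F has_derivative (\<lambda>v. \<Sum>e\<in>B. (v \<bullet> e) *\<^sub>R dir_deriv e F (c + t *\<^sub>R (x - c))))
        (at (c + t *\<^sub>R (x - c)) within (\<lambda>x. c + t *\<^sub>R (x - c)) ` U)"
      by (rule has_derivative_subset[OF has_derivative_orthonormal_expansion[OF V B Suc.prems seg[OF x t]]])
        (use seg t in auto)
    from has_derivative_scaleR_right[OF has_derivative_in_compose[OF 1 this], of "t ^ m"]
    show ?thesis
      by (rule has_derivative_eq_rhs) (auto simp: fx fun_eq_iff scaleR_sum_right ac_simps)
  qed
  have int_der: "((\<lambda>x. integral (cbox 0 1) (\<lambda>t. t ^ m *\<^sub>R F (c + t *\<^sub>R (x - c))))
      has_derivative blinfun_apply (integral (cbox 0 1) (fx x))) (at x within U)" if x: "x \<in> U" for x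
  proof (rule leibniz_rule[OF der _ cont_fx x conv])
    show "(\<lambda>t. t ^ m *\<^sub>R F (c + t *\<^sub>R (x - c))) integrable_on cbox 0 1" if "x \<in> U" for x
      by (intro integrable_continuous continuous_intros cont_t Suc.prems that)
  qed
  have int_eq: "blinfun_apply (integral (cbox 0 1) (fx x)) v =
      (\<Sum>e\<in>B. (v \<bullet> e) *\<^sub>R integral (cbox 0 1) (\<lambda>t. t ^ Suc m *\<^sub>R dir_deriv e F (c + t *\<^sub>R (x - c))))"
    if x: "x \<in> U" for x v
  proof -
    have int: "(\<lambda>t. t ^ Suc m *\<^sub>R dir_deriv e F (c + t *\<^sub>R (x - c))) integrable_on cbox 0 1" if "e \<in> B" for e
      by (intro integrable_continuous continuous_intros cont_t dF that x)
    have "blinfun_apply (integral (cbox 0 1) (fx x)) v = integral (cbox 0 1) (\<lambda>t. blinfun_apply (fx x t) v)"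
      by (intro blinfun_apply_integral integrable_continuous cont_fx_t x)
    also have "\<dots> = (\<Sum>e\<in>B. integral (cbox 0 1) (\<lambda>t. (v \<bullet> e) *\<^sub>R (t ^ Suc m *\<^sub>R dir_deriv e F (c + t *\<^sub>R (x - c)))))"
      unfolding fx by (intro integral_sum B(1) integrable_cmul int)
    finally show ?thesis by (simp only: integral_cmul)
  qed
  have "Ck_on k V U (\<lambda>x. blinfun_apply (integral (cbox 0 1) (fx x)) v)" for v
  proof (rule Ck_on_cong)
    show "Ck_on k V U (\<lambda>x. \<Sum>e\<in>B. (v \<bullet> e) *\<^sub>R
        integral (cbox 0 1) (\<lambda>t. t ^ Suc m *\<^sub>R dir_deriv e F (c + t *\<^sub>R (x - c))))"
      by (intro Ck_on_sum Ck_on_scaleR Ck_on_const Suc.IH dF)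
  qed (simp only: int_eq)
  then show ?case
    using int_der by (auto intro!: exI[of _ "\<lambda>x. blinfun_apply (integral (cbox 0 1) (fx x))"])
qed

lemma hadamard_on_convex:
  fixes F :: "'e::euclidean_space \<Rightarrow> complex"
  assumes V: "subspace V" "openin (top_of_set V) U" and conv: "convex U" and c: "c \<in> U"
    and F: "smooth_on V U F" and B: "finite B" "B \<subseteq> V" "\<And>x. x \<in> V \<Longrightarrow> x = (\<Sum>e\<in>B. (x \<bullet> e) *\<^sub>R e)"
  shows "\<exists>G. (\<forall>e\<in>B. smooth_on V U (G e)) \<and>
    (\<forall>x\<in>U. F x = F c + (\<Sum>e\<in>B. complex_of_real ((x - c) \<bullet> e) * G e x))"
proof (intro exI conjI ballI)
  \<comment> \<open>The classical Hadamard coefficients. The trivial weight \<open>t ^ 0\<close>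
    matches the lemma on segment integrals.\<close>
  define G where "G e x = integral (cbox 0 1) (\<lambda>t. t ^ 0 *\<^sub>R dir_deriv e F (c + t *\<^sub>R (x - c)))" for e x
  show "smooth_on V U (G e)" if "e \<in> B" for e
    using Ck_on_segment_integral[OF V conv c smooth_on_dir_deriv[OF V F], of e _ 0] B(2) that
    unfolding smooth_on_def G_def[abs_def] by blast
  fix x assume x: "x \<in> U"
  have seg: "c + t *\<^sub>R (x - c) \<in> U" if "t \<in> {0..1}" for t
    using segment_in_convex[OF conv c x] that by simp
  have der: "((\<lambda>t. F (c + t *\<^sub>R (x - c))) has_vector_derivative
      (\<Sum>e\<in>B. ((x - c) \<bullet> e) *\<^sub>R dir_deriv e F (c + t *\<^sub>R (x - c)))) (at t within {0..1})"
    if t: "t \<in> {0..1}" for t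
  proof -
    have 1: "((\<lambda>t. c + t *\<^sub>R (x - c)) has_derivative (\<lambda>s. s *\<^sub>R (x - c))) (at t within {0..1})"
      by (auto intro!: derivative_eq_intros)
    have "(F has_derivative (\<lambda>v. \<Sum>e\<in>B. (v \<bullet> e) *\<^sub>R dir_deriv e F (c + t *\<^sub>R (x - c))))
        (at (c + t *\<^sub>R (x - c)) within (\<lambda>t. c + t *\<^sub>R (x - c)) ` {0..1})"
      by (rule has_derivative_subset[OF has_derivative_orthonormal_expansion[OF V B F seg[OF t]]])
        (use seg in auto)
    from has_derivative_in_compose[OF 1 this] show ?thesis
      unfolding has_vector_derivative_def
      by (rule has_derivative_eq_rhs) (auto simp: fun_eq_iff scaleR_sum_right)
  qed
  have "continuous_on {0..1} (\<lambda>t. dir_deriv e F (c + t *\<^sub>R (x - c)))" if "e \<in> B" for e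
  proof -
    have "continuous_on U (dir_deriv e F)"
      using smooth_on_dir_deriv[OF V F, of e] B(2) that Ck_on.simps(1) unfolding smooth_on_def by blast
    then show ?thesis
      by (rule continuous_on_compose2) (use seg in \<open>auto intro!: continuous_intros\<close>)
  qed
  then have int: "(\<lambda>t. dir_deriv e F (c + t *\<^sub>R (x - c))) integrable_on {0..1}" if "e \<in> B" for e
    using that by (intro integrable_continuous_real)
  have "((\<lambda>t. \<Sum>e\<in>B. ((x - c) \<bullet> e) *\<^sub>R dir_deriv e F (c + t *\<^sub>R (x - c))) has_integral
      F (c + 1 *\<^sub>R (x - c)) - F (c + 0 *\<^sub>R (x - c))) {0..1}"
    by (rule fundamental_theorem_of_calculus[OF _ der]) auto
  then have "F x - F c = integral {0..1} (\<lambda>t. \<Sum>e\<in>B. ((x - c) \<bullet> e) *\<^sub>R dir_deriv e F (c + t *\<^sub>R (x - c)))"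
    by (simp add: integral_unique)
  also have "\<dots> = (\<Sum>e\<in>B. integral {0..1} (\<lambda>t. ((x - c) \<bullet> e) *\<^sub>R dir_deriv e F (c + t *\<^sub>R (x - c))))"
    by (intro integral_sum B(1) integrable_cmul int)
  also have "\<dots> = (\<Sum>e\<in>B. complex_of_real ((x - c) \<bullet> e) * G e x)"
    by (simp add: G_def scaleR_conv_of_real)
  finally show "F x = F c + (\<Sum>e\<in>B. complex_of_real ((x - c) \<bullet> e) * G e x)"
    by (simp add: algebra_simps)
qed

section \<open>Local frames of a surjective submersion\<close>

text \<open>The formula on a convex set is used for a ball in the model, and a cutoff makes the
  coefficients global. It remains valid where the cutoff is 1, hence the smaller neighbourhood
  \<open>O'\<close>.\<close>

lemma (in smooth_manifold_locale) chart_hadamard: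
  assumes U: "(U, \<psi>) \<in> charts M" and N: "open N" "N \<subseteq> U" "y0 \<in> N" and b: "b \<in> S"
    and B: "finite B" "B \<subseteq> V" "\<And>x. x \<in> V \<Longrightarrow> x = (\<Sum>e\<in>B. (x \<bullet> e) *\<^sub>R e)"
  shows "\<exists>g O'. (\<forall>e\<in>B. g e \<in> S) \<and> open O' \<and> y0 \<in> O' \<and> O' \<subseteq> N \<and>
    (\<forall>y\<in>O'. b y = b y0 + (\<Sum>e\<in>B. complex_of_real ((\<psi> y - \<psi> y0) \<bullet> e) * g e y))"
proof -
  have opn: "openin (top_of_set V) (\<psi> ` N)" by (rule chart_open_image[OF U N(1,2)])
  then obtain r where r: "r > 0" "ball (\<psi> y0) r \<inter> V \<subseteq> \<psi> ` N"
    using N(3) unfolding openin_contains_ball by blast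
  define D where "D = V \<inter> ball (\<psi> y0) r"
  have D_open: "openin (top_of_set V) D" unfolding D_def by (rule openin_open_Int) simp
  have D_convex: "convex D" unfolding D_def by (intro convex_Int subspace_imp_convex subspace_V convex_ball)
  have y0: "\<psi> y0 \<in> D" using r(1) openin_imp_subset[OF opn] N(3) by (auto simp: D_def)
  have D_sub: "D \<subseteq> \<psi> ` N" using r(2) by (auto simp: D_def)
  have F: "smooth_on V D (b \<circ> inv_into U \<psi>)"
    by (rule smooth_on_subset[OF smooth_functionsD[OF b U]]) (use D_sub N(2) in blast)
  obtain G where G: "\<And>e. e \<in> B \<Longrightarrow> smooth_on V D (G e)"
    "\<And>x. x \<in> D \<Longrightarrow> (b \<circ> inv_into U \<psi>) x =
      (b \<circ> inv_into U \<psi>) (\<psi> y0) + (\<Sum>e\<in>B. complex_of_real ((x - \<psi> y0) \<bullet> e) * G e x)"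
    using hadamard_on_convex[OF subspace_V D_open D_convex y0 F B] by blast
  define N2 where "N2 = N \<inter> (U \<inter> \<psi> -` ball (\<psi> y0) r)"
  have cont: "continuous_on U \<psi>" using chart(3)[OF U] by (simp add: homeomorphism_def)
  have "open (U \<inter> \<psi> -` ball (\<psi> y0) r)"
    using continuous_on_open_vimage[OF chart(1)[OF U], of \<psi>] cont by (metis Int_commute open_ball)
  then have N2: "open N2" "N2 \<subseteq> U" "y0 \<in> N2" using N r(1) by (auto simp: N2_def)
  have N2_D: "\<psi> ` N2 \<subseteq> D" using openin_imp_subset[OF opn] by (auto simp: N2_def D_def)
  obtain \<beta> N3 where \<beta>: "open N3" "y0 \<in> N3" "N3 \<subseteq> N2" "\<And>y. y \<in> N3 \<Longrightarrow> \<beta> y = (1::real)"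
    "\<And>h. smooth_on V (\<psi> ` N2) h \<Longrightarrow> (\<lambda>y. if y \<in> N2 then complex_of_real (\<beta> y) * h (\<psi> y) else 0) \<in> S"
    using chart_cutoff[OF U N2] by blast
  define g where "g e y = (if y \<in> N2 then complex_of_real (\<beta> y) * G e (\<psi> y) else 0)" for e y
  have "g e \<in> S" if "e \<in> B" for e
    using \<beta>(5)[OF smooth_on_subset[OF G(1)[OF that] N2_D]] by (simp add: g_def[abs_def])
  moreover have "b y = b y0 + (\<Sum>e\<in>B. complex_of_real ((\<psi> y - \<psi> y0) \<bullet> e) * g e y)" if y: "y \<in> N3" for y
  proof -
    have "y \<in> N2" "\<psi> y \<in> D" "y \<in> U" "y0 \<in> U" using y \<beta>(3) N2_D N2 by blast+
    then show ?thesis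
      using G(2)[of "\<psi> y"] \<beta>(4)[OF y] by (simp add: g_def chart_inj[OF U])
  qed
  moreover have "N3 \<subseteq> N" using \<beta>(3) by (auto simp: N2_def)
  ultimately show ?thesis
    using \<beta>(1,2) by (intro exI[of _ g] exI[of _ N3] conjI ballI) assumption+
qed

text \<open>A vector field with constant coefficients in one chart, cut off and extended by zero so
  that it acts on global functions.\<close>

definition chart_field ::
  "('a \<Rightarrow> real) \<Rightarrow> 'a set \<Rightarrow> 'a set \<Rightarrow> ('a \<Rightarrow> 'e::real_normed_vector) \<Rightarrow> 'e \<Rightarrow> ('a \<Rightarrow> complex) \<Rightarrow> 'a \<Rightarrow> complex" where
  "chart_field \<beta> N U \<phi> v f y =
     (if y \<in> N then complex_of_real (\<beta> y) * dir_deriv v (f \<circ> inv_into U \<phi>) (\<phi> y) else 0)"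

lemma (in smooth_manifold_locale) chart_field:
  assumes U: "(U, \<phi>) \<in> charts M" and N: "open N" "N \<subseteq> U" and v: "v \<in> V"
    and \<beta>: "\<And>h. smooth_on V (\<phi> ` N) h \<Longrightarrow> (\<lambda>y. if y \<in> N then complex_of_real (\<beta> y) * h (\<phi> y) else 0) \<in> S"
  shows "linear_op S S (chart_field \<beta> N U \<phi> v)"
    and "f \<in> S \<Longrightarrow> g \<in> S \<Longrightarrow> chart_field \<beta> N U \<phi> v (f * g) =
      chart_field \<beta> N U \<phi> v f * g + f * chart_field \<beta> N U \<phi> v g"
proof -
  have opn: "openin (top_of_set V) (\<phi> ` N)" by (rule chart_open_image[OF U N])
  have sm: "smooth_on V (\<phi> ` N) (f \<circ> inv_into U \<phi>)" if "f \<in> S" for f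
    by (rule smooth_on_subset[OF smooth_functionsD[OF that U]]) (use N in blast)
  note rules = dir_deriv_add[OF subspace_V opn sm sm _ v] dir_deriv_mult[OF subspace_V opn sm sm _ v]
  have inj: "inv_into U \<phi> (\<phi> y) = y" if "y \<in> N" for y using chart_inj[OF U] N that by blast
  have mult: "chart_field \<beta> N U \<phi> v (f * g) =
      chart_field \<beta> N U \<phi> v f * g + f * chart_field \<beta> N U \<phi> v g" if "f \<in> S" "g \<in> S" for f g
  proof
    fix y
    show "chart_field \<beta> N U \<phi> v (f * g) y = (chart_field \<beta> N U \<phi> v f * g + f * chart_field \<beta> N U \<phi> v g) y"
    proof (cases "y \<in> N")
      case True
      have "(f * g) \<circ> inv_into U \<phi> = (\<lambda>x. (f \<circ> inv_into U \<phi>) x * (g \<circ> inv_into U \<phi>) x)"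
        by (simp add: fun_eq_iff pointwise)
      then show ?thesis
        using rules(2)[OF that, of "\<phi> y"] True
        by (simp add: chart_field_def pointwise inj algebra_simps)
    qed (simp add: chart_field_def pointwise)
  qed
  then show "f \<in> S \<Longrightarrow> g \<in> S \<Longrightarrow> chart_field \<beta> N U \<phi> v (f * g) =
      chart_field \<beta> N U \<phi> v f * g + f * chart_field \<beta> N U \<phi> v g" .
  show "linear_op S S (chart_field \<beta> N U \<phi> v)"
  proof (rule linear_opI)
    show "chart_field \<beta> N U \<phi> v f \<in> S" if "f \<in> S" for f
      using \<beta>[OF smooth_on_dir_deriv[OF subspace_V opn sm[OF that] v]]
      by (simp add: chart_field_def[abs_def])
    show "chart_field \<beta> N U \<phi> v (f + g) = chart_field \<beta> N U \<phi> v f + chart_field \<beta> N U \<phi> v g"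
      if "f \<in> S" "g \<in> S" for f g
    proof
      fix y
      have "(f + g) \<circ> inv_into U \<phi> = (\<lambda>x. (f \<circ> inv_into U \<phi>) x + (g \<circ> inv_into U \<phi>) x)"
        by (simp add: fun_eq_iff pointwise)
      then show "chart_field \<beta> N U \<phi> v (f + g) y = (chart_field \<beta> N U \<phi> v f + chart_field \<beta> N U \<phi> v g) y"
        using rules(1)[OF that, of "\<phi> y"]
        by (simp add: chart_field_def pointwise distrib_left)
    qed
    show "chart_field \<beta> N U \<phi> v ((\<lambda>_. c) * f) = (\<lambda>_. c) * chart_field \<beta> N U \<phi> v f" if "f \<in> S" for c f
    proof -
      \<comment> \<open>Homogeneity is obtained from the product rule once constants are known to be
        annihilated.\<close>
      have "chart_field \<beta> N U \<phi> v (\<lambda>_. c) = 0"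
      proof
        fix y
        have "(\<lambda>_. c) \<circ> inv_into U \<phi> = (\<lambda>_. c)" by auto
        then show "chart_field \<beta> N U \<phi> v (\<lambda>_. c) y = 0 y"
          using dir_deriv_const[OF subspace_V opn _ v, of "\<phi> y" c] by (simp add: chart_field_def pointwise)
      qed
      then show ?thesis
        using mult[OF function_algebraD(1)[OF function_algebra_smooth_functions] that] by simp
    qed
  qed
qed

lemma (in smooth_manifold_locale) local_inverse:
  assumes u: "u \<in> S" and z: "u z = 1"
  obtains w N where "w \<in> S" "open N" "z \<in> N" "\<And>y. y \<in> N \<Longrightarrow> w y * u y = 1" "w z = 1"
proof -
  note Sc = function_algebraD[OF function_algebra_smooth_functions]
  have cont: "continuous_on UNIV u"
  proof -
    have "\<exists>N. open N \<and> y \<in> N \<and> continuous_on N u" for y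
    proof -
      obtain U \<phi> where U: "(U, \<phi>) \<in> charts M" "y \<in> U" by (rule chart_exists)
      have "continuous_on (\<phi> ` U) (u \<circ> inv_into U \<phi>)"
        using smooth_functionsD[OF u U(1)] Ck_on.simps(1) unfolding smooth_on_def by blast
      moreover have "continuous_on U \<phi>" using chart(3)[OF U(1)] by (simp add: homeomorphism_def)
      ultimately have "continuous_on U ((u \<circ> inv_into U \<phi>) \<circ> \<phi>)"
        using continuous_on_compose by blast
      then have "continuous_on U u"
        by (rule continuous_on_eq) (simp add: chart_inj[OF U(1)])
      then show ?thesis using U chart(1)[OF U(1)] by blast
    qed
    then have "isCont u y" for y
      using continuous_on_eq_continuous_at by blast
    then show ?thesis by (simp add: continuous_at_imp_continuous_on)
  qed
  define Q where "Q = u -` ball 1 (1/2)"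
  have Q: "open Q" "z \<in> Q"
    using open_vimage[OF open_ball cont] z by (auto simp: Q_def)
  obtain b N where b: "b \<in> S" "open N" "z \<in> N" "\<And>y. y \<in> N \<Longrightarrow> b y = 1"
    "\<And>y. y \<notin> Q \<Longrightarrow> b y = 0" "\<And>y. norm (b y) \<le> 1"
    using smooth_cutoff[OF Q] by metis
  \<comment> \<open>This interpolates between \<open>u\<close> near \<open>z\<close> and 1 off
    \<open>Q\<close>. On \<open>Q\<close> the distance of \<open>u\<close> from 1 is below 1/2 and
    \<open>b\<close> has norm at most 1, so \<open>u'\<close> has no zeros and its inverse is
    globally smooth.\<close>
  define u' where "u' = 1 + b * (u - 1)"
  have u': "u' \<in> S" unfolding u'_def by (intro Sc b u)
  have nz: "u' y \<noteq> 0" for y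
  proof
    assume "u' y = 0"
    then have eq: "b y * (1 - u y) = 1" by (simp add: u'_def pointwise algebra_simps)
    show False
    proof (cases "y \<in> Q")
      case True
      then have "norm (1 - u y) < 1 / 2" by (simp add: Q_def dist_norm)
      moreover have "norm (b y * (1 - u y)) \<le> 1 * norm (1 - u y)"
        unfolding norm_mult by (intro mult_right_mono b) simp
      ultimately show False using eq by simp
    next
      case False
      then show False using eq b(5) by simp
    qed
  qed
  have eq: "u' y = u y" if "y \<in> N" for y
    using b(4)[OF that] by (simp add: u'_def pointwise)
  show ?thesis
  proof (rule that[of "\<lambda>y. inverse (u' y)" N])
    show "(\<lambda>y. inverse (u' y)) \<in> S" by (rule smooth_functions_inverse[OF u' nz])
    show "inverse (u' y) * u y = 1" if "y \<in> N" for y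
      using eq[OF that] nz[of y] by simp
    show "inverse (u' z) = 1" using eq[OF b(3)] z by simp
  qed (fact b)+
qed

text \<open>Gaussian elimination, one column at a time, shrinking the neighbourhood of \<open>z\<close>.\<close>

lemma (in smooth_manifold_locale) local_matrix_inverse:
  fixes m :: "nat \<Rightarrow> nat \<Rightarrow> 'a \<Rightarrow> complex"
  assumes m: "\<And>i j. i < d \<Longrightarrow> j < d \<Longrightarrow> m i j \<in> S"
    and z: "\<And>i j. i < d \<Longrightarrow> j < d \<Longrightarrow> m i j z = (if i = j then 1 else 0)"
    and "n \<le> d"
  shows "\<exists>c N. (\<forall>i<d. \<forall>k<d. c i k \<in> S \<and> c i k z = (if i = k then 1 else 0)) \<and> open N \<and> z \<in> N \<and>
    (\<forall>y\<in>N. \<forall>i<d. \<forall>j<n. (\<Sum>k<d. c i k y * m k j y) = (if i = j then 1 else 0))"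
  using \<open>n \<le> d\<close>
proof (induction n)
  case 0
  note Sc = function_algebraD[OF function_algebra_smooth_functions]
  show ?case
    by (intro exI[of _ "\<lambda>i k _. if i = k then 1 else 0"] exI[of _ UNIV]) (auto intro: Sc)
next
  case (Suc n)
  note Sc = function_algebraD[OF function_algebra_smooth_functions]
  obtain c N where cN: "\<forall>i<d. \<forall>k<d. c i k \<in> S \<and> c i k z = (if i = k then 1 else 0)"
    and N: "open N" "z \<in> N"
    and cm': "\<forall>y\<in>N. \<forall>i<d. \<forall>j<n. (\<Sum>k<d. c i k y * m k j y) = (if i = j then 1 else 0)"
    using Suc.IH[OF Suc_leD[OF Suc.prems]] by blast
  have c: "c i k \<in> S" "c i k z = (if i = k then 1 else 0)" if "i < d" "k < d" for i k
    using cN that by blast+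
  have cm: "(\<Sum>k<d. c i k y * m k j y) = (if i = j then 1 else 0)" if "y \<in> N" "i < d" "j < n" for y i j
    using cm' that by blast
  have n: "n < d" using Suc.prems by simp
  define u where "u i = (\<Sum>k<d. c i k * m k n)" for i
  have u: "u i \<in> S" if "i < d" for i
    unfolding u_def by (intro Sc(8)) (simp add: Sc(3) c m that n)
  have u_apply: "u i y = (\<Sum>k<d. c i k y * m k n y)" for i y
    by (simp add: u_def sum_fun_apply pointwise)
  have uz: "u i z = (if i = n then 1 else 0)" if "i < d" for i
  proof -
    have "u i z = (\<Sum>k<d. if k = i then m i n z else 0)"
      unfolding u_apply using c(2) that by (intro sum.cong refl) auto
    then show ?thesis using z that n by simp
  qed
  obtain w N' where w: "w \<in> S" "open N'" "z \<in> N'" "\<And>y. y \<in> N' \<Longrightarrow> w y * u n y = 1" "w z = 1"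
    using local_inverse[OF u[OF n]] uz[OF n] by auto
  \<comment> \<open>Row \<open>n\<close> is divided by its pivot \<open>u n\<close> through the
    local inverse \<open>w\<close>, and multiples of it clear column \<open>n\<close> in the other
    rows. At \<open>z\<close> the pivot is 1 and the other entries of the column are 0, so
    \<open>c'\<close> is still the identity there.\<close>
  define c' where "c' i k = (if i = n then w * c n k else c i k - u i * w * c n k)" for i k
  have c'_in: "c' i k \<in> S" if "i < d" "k < d" for i k
    unfolding c'_def by (cases "i = n") (simp_all add: Sc(3,7) c u w that n)
  have c'_z: "c' i k z = (if i = k then 1 else 0)" if "i < d" "k < d" for i k
    using c(2)[OF that] c(2)[OF n that(2)] uz[OF that(1)] w(5) by (auto simp: c'_def pointwise)
  have "(\<Sum>k<d. c' i k y * m k j y) = (if i = j then 1 else 0)"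
    if y: "y \<in> N \<inter> N'" and i: "i < d" and j: "j < Suc n" for y i j
  proof -
    define s where "s i = (\<Sum>k<d. c i k y * m k j y)" for i
    have eq: "(\<Sum>k<d. c' i k y * m k j y) = (if i = n then w y * s n else s i - u i y * w y * s n)"
      unfolding s_def c'_def
      by (auto simp: pointwise sum_distrib_left sum_subtractf algebra_simps)
    show ?thesis
    proof (cases "j = n")
      case True
      then have "s i = u i y" for i by (simp add: s_def u_apply)
      moreover have "w y * u n y = 1" using w(4) y by blast
      ultimately show ?thesis using eq True by (auto simp: mult.assoc)
    next
      \<comment> \<open>Columns treated earlier are not disturbed: row \<open>n\<close> has the
        entry 0 in every column \<open>j < n\<close>.\<close>
      case False
      then have "s i = (if i = j then 1 else 0)" "s n = 0"
        using cm[of y] y i n j by (auto simp: s_def)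
      then show ?thesis using eq False by auto
    qed
  qed
  then show ?case
    using c'_in c'_z N w(2,3) by (intro exI[of _ c'] exI[of _ "N \<inter> N'"]) auto
qed

section \<open>Coordinates, dual vector fields and a partition of unity for the submersion\<close>

locale submersion = P: smooth_manifold_locale P + M: smooth_manifold_locale M
  for P :: "('p::{t2_space, second_countable_topology}, 'e::euclidean_space) manifold"
    and M :: "('m::{t2_space, second_countable_topology}, 'f::euclidean_space) manifold" +
  fixes p :: "'p \<Rightarrow> 'm"
  assumes submersion: "surjective_submersion P M p"
begin

lemma continuous_p: "continuous_on UNIV p"
  using submersion by (simp add: surjective_submersion_def smooth_map_def)

lemma open_preimage: "open N \<Longrightarrow> open (p -` N)"
  using open_vimage continuous_p by blast

lemma smooth_p:
  assumes "(U, \<phi>) \<in> charts P" "(W, \<psi>) \<in> charts M"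
  shows "smooth_on (model P) (\<phi> ` (U \<inter> p -` W)) (\<psi> \<circ> p \<circ> inv_into U \<phi>)"
  using submersion assms by (fastforce simp: surjective_submersion_def smooth_map_def)

lemma pullback_smooth:
  assumes a: "a \<in> smooth_functions M"
  shows "a \<circ> p \<in> smooth_functions P"
proof (rule P.smooth_functions_locallyI)
  fix U \<phi> z assume U: "(U, \<phi>) \<in> charts P" and z: "z \<in> U"
  obtain W \<psi> where W: "(W, \<psi>) \<in> charts M" "p z \<in> W" by (rule M.chart_exists)
  let ?N = "U \<inter> p -` W"
  have N: "open ?N" using P.chart(1)[OF U] open_preimage[OF M.chart(1)[OF W(1)]] by blast
  have img: "(\<psi> \<circ> p \<circ> inv_into U \<phi>) ` (\<phi> ` ?N) \<subseteq> \<psi> ` W"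
    using P.chart_inj[OF U] by auto
  have "smooth_on (model P) (\<phi> ` ?N) ((a \<circ> inv_into W \<psi>) \<circ> (\<psi> \<circ> p \<circ> inv_into U \<phi>))"
    by (rule smooth_on_compose[OF P.subspace_V P.chart_open_image[OF U N] M.subspace_V
          openin_imp_subset[OF M.chart(2)[OF W(1)]] img smooth_p[OF U W(1)] M.smooth_functionsD[OF a W(1)]]) auto
  then have "smooth_on (model P) (\<phi> ` ?N) ((a \<circ> p) \<circ> inv_into U \<phi>)"
    by (rule smooth_on_cong) (auto simp: P.chart_inj[OF U] M.chart_inj[OF W(1)])
  then show "\<exists>N. open N \<and> z \<in> N \<and> N \<subseteq> U \<and> smooth_on (model P) (\<phi> ` N) ((a \<circ> p) \<circ> inv_into U \<phi>)"
    using N z W(2) by (intro exI[of _ ?N]) auto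
qed

sublocale pulled_back_algebra "smooth_functions P" "smooth_functions M" p
proof unfold_locales
  show "\<exists>e\<in>smooth_functions P. e z = 0 \<and> (\<forall>y. y \<notin> U \<longrightarrow> e y = 1)" if "open U" "z \<in> U" for U z
    using that by (rule P.smooth_separation)
  show "\<exists>e\<in>smooth_functions M. e z = 0 \<and> (\<forall>y. y \<notin> U \<longrightarrow> e y = 1)" if "open U" "z \<in> U" for U z
    using that by (rule M.smooth_separation)
qed (fact P.function_algebra_smooth_functions M.function_algebra_smooth_functions pullback_smooth)+

text \<open>Surjectivity of the derivative at \<open>z0\<close> lifts the basis of the base model to
  directions \<open>v i\<close> upstairs. The corresponding fields paired with the coordinates form
  a matrix that is the identity at \<open>z0\<close>, and its inverse nearby corrects them to a dual
  frame.\<close>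

lemma local_frame_exists:
  assumes e_in: "\<And>i. i < d \<Longrightarrow> e i \<in> model M"
    and e_orth: "\<And>i j. i < d \<Longrightarrow> j < d \<Longrightarrow> e i \<bullet> e j = (if i = j then 1 else 0)"
    and e_expand: "\<And>x. x \<in> model M \<Longrightarrow> x = (\<Sum>i<d. (x \<bullet> e i) *\<^sub>R e i)"
  shows "\<exists>W x X. z0 \<in> W \<and> local_frame (smooth_functions P) (smooth_functions M) p W d x X"
proof -
  let ?S = "smooth_functions P" and ?A = "smooth_functions M"
  obtain U \<phi> where U: "(U, \<phi>) \<in> charts P" "z0 \<in> U" by (rule P.chart_exists)
  obtain Q \<psi> where Q: "(Q, \<psi>) \<in> charts M" "p z0 \<in> Q" by (rule M.chart_exists)
  define q where "q = \<psi> \<circ> p \<circ> inv_into U \<phi>"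
  obtain D where D: "(q has_derivative D) (at (\<phi> z0) within \<phi> ` (U \<inter> p -` Q))" "D ` model P = model M"
    using submersion U Q unfolding surjective_submersion_def q_def by fastforce
  have "\<forall>i. \<exists>v. i < d \<longrightarrow> v \<in> model P \<and> D v = e i"
    using e_in D(2) by (metis imageE)
  then obtain v where v: "\<And>i. i < d \<Longrightarrow> v i \<in> model P" "\<And>i. i < d \<Longrightarrow> D (v i) = e i" by metis
  obtain \<beta>M NM where \<beta>M: "open NM" "p z0 \<in> NM" "NM \<subseteq> Q" "\<And>y. y \<in> NM \<Longrightarrow> \<beta>M y = (1::real)"
    "\<And>h. smooth_on (model M) (\<psi> ` Q) h \<Longrightarrow> (\<lambda>y. if y \<in> Q then complex_of_real (\<beta>M y) * h (\<psi> y) else 0) \<in> ?A"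
    using M.chart_cutoff[OF Q(1) M.chart(1)[OF Q(1)] subset_refl Q(2)] by blast
  \<comment> \<open>Coordinates made global by a cutoff. The patch \<open>W\<close> will lie over
    \<open>NM\<close>, where the cutoff is 1 and the \<open>x i\<close> are the true
    coordinates.\<close>
  define x where "x i y = (if y \<in> Q then complex_of_real (\<beta>M y) * complex_of_real (\<psi> y \<bullet> e i) else 0)" for i y
  have x_in: "x i \<in> ?A" for i
    unfolding x_def[abs_def]
    by (rule \<beta>M(5)) (intro smooth_on_bounded_linear[OF bounded_linear_of_real]
        smooth_on_bounded_linear[OF bounded_linear_inner_left] smooth_on_id)
  have x_eq: "x i y = complex_of_real (\<psi> y \<bullet> e i)" if "y \<in> NM" for i y
    using that \<beta>M(3,4) by (auto simp: x_def)
  define NP where "NP = U \<inter> p -` NM"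
  have NP: "open NP" "NP \<subseteq> U" "z0 \<in> NP"
    using P.chart(1)[OF U(1)] open_preimage[OF \<beta>M(1)] U(2) \<beta>M(2) by (auto simp: NP_def)
  obtain \<beta>P NP' where \<beta>P: "z0 \<in> NP'" "\<And>y. y \<in> NP' \<Longrightarrow> \<beta>P y = (1::real)"
    "\<And>h. smooth_on (model P) (\<phi> ` NP) h \<Longrightarrow> (\<lambda>y. if y \<in> NP then complex_of_real (\<beta>P y) * h (\<phi> y) else 0) \<in> ?S"
    using P.chart_cutoff[OF U(1) NP] by blast
  define Y where "Y i = chart_field \<beta>P NP U \<phi> (v i)" for i
  have Y_linear: "linear_op ?S ?S (Y i)" if "i < d" for i
    unfolding Y_def by (rule P.chart_field(1)[OF U(1) NP(1,2) v(1)[OF that] \<beta>P(3)])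
  have Y_mult: "Y i (f * g) = Y i f * g + f * Y i g" if "i < d" "f \<in> ?S" "g \<in> ?S" for i f g
    unfolding Y_def by (rule P.chart_field(2)[OF U(1) NP(1,2) v(1)[OF that(1)] \<beta>P(3) that(2,3)])
  define m where "m i j = Y i (x j \<circ> p)" for i j
  have m_in: "m i j \<in> ?S" if "i < d" "j < d" for i j
    unfolding m_def using linear_opD(1)[OF Y_linear[OF that(1)] pull[OF x_in]] .
  have m_z0: "m i j z0 = (if i = j then 1 else 0)" if i: "i < d" and j: "j < d" for i j
  proof -
    have z0: "\<phi> z0 \<in> \<phi> ` NP" using NP(3) by blast
    have "(q has_derivative D) (at (\<phi> z0) within \<phi> ` NP)"
      by (rule has_derivative_subset[OF D(1)]) (use \<beta>M(3) in \<open>auto simp: NP_def\<close>)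
    then have "((\<lambda>y. complex_of_real (q y \<bullet> e j)) has_derivative (\<lambda>v. complex_of_real (D v \<bullet> e j)))
        (at (\<phi> z0) within \<phi> ` NP)"
      by (intro bounded_linear.has_derivative[OF bounded_linear_of_real]
          bounded_linear.has_derivative[OF bounded_linear_inner_left])
    then have "(((x j \<circ> p) \<circ> inv_into U \<phi>) has_derivative (\<lambda>v. complex_of_real (D v \<bullet> e j)))
        (at (\<phi> z0) within \<phi> ` NP)"
      by (rule has_derivative_transform[OF z0, rotated])
        (auto simp: q_def x_eq NP_def P.chart_inj[OF U(1)])
    from dir_deriv_eq[OF P.subspace_V P.chart_open_image[OF U(1) NP(1,2)] z0 v(1)[OF i] this]
    have "dir_deriv (v i) ((x j \<circ> p) \<circ> inv_into U \<phi>) (\<phi> z0) = complex_of_real (e i \<bullet> e j)"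
      by (simp only: v(2)[OF i])
    then show ?thesis
      using NP(3) \<beta>P(1,2) by (simp add: m_def Y_def chart_field_def e_orth[OF i j])
  qed
  obtain c N1 where c: "\<forall>i<d. \<forall>k<d. c i k \<in> ?S \<and> c i k z0 = (if i = k then 1 else 0)"
    and N1: "open N1" "z0 \<in> N1"
    and cm: "\<forall>y\<in>N1. \<forall>i<d. \<forall>j<d. (\<Sum>k<d. c i k y * m k j y) = (if i = j then 1 else 0)"
    using P.local_matrix_inverse[of d m z0 d] m_in m_z0 by blast
  \<comment> \<open>With the rows of the inverse matrix as coefficients,
    \<open>X i (x j \<circ> p)\<close> is the product of that inverse with \<open>m\<close>.\<close>
  define X where "X i f = (\<Sum>k<d. c i k * Y k f)" for i f
  define W where "W = N1 \<inter> NP"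
  have "local_frame ?S ?A p W d x X"
  proof unfold_locales
    show "open W" using N1 NP by (auto simp: W_def)
    show "x i \<in> ?A" for i by (rule x_in)
    show "linear_op ?S ?S (X i)" if "i < d" for i
      unfolding X_def[abs_def]
      by (intro linear_op_sum S linear_op_mult_left Y_linear) (use c that in auto)
    show "X i (f * g) = X i f * g + f * X i g" if "i < d" "f \<in> ?S" "g \<in> ?S" for i f g
    proof -
      have "X i (f * g) = (\<Sum>k<d. (c i k * Y k f) * g + f * (c i k * Y k g))"
        unfolding X_def using that by (intro sum.cong refl) (simp add: Y_mult algebra_simps)
      then show ?thesis
        by (simp add: X_def sum.distrib sum_distrib_left sum_distrib_right)
    qed
    show "X i (x j \<circ> p) z = (if i = j then 1 else 0)" if "i < d" "j < d" "z \<in> W" for i j z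
      using cm that by (simp add: X_def m_def W_def sum_fun_apply times_fun_apply)
    show "\<exists>g U. (\<forall>i<d. g i \<in> ?A) \<and> open U \<and> p z \<in> U \<and>
        (\<forall>y\<in>U. b y = b (p z) + (\<Sum>i<d. (x i y - x i (p z)) * g i y))" if z: "z \<in> W" and b: "b \<in> ?A" for z b
    proof -
      have pz: "p z \<in> NM" using z by (simp add: W_def NP_def)
      \<comment> \<open>The frame is indexed by numbers but the Hadamard formula by basis vectors;
        injectivity of \<open>e\<close> converts the sums.\<close>
      have inj: "inj_on e {..<d}"
      proof (rule inj_onI)
        fix i j assume "i \<in> {..<d}" "j \<in> {..<d}" "e i = e j"
        then show "i = j" using e_orth[of i j] e_orth[of i i] by (auto split: if_splits)
      qed
      have B: "finite (e ` {..<d})" "e ` {..<d} \<subseteq> model M"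
        "\<And>x. x \<in> model M \<Longrightarrow> x = (\<Sum>e\<in>e ` {..<d}. (x \<bullet> e) *\<^sub>R e)"
        using e_in e_expand by (auto simp: sum.reindex[OF inj])
      obtain g O' where g: "\<And>e'. e' \<in> e ` {..<d} \<Longrightarrow> g e' \<in> ?A" and O': "open O'" "p z \<in> O'" "O' \<subseteq> NM"
        and eq: "\<And>y. y \<in> O' \<Longrightarrow> b y = b (p z) +
          (\<Sum>e'\<in>e ` {..<d}. complex_of_real ((\<psi> y - \<psi> (p z)) \<bullet> e') * g e' y)"
        using M.chart_hadamard[OF Q(1) \<beta>M(1,3) pz b B] by blast
      have "b y = b (p z) + (\<Sum>i<d. (x i y - x i (p z)) * g (e i) y)" if "y \<in> O'" for y
      proof -
        have "y \<in> NM" using that O'(3) by blast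
        then show ?thesis
          using eq[OF that] by (simp add: sum.reindex[OF inj] x_eq pz inner_diff_left)
      qed
      then have "\<forall>y\<in>O'. b y = b (p z) + (\<Sum>i<d. (x i y - x i (p z)) * g (e i) y)" by blast
      moreover have "\<forall>i<d. g (e i) \<in> ?A" using g by simp
      ultimately show ?thesis
        using O'(1,2) by (intro exI[of _ "\<lambda>i. g (e i)"] exI[of _ O'] conjI)
    qed
  qed
  then show ?thesis using N1(2) NP(3) by (intro exI[of _ W]) (auto simp: W_def)
qed

text \<open>The Lindelof property leaves a sequence of patches. With \<open>\<eta> n\<close> the
  product of the \<open>n\<close>-th cutoff and all \<open>1 - b (s j)\<close> for
  \<open>j < n\<close>, partial sums telescope, and wherever some cutoff is 1 all later terms
  vanish. This gives local finiteness without refining the cover. One basis of the base model serves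
  every patch, so \<open>d\<close> is common to all.\<close>

lemma framed: "\<exists>W d x X \<eta>. framed_submersion (smooth_functions P) (smooth_functions M) p W d x X \<eta>"
proof -
  let ?S = "smooth_functions P" and ?A = "smooth_functions M"
  obtain B where B: "finite B" "B \<subseteq> model M" "\<And>x y. x \<in> B \<Longrightarrow> y \<in> B \<Longrightarrow> x \<bullet> y = (if x = y then 1 else 0)"
    "\<And>x. x \<in> model M \<Longrightarrow> x = (\<Sum>e\<in>B. (x \<bullet> e) *\<^sub>R e)"
    using orthonormal_expansion_subspace[OF M.subspace_V] by metis
  define d where "d = card B"
  obtain e where e: "bij_betw e {..<d} B"
    using ex_bij_betw_nat_finite[OF B(1)] by (auto simp: d_def atLeast0LessThan)
  have e_B: "e i \<in> B" if "i < d" for i using bij_betwE[OF e] that by blast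
  have e_in: "e i \<in> model M" if "i < d" for i using e_B[OF that] B(2) by blast
  have e_orth: "e i \<bullet> e j = (if i = j then 1 else 0)" if "i < d" "j < d" for i j
    using B(3)[OF e_B e_B, OF that] bij_betw_imp_inj_on[OF e] that by (auto simp: inj_on_def)
  have e_expand: "y = (\<Sum>i<d. (y \<bullet> e i) *\<^sub>R e i)" if "y \<in> model M" for y
    using B(4)[OF that] sum.reindex_bij_betw[OF e, of "\<lambda>e. (y \<bullet> e) *\<^sub>R e"] by simp
  have "\<forall>z. \<exists>W x X. z \<in> W \<and> local_frame ?S ?A p W d x X"
    using local_frame_exists[of d e] e_in e_orth e_expand by blast
  then obtain W x X where frame: "\<And>z. z \<in> W z" "\<And>z. local_frame ?S ?A p (W z) d (x z) (X z)" by metis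
  have "\<forall>z. \<exists>b N. b \<in> ?S \<and> open N \<and> z \<in> N \<and> (\<forall>y\<in>N. b y = 1) \<and> (\<forall>y. y \<notin> W z \<longrightarrow> b y = 0)"
  proof
    fix z
    obtain b N where "b \<in> ?S" "open N" "z \<in> N" "\<And>y. y \<in> N \<Longrightarrow> b y = 1" "\<And>y. y \<notin> W z \<Longrightarrow> b y = 0"
      using P.smooth_cutoff[OF local_frame.open_W[OF frame(2)] frame(1), of z] by metis
    then show "\<exists>b N. b \<in> ?S \<and> open N \<and> z \<in> N \<and> (\<forall>y\<in>N. b y = 1) \<and> (\<forall>y. y \<notin> W z \<longrightarrow> b y = 0)"
      by (intro exI[of _ b] exI[of _ N]) simp
  qed
  then obtain b N where b: "\<And>z. b z \<in> ?S" "\<And>z. open (N z)" "\<And>z. z \<in> N z"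
    "\<And>z y. y \<in> N z \<Longrightarrow> b z y = 1" "\<And>z y. y \<notin> W z \<Longrightarrow> b z y = 0" by metis
  obtain F where F: "F \<subseteq> range N" "countable F" "\<Union>F = \<Union>(range N)"
    using Lindelof[of "range N"] b(2) by (metis imageE)
  have cover: "\<Union>F = UNIV" using F(3) b(3) by blast
  then have "F \<noteq> {}" by auto
  then have F_range: "range (from_nat_into F) = F" using F(2) by (rule range_from_nat_into)
  have "\<forall>n. \<exists>z. from_nat_into F n = N z" using F(1) F_range by blast
  then obtain s where s: "\<And>n. from_nat_into F n = N (s n)" by metis
  have cover': "\<exists>n. z \<in> N (s n)" for z
    using cover F_range s by (metis UNIV_I UnionE imageE)
  define \<eta> where "\<eta> n = b (s n) * (\<Prod>j<n. 1 - b (s j))" for n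
  have prod_apply: "(\<Prod>j<n. 1 - b (s j)) y = (\<Prod>j<n. 1 - b (s j) y)" for n y
    by (induction n) (simp_all add: pointwise)
  have partial: "(\<Sum>n<m. \<eta> n z) = 1 - (\<Prod>j<m. 1 - b (s j) z)" for m z
    by (induction m) (simp_all add: \<eta>_def pointwise prod_apply algebra_simps)
  have zero: "\<eta> n y = 0" if "y \<in> N (s m)" "m < n" for m n y
  proof -
    have "(\<Prod>j<n. 1 - b (s j) y) = 0"
      using that b(4) by (intro prod_zero) (auto intro!: bexI[of _ m])
    then show ?thesis by (simp add: \<eta>_def pointwise prod_apply)
  qed
  have "framed_submersion ?S ?A p (\<lambda>n. W (s n)) d (\<lambda>n. x (s n)) (\<lambda>n. X (s n)) \<eta>"
  proof (rule framed_submersion.intro[OF pulled_back_algebra_axioms framed_submersion_axioms.intro])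
    show "local_frame ?S ?A p (W (s n)) d (x (s n)) (X (s n))" for n by (rule frame(2))
    show "f \<in> ?S" if "\<And>z. \<exists>g\<in>?S. \<exists>U. open U \<and> z \<in> U \<and> (\<forall>y\<in>U. f y = g y)" for f
      using P.smooth_functions_locally[OF that] .
    show "\<eta> n \<in> ?S" for n
    proof -
      have "(\<Prod>j<n. 1 - b (s j)) \<in> ?S"
        by (induction n) (simp_all only: prod.lessThan_Suc lessThan_0 prod.empty Sc b)
      then show ?thesis unfolding \<eta>_def by (intro Sc b)
    qed
    show "z \<in> W (s n)" if "\<eta> n z \<noteq> 0" for n z
      using that b(5) by (auto simp: \<eta>_def pointwise)
    show "\<exists>U m. open U \<and> z \<in> U \<and> (\<forall>n\<ge>m. \<forall>y\<in>U. \<eta> n y = 0)" for z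
    proof -
      obtain m where "z \<in> N (s m)" using cover' by blast
      then show ?thesis using zero b(2) by (intro exI[of _ "N (s m)"] exI[of _ "Suc m"]) auto
    qed
    show "(\<Sum>n<m. \<eta> n z) = 1" if m: "\<And>n. n \<ge> m \<Longrightarrow> \<eta> n z = 0" for m z
    proof -
      obtain l where l: "z \<in> N (s l)" using cover' by blast
      have "(\<Sum>n<m. \<eta> n z) = (\<Sum>n<max m (Suc l). \<eta> n z)"
        using m by (intro sum.mono_neutral_left) auto
      also have "\<dots> = 1"
      proof -
        have "(\<Prod>j<max m (Suc l). 1 - b (s j) z) = 0"
          using l b(4) by (intro prod_zero) (auto intro!: bexI[of _ l])
        then show ?thesis by (simp only: partial diff_zero)
      qed
      finally show ?thesis .
    qed
  qed
  then show ?thesis by blast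
qed

end

section \<open>Transfer to smooth manifolds\<close>

lemma bidifferential_operator_iff:
  assumes "function_algebra (smooth_functions P)" "function_algebra (smooth_functions M)"
  shows "bidifferential_operator P M p B \<longleftrightarrow> (\<exists>k l. bidiff (smooth_functions P) (smooth_functions M) p k l B)"
  unfolding bidifferential_operator_def bidiff_def bidiff_op_below_iff[OF assms] by blast

theorem theorem1p5:
  fixes P :: "('p::{t2_space, second_countable_topology}, 'e::euclidean_space) manifold"
    and M :: "('m::{t2_space, second_countable_topology}, 'f::euclidean_space) manifold"
    and p :: "'p \<Rightarrow> 'm"
    and star :: "('m \<Rightarrow> complex) fps \<Rightarrow> ('m \<Rightarrow> complex) fps \<Rightarrow> ('m \<Rightarrow> complex) fps"
  assumes "smooth_manifold P"
    and "smooth_manifold M"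
    and "surjective_submersion P M p"
    and "star_product M star"
  shows "(\<exists>act. deformation_quantization P M p star act) \<and>
         (\<forall>act act'. deformation_quantization P M p star act \<longrightarrow>
            deformation_quantization P M p star act' \<longrightarrow>
            equivalent_quantizations P M act act') \<and>
         (\<exists>act. deformation_quantization P M p star act \<and> preserves_fibration M p star act)"
proof -
  let ?S = "smooth_functions P" and ?A = "smooth_functions M"
  interpret submersion P M p
    using assms by unfold_locales
  obtain W d x X \<eta> where framed: "framed_submersion ?S ?A p W d x X \<eta>"
    using framed by blast
  interpret framed_submersion ?S ?A p W d x X \<eta> by (rule framed)
  obtain C where C: "\<And>r. bidifferential_operator M M id (C r)"
    "\<And>a b. a \<in> ?A \<Longrightarrow> b \<in> ?A \<Longrightarrow> C 0 a b = a * b"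
    "\<And>a b. a \<in> formal ?A \<Longrightarrow> b \<in> formal ?A \<Longrightarrow> star a b = formal_biop C a b"
    using assms(4) unfolding star_product_def formal_functions_eq by blast
  have star_assoc: "star (star a b) c = star a (star b c)"
    if "a \<in> formal ?A" "b \<in> formal ?A" "c \<in> formal ?A" for a b c
    using assms(4) that unfolding star_product_def formal_functions_eq by blast
  have star_one: "star 1 a = a" "star a 1 = a" if "a \<in> formal ?A" for a
    using assms(4) that unfolding star_product_def formal_functions_eq by blast+
  have C_bidiff: "\<exists>k l. bidiff ?A ?A id k l (C r)" for r
    using C(1) bidifferential_operator_iff[OF A A] by blast
  interpret C: bilinear_family ?A ?A ?A C
    by (rule pulled_back_algebra.bidiff_family_bilinear[OF base_algebra C_bidiff])
  have one_in: "(1 :: ('m \<Rightarrow> complex) fps) \<in> formal ?A"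
    using formal_const[OF A Ac(5)] by simp
  interpret star_submersion ?S ?A p W d x X \<eta> C
  proof unfold_locales
    show "formal_biop C (formal_biop C F G) H = formal_biop C F (formal_biop C G H)"
      if "F \<in> formal ?A" "G \<in> formal ?A" "H \<in> formal ?A" for F G H
      using star_assoc[OF that] by (simp add: C(3) C.biop_in that)
    \<comment> \<open>Compare the coefficients of order \<open>r\<close> in the unit law for a
      constant series \<open>a\<close>; for \<open>r > 0\<close> its right-hand side is
      zero.\<close>
    show "C r 1 a = 0" if "r > 0" "a \<in> ?A" for r a
      using arg_cong[OF star_one(1)[OF formal_const[OF A that(2)]], of "\<lambda>f. f $ r"] that
        C.biop_const_const[OF Ac(5) that(2), of r]
      by (simp add: C(3)[OF one_in formal_const[OF A that(2)]])
    show "C r a 1 = 0" if "r > 0" "a \<in> ?A" for r a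
      using arg_cong[OF star_one(2)[OF formal_const[OF A that(2)]], of "\<lambda>f. f $ r"] that
        C.biop_const_const[OF that(2) Ac(5), of r]
      by (simp add: C(3)[OF formal_const[OF A that(2)] one_in])
  qed (fact C_bidiff C(2))+
  obtain \<rho> where \<rho>: "\<And>r. quantization_up_to r \<rho>"
    using quantization_exists by blast
  note module = quantization_module[OF \<rho>]
  interpret \<rho>: bilinear_family ?S ?A ?S \<rho> by (rule module(1))
  have quantization: "deformation_quantization P M p star (formal_biop \<rho>)"
    unfolding deformation_quantization_def formal_functions_eq
  proof (intro conjI)
    show "\<exists>\<rho>'. (\<forall>r. bidifferential_operator P M p (\<rho>' r)) \<and>
        (\<forall>f\<in>?S. \<forall>a\<in>?A. \<rho>' 0 f a = f * (a \<circ> p)) \<and>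
        (\<forall>f\<in>formal ?S. \<forall>a\<in>formal ?A. formal_biop \<rho> f a = formal_biop \<rho>' f a)"
    proof (intro exI[of _ \<rho>] conjI)
      show "\<forall>r. bidifferential_operator P M p (\<rho> r)"
        using \<rho> unfolding bidifferential_operator_iff[OF S A] quantization_up_to_def by blast
      show "\<forall>f\<in>?S. \<forall>a\<in>?A. \<rho> 0 f a = f * (a \<circ> p)"
        using \<rho>[of 0] unfolding quantization_up_to_def by blast
    qed simp
    show "formal_bilinear P M (formal_biop \<rho>)"
      unfolding formal_bilinear_def formal_functions_eq
      using \<rho>.biop_add_left \<rho>.biop_add_right \<rho>.biop_scalar by blast
    show "\<forall>f\<in>formal ?S. \<forall>a\<in>formal ?A. \<forall>b\<in>formal ?A.
        formal_biop \<rho> (formal_biop \<rho> f a) b = formal_biop \<rho> f (star a b)"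
      using module(2) C(3) by simp
    show "\<forall>f\<in>formal ?S. formal_biop \<rho> f 1 = f" using module(3) by blast
  qed
  moreover have "preserves_fibration M p star (formal_biop \<rho>)"
    unfolding preserves_fibration_def formal_functions_eq using module(4) C(3) by simp
  moreover have "equivalent_quantizations P M act act'"
    if act: "deformation_quantization P M p star act" "deformation_quantization P M p star act'" for act act'
  proof -
    \<comment> \<open>An action is known only on formal functions, where it coincides with the
      series of its coefficient operators. The module law is carried over to that series, to which
      the abstract uniqueness result applies.\<close>
    have ex: "\<exists>\<sigma>. (\<forall>r. \<exists>k l. bidiff ?S ?A p k l (\<sigma> r)) \<and> (\<forall>f\<in>?S. \<forall>a\<in>?A. \<sigma> 0 f a = f * (a \<circ> p)) \<and>
        (\<forall>F\<in>formal ?S. \<forall>a\<in>formal ?A. act F a = formal_biop \<sigma> F a) \<and>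
        (\<forall>F\<in>formal ?S. \<forall>a\<in>formal ?A. \<forall>b\<in>formal ?A.
          formal_biop \<sigma> (formal_biop \<sigma> F a) b = formal_biop \<sigma> F (formal_biop C a b))"
      if act: "deformation_quantization P M p star act" for act
    proof -
      obtain \<sigma> where \<sigma>: "\<And>r. bidifferential_operator P M p (\<sigma> r)"
        "\<And>f a. f \<in> ?S \<Longrightarrow> a \<in> ?A \<Longrightarrow> \<sigma> 0 f a = f * (a \<circ> p)"
        "\<And>F a. F \<in> formal ?S \<Longrightarrow> a \<in> formal ?A \<Longrightarrow> act F a = formal_biop \<sigma> F a"
        using act unfolding deformation_quantization_def formal_functions_eq by blast
      have bd: "\<exists>k l. bidiff ?S ?A p k l (\<sigma> r)" for r
        using \<sigma>(1) bidifferential_operator_iff[OF S A] by blast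
      interpret \<sigma>: bilinear_family ?S ?A ?S \<sigma> by (rule bidiff_family_bilinear[OF bd])
      have "act (act F a) b = act F (star a b)"
        if "F \<in> formal ?S" "a \<in> formal ?A" "b \<in> formal ?A" for F a b
        using act that unfolding deformation_quantization_def formal_functions_eq by blast
      then have "formal_biop \<sigma> (formal_biop \<sigma> F a) b = formal_biop \<sigma> F (formal_biop C a b)"
        if "F \<in> formal ?S" "a \<in> formal ?A" "b \<in> formal ?A" for F a b
        using that by (simp add: \<sigma>(3) C(3) \<sigma>.biop_in C.biop_in)
      then show ?thesis using bd \<sigma>(2,3) by (intro exI[of _ \<sigma>]) simp
    qed
    obtain \<sigma> where \<sigma>: "\<forall>r. \<exists>k l. bidiff ?S ?A p k l (\<sigma> r)" "\<forall>f\<in>?S. \<forall>a\<in>?A. \<sigma> 0 f a = f * (a \<circ> p)"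
        "\<forall>F\<in>formal ?S. \<forall>a\<in>formal ?A. act F a = formal_biop \<sigma> F a"
        "\<forall>F\<in>formal ?S. \<forall>a\<in>formal ?A. \<forall>b\<in>formal ?A.
          formal_biop \<sigma> (formal_biop \<sigma> F a) b = formal_biop \<sigma> F (formal_biop C a b)"
      using ex[OF act(1)] by blast
    obtain \<tau> where \<tau>: "\<forall>r. \<exists>k l. bidiff ?S ?A p k l (\<tau> r)" "\<forall>f\<in>?S. \<forall>a\<in>?A. \<tau> 0 f a = f * (a \<circ> p)"
        "\<forall>F\<in>formal ?S. \<forall>a\<in>formal ?A. act' F a = formal_biop \<tau> F a"
        "\<forall>F\<in>formal ?S. \<forall>a\<in>formal ?A. \<forall>b\<in>formal ?A.
          formal_biop \<tau> (formal_biop \<tau> F a) b = formal_biop \<tau> F (formal_biop C a b)"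
      using ex[OF act(2)] by blast
    have "\<exists>T. (\<forall>r. linear_op ?S ?S (T r) \<and> (\<exists>k. diff_op_along ?S id k (T r))) \<and> (\<forall>f\<in>?S. T 0 f = f) \<and>
        (\<forall>F\<in>formal ?S. \<forall>a\<in>formal ?A. formal_op T (formal_biop \<sigma> F a) = formal_biop \<tau> (formal_op T F) a)"
      by (rule quantizations_equivalent) (use \<sigma> \<tau> in blast)+
    then obtain T where T: "\<And>r. linear_op ?S ?S (T r)" "\<And>r. \<exists>k. diff_op_along ?S id k (T r)"
      "\<And>f. f \<in> ?S \<Longrightarrow> T 0 f = f"
      "\<And>F a. F \<in> formal ?S \<Longrightarrow> a \<in> formal ?A \<Longrightarrow>
        formal_op T (formal_biop \<sigma> F a) = formal_biop \<tau> (formal_op T F) a"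
      by blast
    interpret T: linear_family ?S T by unfold_locales (rule S T(1))+
    show ?thesis
      unfolding equivalent_quantizations_def formal_functions_eq differential_operator_def
        diff_op_below_iff_along
      using T \<sigma>(3) \<tau>(3) T.op_in by (intro exI[of _ T]) simp
  qed
  ultimately show ?thesis by blast
qed

end
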